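(* Let $x,y$ be nonzero elements of $\mathcal A_{kl}$, with $k\ne l$. Then $$\Phi_r(x,y,x^*,y^* )\ \ge\ \Phi_r(x,x^* )+\Phi_r(y,y^* ),$$ and equality holds if $x,y$ are free with amalgamation over $\mathcal D$. Moreover, if $$\Phi_r(x,y,x^*,y^* )=\Phi_r(x,x^* )+\Phi_r(y,y^* )<\infty,$$ then $x,y$ are free with amalgamation over $\mathcal D$.
   Context: $(\mathcal A,\varphi)$ is a $W^*$-probability space with $\varphi$ a faithful tracial state, with nonzero self-adjoint pairwise orthogonal projections $p_1,\dots,p_d$ with sum $1$; $\rho_i=\varphi(p_i)$; $\mathcal D=\mathrm{Span}\{p_1,\dots,p_d\}$; $\mathcal A_{ij}=p_i\mathcal Ap_j$; $\varphi_i=\rho_i^{-1}\varphi|_{\mathcal A_{ii}}$; $E(x)=\sum_i\varphi_i(p_ixp_i)p_i$ is the conditional expectation onto $\mathcal D$. $*$-subalgebras $(\mathcal A_i)$ containing $\mathcal D$ are free with amalgamation over $\mathcal D$ if $E(x(1)\cdots x(m))=0$ whenever $i_1\ne\cdots\ne i_m$ (consecutive indices distinct) and $x(j)\in\mathcal A_{i_j}\cap\ker E$; elements are free with amalgamation over $\mathcal D$ if they belong respectively to such $*$-subalgebras. $L^2(\mathcal A)$ is the completion of $\mathcal A$ for $\|a\|_2=\varphi(aa^* )^{1/2}$, an $\mathcal A$-bimodule to which $*$ extends; $L^2(\mathcal A)_{ij}=p_iL^2(\mathcal A)p_j$, and $\varphi_i$ extends to $L^2(\mathcal A)_{ii}$.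 Simple elements of $L^2(\mathcal A)$ are the nonzero elements of $\bigcup_{i,j}L^2(\mathcal A)_{ij}$; for such $x\in L^2(\mathcal A)_{ij}$, put $r(x)=i$, $c(x)=j$. A finite sequence $(x_1,\dots,x_m)$ of simple elements is a square sequence if $c(x_i)=r(x_{i+1})$ for all $i$, with $x_{m+1}:=x_1$. Let $(a_i)_{i\in I}$ be a self-adjoint family of simple elements of $\mathcal A$ (i.e. there is an involution $*$ of $I$ with $a_i^*=a_{*(i)}$). A family $(\xi_i)_{i\in I}$ of simple elements of $L^2(\mathcal A)$ fulfills conjugate relations for $(a_i)_{i\in I}$ if for all $i$, $r(\xi_i)=c(a_i)$, $c(\xi_i)=r(a_i)$, and for all $n\ge0$ and $i,i_1,\dots,i_n\in I$ such that $(\xi_i,a_{i_1},\dots,a_{i_n})$ is a square sequence, $$\varphi_{r(\xi_i)}(\xi_ia_{i_1}\cdots a_{i_n})=\sum_{m=1}^n\delta_{i,i_m}\,\varphi_{c(\xi_i)}(a_{i_1}\cdots a_{i_{m-1}})\,\varphi_{r(\xi_i)}(a_{i_{m+1}}\cdots a_{i_n}),$$ where $\varphi_j$ of an empty product is $1$. It is a conjugate system if moreover every $\xi_i$ lies in the $\|\cdot\|_2$-closure of the algebra generated by $\{a_i:i\in I\}\cup\mathcal D$ (it is then unique). The Fisher information is $\Phi_r((a_i)_{i\in I})=\sum_{i\in I}\|\xi_i\|_2^2$ if $(\xi_i)$ is a conjugate system, and $\infty$ if there is no conjugate system. Here it is applied to the families $(x,y,x^*,y^* )$ (four indices), $(x,x^*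 )$ and $(y,y^* )$. *)

theory Defs
  imports "HOL-Analysis.Analysis"
begin

class scaleC =
  fixes scaleC :: "complex \<Rightarrow> 'a \<Rightarrow> 'a"  (infixr \<open>*\<^sub>C\<close> 75)

class complex_normed_vector = real_normed_vector + scaleC +
  assumes scaleC_add_right: "c *\<^sub>C (x + y) = c *\<^sub>C x + c *\<^sub>C y"
    and scaleC_add_left: "(b + c) *\<^sub>C x = b *\<^sub>C x + c *\<^sub>C x"
    and scaleC_scaleC: "b *\<^sub>C (c *\<^sub>C x) = (b * c) *\<^sub>C x"
    and scaleR_scaleC: "r *\<^sub>R x = complex_of_real r *\<^sub>C x"
    and norm_scaleC: "norm (c *\<^sub>C x) = cmod c * norm x"

text \<open>The real inner product of a complex Hilbert space is the real part of the complex one,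
  which is recovered from it because multiplication by the imaginary unit is isometric.\<close>

class complex_hilbert_space = complex_normed_vector + real_inner + complete_space

class cstar_algebra = complex_normed_vector + real_normed_algebra_1 + complete_space +
  fixes star :: "'a \<Rightarrow> 'a"
  assumes mult_scaleC_left: "(c *\<^sub>C x) * y = c *\<^sub>C (x * y)"
    and mult_scaleC_right: "x * (c *\<^sub>C y) = c *\<^sub>C (x * y)"
    and star_star: "star (star x) = x"
    and star_add: "star (x + y) = star x + star y"
    and star_scaleC: "star (c *\<^sub>C x) = cnj c *\<^sub>C star x"
    and star_mult: "star (x * y) = star y * star x"
    and norm_star_mult: "norm (star x * x) = (norm x)\<^sup>2"

definition bounded_functional :: "('a::complex_normed_vector \<Rightarrow> complex) \<Rightarrow> bool" where
  "bounded_functional f \<longleftrightarrow> bounded_linear f \<and> (\<forall>c x. f (c *\<^sub>C x) = c * f x)"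

text \<open>A predual of \<open>'a\<close> is represented by its canonical image \<open>V\<close> in the dual of \<open>'a\<close>:
  a norm-closed space of bounded functionals for which evaluation is an isometric
  isomorphism of \<open>'a\<close> onto the dual of \<open>V\<close>. The C*-algebras that have a predual are the
  W*-algebras (Sakai), and the elements of the predual are their normal functionals.\<close>

definition predual :: "('a::complex_normed_vector \<Rightarrow> complex) set \<Rightarrow> bool" where
  "predual V \<longleftrightarrow>
     (\<forall>f\<in>V. bounded_functional f) \<and>
     (\<lambda>x. 0) \<in> V \<and>
     (\<forall>f\<in>V. \<forall>g\<in>V. (\<lambda>x. f x + g x) \<in> V) \<and>
     (\<forall>c. \<forall>f\<in>V. (\<lambda>x. c * f x) \<in> V) \<and>
     (\<forall>f g. (\<forall>n::nat. f n \<in> V) \<and> bounded_functional g \<and>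
        (\<lambda>n. onorm (\<lambda>x. f n x - g x)) \<longlonglongrightarrow> 0 \<longrightarrow> g \<in> V) \<and>
     (\<forall>a. norm a = (SUP f\<in>{f\<in>V. onorm f \<le> 1}. cmod (f a))) \<and>
     (\<forall>F :: ('a \<Rightarrow> complex) \<Rightarrow> complex.
        (\<forall>f\<in>V. \<forall>g\<in>V. F (\<lambda>x. f x + g x) = F f + F g) \<and>
        (\<forall>c. \<forall>f\<in>V. F (\<lambda>x. c * f x) = c * F f) \<and>
        (\<exists>B. \<forall>f\<in>V. cmod (F f) \<le> B * onorm f) \<longrightarrow>
        (\<exists>a. \<forall>f\<in>V. F f = f a))"

text \<open>The state of a W*-probability space is normal, as usual.\<close>

definition wstar_probability_space :: "('a::cstar_algebra \<Rightarrow> complex) \<Rightarrow> bool" where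
  "wstar_probability_space \<phi> \<longleftrightarrow>
     (\<exists>V. predual V \<and> \<phi> \<in> V) \<and> \<phi> 1 = 1 \<and> (\<forall>x. Im (\<phi> (star x * x)) = 0 \<and> Re (\<phi> (star x * x)) \<ge> 0)"

definition faithful :: "('a::cstar_algebra \<Rightarrow> complex) \<Rightarrow> bool" where
  "faithful \<phi> \<longleftrightarrow> (\<forall>x. \<phi> (star x * x) = 0 \<longrightarrow> x = 0)"

definition tracial :: "('a::cstar_algebra \<Rightarrow> complex) \<Rightarrow> bool" where
  "tracial \<phi> \<longleftrightarrow> (\<forall>x y. \<phi> (x * y) = \<phi> (y * x))"

definition projection_partition :: "nat \<Rightarrow> (nat \<Rightarrow> 'a::cstar_algebra) \<Rightarrow> bool" where
  "projection_partition d p \<longleftrightarrow>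
     (\<forall>i\<in>{1..d}. p i \<noteq> 0 \<and> star (p i) = p i \<and> p i * p i = p i) \<and>
     (\<forall>i\<in>{1..d}. \<forall>j\<in>{1..d}. i \<noteq> j \<longrightarrow> p i * p j = 0) \<and>
     (\<Sum>i=1..d. p i) = 1"

definition diagonal :: "nat \<Rightarrow> (nat \<Rightarrow> 'a::cstar_algebra) \<Rightarrow> 'a set" where
  "diagonal d p = {\<Sum>i=1..d. c i *\<^sub>C p i | c. True}"

definition corner :: "(nat \<Rightarrow> 'a::cstar_algebra) \<Rightarrow> nat \<Rightarrow> nat \<Rightarrow> 'a set" where
  "corner p i j = {p i * a * p j | a. True}"

text \<open>\<open>\<phi>\<^sub>i\<close>; meant for elements of \<open>corner p i i\<close>.\<close>

definition state_at :: "('a::cstar_algebra \<Rightarrow> complex) \<Rightarrow> (nat \<Rightarrow> 'a) \<Rightarrow> nat \<Rightarrow> 'a \<Rightarrow> complex" where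
  "state_at \<phi> p i x = \<phi> x / \<phi> (p i)"

definition cond_exp :: "('a::cstar_algebra \<Rightarrow> complex) \<Rightarrow> nat \<Rightarrow> (nat \<Rightarrow> 'a) \<Rightarrow> 'a \<Rightarrow> 'a" where
  "cond_exp \<phi> d p x = (\<Sum>i=1..d. state_at \<phi> p i (p i * x * p i) *\<^sub>C p i)"

definition subalgebra :: "'a::cstar_algebra set \<Rightarrow> bool" where
  "subalgebra B \<longleftrightarrow> 0 \<in> B \<and> (\<forall>x\<in>B. \<forall>y\<in>B. x + y \<in> B \<and> x * y \<in> B) \<and> (\<forall>c. \<forall>x\<in>B. c *\<^sub>C x \<in> B)"

definition star_subalgebra :: "'a::cstar_algebra set \<Rightarrow> bool" where
  "star_subalgebra B \<longleftrightarrow> subalgebra B \<and> (\<forall>x\<in>B. star x \<in> B)"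

definition algebra_generated :: "'a::cstar_algebra set \<Rightarrow> 'a set" where
  "algebra_generated S = \<Inter>{B. subalgebra B \<and> S \<subseteq> B}"

definition free_subalgebras ::
    "('a::cstar_algebra \<Rightarrow> complex) \<Rightarrow> nat \<Rightarrow> (nat \<Rightarrow> 'a) \<Rightarrow> ('i \<Rightarrow> 'a set) \<Rightarrow> bool" where
  "free_subalgebras \<phi> d p B \<longleftrightarrow>
     (\<forall>i. star_subalgebra (B i) \<and> diagonal d p \<subseteq> B i) \<and>
     (\<forall>w :: ('i \<times> 'a) list.
        w \<noteq> [] \<and> distinct_adj (map fst w) \<and>
        (\<forall>(i, x)\<in>set w. x \<in> B i \<and> cond_exp \<phi> d p x = 0) \<longrightarrow>
        cond_exp \<phi> d p (prod_list (map snd w)) = 0)"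

definition free_elements ::
    "('a::cstar_algebra \<Rightarrow> complex) \<Rightarrow> nat \<Rightarrow> (nat \<Rightarrow> 'a) \<Rightarrow> ('i \<Rightarrow> 'a) \<Rightarrow> bool" where
  "free_elements \<phi> d p a \<longleftrightarrow> (\<exists>B. free_subalgebras \<phi> d p B \<and> (\<forall>i. a i \<in> B i))"

text \<open>\<open>emb\<close> is the inclusion of \<open>'a\<close> into \<open>L\<^sup>2\<close>, a completion of \<open>'a\<close> for the norm
  \<open>\<phi> (a a*)\<^bsup>1/2\<^esup>\<close>. The completion is determined up to unique isomorphism only, so
  it is a parameter; the operations on it are the continuous extensions of those of \<open>'a\<close>.\<close>

definition L2_completion ::
    "('a::cstar_algebra \<Rightarrow> complex) \<Rightarrow> ('a \<Rightarrow> 'h::complex_hilbert_space) \<Rightarrow> bool" where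
  "L2_completion \<phi> emb \<longleftrightarrow>
     (\<forall>a b. emb (a + b) = emb a + emb b) \<and>
     (\<forall>c a. emb (c *\<^sub>C a) = c *\<^sub>C emb a) \<and>
     (\<forall>a. norm (emb a) = sqrt (Re (\<phi> (a * star a)))) \<and>
     closure (range emb) = UNIV"

definition L2_extend :: "('a \<Rightarrow> 'h::complex_hilbert_space) \<Rightarrow> ('a \<Rightarrow> 'b::t2_space) \<Rightarrow> 'h \<Rightarrow> 'b" where
  "L2_extend emb f = (THE g. continuous_on UNIV g \<and> (\<forall>a. g (emb a) = f a))"

definition L2_lmult :: "('a::cstar_algebra \<Rightarrow> 'h::complex_hilbert_space) \<Rightarrow> 'a \<Rightarrow> 'h \<Rightarrow> 'h" where
  "L2_lmult emb a = L2_extend emb (\<lambda>b. emb (a * b))"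

definition L2_rmult :: "('a::cstar_algebra \<Rightarrow> 'h::complex_hilbert_space) \<Rightarrow> 'h \<Rightarrow> 'a \<Rightarrow> 'h" where
  "L2_rmult emb \<xi> a = L2_extend emb (\<lambda>b. emb (b * a)) \<xi>"

definition L2_corner ::
    "('a::cstar_algebra \<Rightarrow> 'h::complex_hilbert_space) \<Rightarrow> (nat \<Rightarrow> 'a) \<Rightarrow> nat \<Rightarrow> nat \<Rightarrow> 'h set" where
  "L2_corner emb p i j = {L2_rmult emb (L2_lmult emb (p i) \<xi>) (p j) | \<xi>. True}"

text \<open>The extension of \<open>\<phi>\<^sub>i\<close>; meant for elements of \<open>L2_corner emb p i i\<close>.\<close>

definition L2_state_at ::
    "('a::cstar_algebra \<Rightarrow> complex) \<Rightarrow> (nat \<Rightarrow> 'a) \<Rightarrow> ('a \<Rightarrow> 'h::complex_hilbert_space) \<Rightarrow>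
     nat \<Rightarrow> 'h \<Rightarrow> complex" where
  "L2_state_at \<phi> p emb i \<xi> = L2_extend emb \<phi> \<xi> / \<phi> (p i)"

text \<open>Since \<open>'a\<close> is included in \<open>L\<^sup>2\<close>, an element \<open>a\<close> of \<open>'a\<close> is simple if \<open>emb a\<close> is.\<close>

definition simple ::
    "nat \<Rightarrow> (nat \<Rightarrow> 'a::cstar_algebra) \<Rightarrow> ('a \<Rightarrow> 'h::complex_hilbert_space) \<Rightarrow> 'h \<Rightarrow> bool" where
  "simple d p emb \<xi> \<longleftrightarrow> \<xi> \<noteq> 0 \<and> \<xi> \<in> (\<Union>i\<in>{1..d}. \<Union>j\<in>{1..d}. L2_corner emb p i j)"

definition row ::
    "nat \<Rightarrow> (nat \<Rightarrow> 'a::cstar_algebra) \<Rightarrow> ('a \<Rightarrow> 'h::complex_hilbert_space) \<Rightarrow> 'h \<Rightarrow> nat" where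
  "row d p emb \<xi> = (THE i. i \<in> {1..d} \<and> (\<exists>j\<in>{1..d}. \<xi> \<in> L2_corner emb p i j))"

definition col ::
    "nat \<Rightarrow> (nat \<Rightarrow> 'a::cstar_algebra) \<Rightarrow> ('a \<Rightarrow> 'h::complex_hilbert_space) \<Rightarrow> 'h \<Rightarrow> nat" where
  "col d p emb \<xi> = (THE j. j \<in> {1..d} \<and> (\<exists>i\<in>{1..d}. \<xi> \<in> L2_corner emb p i j))"

definition square_sequence ::
    "nat \<Rightarrow> (nat \<Rightarrow> 'a::cstar_algebra) \<Rightarrow> ('a \<Rightarrow> 'h::complex_hilbert_space) \<Rightarrow> 'h list \<Rightarrow> bool" where
  "square_sequence d p emb xs \<longleftrightarrow>
     (\<forall>\<xi>\<in>set xs. simple d p emb \<xi>) \<and>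
     (\<forall>m<length xs. col d p emb (xs ! m) = row d p emb (xs ! (Suc m mod length xs)))"

text \<open>\<open>\<phi>\<^sub>j\<close> of a product, where the empty product stands for the unit \<open>p j\<close> of the corner
  and not for \<open>1\<close>.\<close>

definition state_at_word ::
    "('a::cstar_algebra \<Rightarrow> complex) \<Rightarrow> (nat \<Rightarrow> 'a) \<Rightarrow> nat \<Rightarrow> 'a list \<Rightarrow> complex" where
  "state_at_word \<phi> p j as = (if as = [] then 1 else state_at \<phi> p j (prod_list as))"

text \<open>In the list \<open>is\<close>, counted from \<open>0\<close>, the entry \<open>is ! m\<close> is preceded by \<open>take m is\<close> and
  followed by \<open>drop (Suc m) is\<close>.\<close>

definition conjugate_relations ::
    "('a::cstar_algebra \<Rightarrow> complex) \<Rightarrow> nat \<Rightarrow> (nat \<Rightarrow> 'a) \<Rightarrow> ('a \<Rightarrow> 'h::complex_hilbert_space) \<Rightarrow>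
     'i set \<Rightarrow> ('i \<Rightarrow> 'a) \<Rightarrow> ('i \<Rightarrow> 'h) \<Rightarrow> bool" where
  "conjugate_relations \<phi> d p emb I a \<xi> \<longleftrightarrow>
     (\<forall>i\<in>I. simple d p emb (\<xi> i)) \<and>
     (\<forall>i\<in>I. row d p emb (\<xi> i) = col d p emb (emb (a i)) \<and>
             col d p emb (\<xi> i) = row d p emb (emb (a i))) \<and>
     (\<forall>i\<in>I. \<forall>is. set is \<subseteq> I \<and> square_sequence d p emb (\<xi> i # map (\<lambda>j. emb (a j)) is) \<longrightarrow>
        L2_state_at \<phi> p emb (row d p emb (\<xi> i)) (L2_rmult emb (\<xi> i) (prod_list (map a is))) =
        (\<Sum>m<length is. if is ! m = i
           then state_at_word \<phi> p (col d p emb (\<xi> i)) (map a (take m is)) *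
                state_at_word \<phi> p (row d p emb (\<xi> i)) (map a (drop (Suc m) is))
           else 0))"

definition conjugate_system ::
    "('a::cstar_algebra \<Rightarrow> complex) \<Rightarrow> nat \<Rightarrow> (nat \<Rightarrow> 'a) \<Rightarrow> ('a \<Rightarrow> 'h::complex_hilbert_space) \<Rightarrow>
     'i set \<Rightarrow> ('i \<Rightarrow> 'a) \<Rightarrow> ('i \<Rightarrow> 'h) \<Rightarrow> bool" where
  "conjugate_system \<phi> d p emb I a \<xi> \<longleftrightarrow>
     conjugate_relations \<phi> d p emb I a \<xi> \<and>
     (\<forall>i\<in>I. \<xi> i \<in> closure (emb ` algebra_generated (a ` I \<union> diagonal d p)))"

text \<open>A conjugate system of a self-adjoint family of simple elements is unique on \<open>I\<close>, so the
  choice below is immaterial.\<close>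

definition fisher_information ::
    "('a::cstar_algebra \<Rightarrow> complex) \<Rightarrow> nat \<Rightarrow> (nat \<Rightarrow> 'a) \<Rightarrow> ('a \<Rightarrow> 'h::complex_hilbert_space) \<Rightarrow>
     'i set \<Rightarrow> ('i \<Rightarrow> 'a) \<Rightarrow> ennreal" where
  "fisher_information \<phi> d p emb I a =
     (if \<exists>\<xi>. conjugate_system \<phi> d p emb I a \<xi>
      then \<Sum>\<^sub>\<infinity>i\<in>I. ennreal ((norm ((SOME \<xi>. conjugate_system \<phi> d p emb I a \<xi>) i))\<^sup>2)
      else \<infinity>)"

definition fisher_information_list ::
    "('a::cstar_algebra \<Rightarrow> complex) \<Rightarrow> nat \<Rightarrow> (nat \<Rightarrow> 'a) \<Rightarrow> ('a \<Rightarrow> 'h::complex_hilbert_space) \<Rightarrow>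
     'a list \<Rightarrow> ennreal" where
  "fisher_information_list \<phi> d p emb as = fisher_information \<phi> d p emb {..<length as} (\<lambda>i. as ! i)"

end

theory Submission
  imports Defs
begin

text \<open>
  The conjugate variable of \<open>x\<close> represents \<open>(\<phi> \<otimes> \<phi>) \<circ> \<partial>\<close>, where the derivation \<open>\<partial>\<close> sends \<open>x\<close> to
  \<open>p\<^sub>k \<otimes> p\<^sub>l\<close> and the other variables to \<open>0\<close>. Orthogonal projection onto the \<open>L\<^sup>2\<close>-space of a smaller
  family preserves this property and does not increase norms, which gives superadditivity. If \<open>x\<close>
  and \<open>y\<close> are free, then \<open>\<phi> \<otimes> \<phi>\<close> kills the derivative of every reduced word of length at least two,
  and so does the conjugate variable \<open>\<xi>\<close> of \<open>x\<close> in \<open>(x, x*)\<close>; hence \<open>\<xi>\<close> remains conjugate in the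
  larger family and equality holds.

  Conversely, equality forces the conjugate variables \<open>\<xi>, \<eta>\<close> of \<open>x, x*\<close> in the larger family to lie in
  the closure of the algebra \<open>B\<^sub>1\<close> generated by \<open>x, x*\<close> and the diagonal. The element
  \<open>\<rho>\<^sub>k (\<xi> x - x \<xi>) + \<rho>\<^sub>l (\<eta> x* - x* \<eta>)\<close> then lies there too, and it represents \<open>\<phi> \<otimes> \<phi>\<close> of the derivation
  that is \<open>b \<mapsto> b e - e b\<close> with \<open>e = \<Sum>\<^sub>s p\<^sub>s \<otimes> p\<^sub>s\<close> on \<open>B\<^sub>1\<close> and zero on the algebra generated by \<open>y, y*\<close>
  (Voiculescu's liberation gradient). It is orthogonal to \<open>B\<^sub>1\<close>, hence zero, and the vanishing of
  \<open>\<phi> \<otimes> \<phi>\<close> on derivatives of reduced words gives freeness by induction on their length.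
\<close>

section \<open>C*-algebras with a faithful normal trace\<close>

text \<open>The states \<open>\<phi>\<^sub>r\<close> and \<open>\<phi>\<^sub>c\<close> carry the
  denominators \<open>\<rho>\<^sub>r\<close> and \<open>\<rho>\<^sub>c\<close>, so multiplying a
  conjugate relation for a generator in corner (r, c) by both weights leaves \<open>\<rho>\<^sub>r
  \<phi>(\<xi> w) = (\<phi> \<otimes> \<phi>)(\<partial>w)\<close>. This is the origin of the
  weights in the liberation gradient. Both commutators are needed there: differentiating the extra
  factor \<open>x\<close> itself leaves boundary terms, and these cancel against the ones coming
  from \<open>star x\<close>.

  Freeness is over the diagonal, whereas a derivation argument yields scalar identities. The
  expectation is recovered from scalars by placing a projection \<open>p\<^sub>s\<close> in front of
  a word and cycling letters with the trace, which is why vanishing is stated as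
  \<open>\<phi> (p s * b) = 0\<close> for every \<open>s\<close>.\<close>

lemma star_zero [simp]: "star (0::'a::cstar_algebra) = 0"
  using star_add[of 0 "0::'a"] by simp

lemma star_one [simp]: "star (1::'a::cstar_algebra) = 1"
  by (metis mult.right_neutral mult_1 star_mult star_star)

lemma scaleC_one [simp]: "1 *\<^sub>C (x::'a::complex_normed_vector) = x"
  using scaleR_scaleC[of 1 x] by simp

lemma scaleC_zero_left [simp]: "0 *\<^sub>C (x::'a::complex_normed_vector) = 0"
  using scaleR_scaleC[of 0 x] by simp

lemma scaleC_zero_right [simp]: "c *\<^sub>C (0::'a::complex_normed_vector) = 0"
  using scaleC_add_right[of c 0 "0::'a"] by simp

lemma scaleC_minus_one: "(-1) *\<^sub>C (x::'a::complex_normed_vector) = - x"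
  using scaleR_scaleC[of "-1" x] by simp

lemma star_sum: "star (\<Sum>i\<in>A. f i) = (\<Sum>i\<in>A. star (f i :: 'a::cstar_algebra))"
  by (induction A rule: infinite_finite_induct) (auto simp: star_add)

lemma norm_star [simp]: "norm (star x) = norm (x::'a::cstar_algebra)"
proof -
  have *: "norm y \<le> norm (star y)" for y :: 'a
  proof (cases "y = 0")
    case False
    have "norm y * norm y \<le> norm (star y) * norm y"
      using norm_star_mult[of y] norm_mult_ineq[of "star y" y] by (simp add: power2_eq_square)
    then show ?thesis using False by simp
  qed auto
  show ?thesis using *[of x] *[of "star x"] by (simp add: star_star)
qed

text \<open>A minimising sequence for the distance to \<open>V\<close> is Cauchy, and its limit is
  the foot of the perpendicular. The statement is real because the class of Hilbert spaces carries
  the real inner product; \<open>L2_projection\<close> recovers the complex version.\<close>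

lemma real_closed_subspace_projection:
  fixes V :: "'h::{real_inner,complete_space} set"
  assumes "subspace V" and "closed V"
  obtains \<eta> where "\<eta> \<in> V" and "\<And>v. v \<in> V \<Longrightarrow> (\<xi> - \<eta>) \<bullet> v = 0"
proof -
  have "V \<noteq> {}" using assms(1) subspace_0 by blast
  define \<delta> where "\<delta> = (INF v\<in>V. (norm (\<xi> - v))\<^sup>2)"
  have bdd: "bdd_below ((\<lambda>v. (norm (\<xi> - v))\<^sup>2) ` V)" by (auto intro: bdd_belowI[where m=0])
  have low: "\<delta> \<le> (norm (\<xi> - v))\<^sup>2" if "v \<in> V" for v
    unfolding \<delta>_def using bdd that by (rule cINF_lower)
  have "\<exists>v\<in>V. (norm (\<xi> - v))\<^sup>2 < \<delta> + inverse (real (Suc n))" for n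
  proof -
    have "\<delta> < \<delta> + inverse (real (Suc n))" by simp
    then show ?thesis unfolding \<delta>_def using cINF_less_iff[OF \<open>V \<noteq> {}\<close> bdd] by blast
  qed
  then obtain f where f: "\<And>n. f n \<in> V" "\<And>n. (norm (\<xi> - f n))\<^sup>2 < \<delta> + inverse (real (Suc n))"
    by metis
  \<comment> \<open>Parallelogram law; the midpoint of \<open>u\<close> and \<open>v\<close> lies in
    \<open>V\<close>, so its squared distance from \<open>\<xi>\<close> is at least
    \<open>\<delta>\<close>.\<close>
  have par: "(dist u v)\<^sup>2 \<le> 2 * (norm (\<xi> - u))\<^sup>2 + 2 * (norm (\<xi> - v))\<^sup>2 - 4 * \<delta>" if "u \<in> V" "v \<in> V" for u v
  proof -
    have "(1/2) *\<^sub>R (u + v) \<in> V" using that assms(1) by (intro subspace_scale subspace_add)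
    from low[OF this] have l: "\<delta> \<le> (norm (\<xi> - (1/2) *\<^sub>R (u + v)))\<^sup>2" .
    have "(dist u v)\<^sup>2 + 4 * (norm (\<xi> - (1/2) *\<^sub>R (u + v)))\<^sup>2
        = 2 * (norm (\<xi> - u))\<^sup>2 + 2 * (norm (\<xi> - v))\<^sup>2"
      unfolding dist_norm power2_norm_eq_inner
      by (simp add: inner_commute algebra_simps)
    with l show ?thesis by linarith
  qed
  have "Cauchy f"
  proof (rule metric_CauchyI)
    fix e :: real assume "e > 0"
    then obtain N where N: "inverse (real (Suc N)) < e\<^sup>2 / 4"
      using reals_Archimedean[of "e\<^sup>2/4"] by auto
    show "\<exists>M. \<forall>m\<ge>M. \<forall>n\<ge>M. dist (f m) (f n) < e"
    proof (intro exI allI impI)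
      fix m n assume "N \<le> m" "N \<le> n"
      then have "inverse (real (Suc m)) \<le> inverse (real (Suc N))" "inverse (real (Suc n)) \<le> inverse (real (Suc N))"
        by (auto intro: le_imp_inverse_le)
      then have "(dist (f m) (f n))\<^sup>2 < e\<^sup>2"
        using par[OF f(1)[of m] f(1)[of n]] f(2)[of m] f(2)[of n] N by linarith
      then show "dist (f m) (f n) < e" using \<open>e > 0\<close> by (simp add: power_less_imp_less_base)
    qed
  qed
  then obtain \<eta> where lim: "f \<longlonglongrightarrow> \<eta>" using Cauchy_convergent convergent_def by blast
  have \<eta>: "\<eta> \<in> V" using assms(2) f(1) lim closed_sequentially by blast
  have "(\<lambda>n. (norm (\<xi> - f n))\<^sup>2) \<longlonglongrightarrow> (norm (\<xi> - \<eta>))\<^sup>2" by (intro tendsto_intros lim)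
  moreover have "(\<lambda>n. \<delta> + inverse (real (Suc n))) \<longlonglongrightarrow> \<delta> + 0"
    by (intro tendsto_intros LIMSEQ_inverse_real_of_nat)
  ultimately have min: "(norm (\<xi> - \<eta>))\<^sup>2 \<le> \<delta>"
    using LIMSEQ_le f(2) by (metis (no_types, lifting) add.right_neutral less_imp_le)
  have "(\<xi> - \<eta>) \<bullet> v = 0" if v: "v \<in> V" for v
  proof (cases "v = 0")
    case False
    \<comment> \<open>The minimiser of the quadratic polynomial
      \<open>(norm (\<xi> - \<eta> - t *\<^sub>R v))\<^sup>2\<close> in \<open>t\<close>.\<close>
    define t where "t = ((\<xi> - \<eta>) \<bullet> v) / (v \<bullet> v)"
    have "\<eta> + t *\<^sub>R v \<in> V" using \<eta> v assms(1) by (intro subspace_scale subspace_add)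
    from low[OF this] min have "(norm (\<xi> - \<eta>))\<^sup>2 \<le> (norm (\<xi> - (\<eta> + t *\<^sub>R v)))\<^sup>2" by linarith
    also have "\<dots> = (norm (\<xi> - \<eta>))\<^sup>2 - 2 * t * ((\<xi> - \<eta>) \<bullet> v) + t * t * (v \<bullet> v)"
      unfolding power2_norm_eq_inner by (simp add: inner_commute algebra_simps)
    also have "\<dots> = (norm (\<xi> - \<eta>))\<^sup>2 - ((\<xi> - \<eta>) \<bullet> v)\<^sup>2 / (v \<bullet> v)"
      using False by (simp add: t_def field_simps power2_eq_square)
    finally have "((\<xi> - \<eta>) \<bullet> v)\<^sup>2 / (v \<bullet> v) \<le> 0" by simp
    moreover have "v \<bullet> v > 0" using False by simp
    ultimately show ?thesis by (simp add: divide_le_0_iff)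
  qed auto
  with \<eta> that show ?thesis by blast
qed

section \<open>The trace, its positivity and the two-norm\<close>

locale corner_setting =
  fixes \<phi> :: "'a::cstar_algebra \<Rightarrow> complex"
    and d :: nat
    and p :: "nat \<Rightarrow> 'a"
    and emb :: "'a \<Rightarrow> 'h::complex_hilbert_space"
  assumes wps: "wstar_probability_space \<phi>"
    and faith: "faithful \<phi>"
    and trace: "tracial \<phi>"
    and part: "projection_partition d p"
    and compl: "L2_completion \<phi> emb"
begin

lemma bounded_phi: "bounded_functional \<phi>"
  using wps unfolding wstar_probability_space_def predual_def by blast

lemma phi_add [simp]: "\<phi> (a + b) = \<phi> a + \<phi> b"
  using bounded_phi unfolding bounded_functional_def by (simp add: linear_simps)

lemma phi_scaleC [simp]: "\<phi> (c *\<^sub>C a) = c * \<phi> a"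
  using bounded_phi unfolding bounded_functional_def by simp

lemma phi_zero [simp]: "\<phi> 0 = 0"
  using bounded_phi unfolding bounded_functional_def by (simp add: linear_simps)

lemma phi_minus [simp]: "\<phi> (- a) = - \<phi> a"
  using bounded_phi unfolding bounded_functional_def by (simp add: linear_simps)

lemma phi_diff [simp]: "\<phi> (a - b) = \<phi> a - \<phi> b"
  using bounded_phi unfolding bounded_functional_def by (simp add: linear_simps)

lemma phi_sum: "\<phi> (\<Sum>i\<in>A. f i) = (\<Sum>i\<in>A. \<phi> (f i))"
  by (induction A rule: infinite_finite_induct) auto

lemma phi_bound: obtains K where "K > 0" "\<And>a. cmod (\<phi> a) \<le> K * norm a"
proof -
  have "bounded_linear \<phi>" using bounded_phi unfolding bounded_functional_def by simp
  then obtain K where "K > 0" "\<forall>a. norm (\<phi> a) \<le> norm a * K"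
    using bounded_linear.pos_bounded by blast
  then show ?thesis using that[of K] by (simp add: mult.commute)
qed

lemma phi_trace: "\<phi> (a * b) = \<phi> (b * a)"
  using trace unfolding tracial_def by blast

lemma phi_one [simp]: "\<phi> 1 = 1"
  using wps unfolding wstar_probability_space_def by simp

lemma phi_star_mult: "Im (\<phi> (star a * a)) = 0" "Re (\<phi> (star a * a)) \<ge> 0"
  using wps unfolding wstar_probability_space_def by auto

lemma phi_mult_star: "Im (\<phi> (a * star a)) = 0" "Re (\<phi> (a * star a)) \<ge> 0"
  using phi_star_mult[of a] phi_trace[of a "star a"] by auto

text \<open>Polarization: \<open>\<phi>\<close> is real on
  \<open>star (1 + c *\<^sub>C a) * (1 + c *\<^sub>C a)\<close>. Taking c = 1 compares the imaginary
  parts of \<open>\<phi> a\<close> and \<open>\<phi> (star a)\<close>, and c = \<i> their real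
  parts.\<close>

lemma phi_star: "\<phi> (star a) = cnj (\<phi> a)"
proof -
  have e: "\<phi> (star (1 + c *\<^sub>C a) * (1 + c *\<^sub>C a))
      = 1 + c * \<phi> a + cnj c * \<phi> (star a) + cnj c * c * \<phi> (star a * a)" for c
    by (simp add: star_add star_scaleC algebra_simps mult_scaleC_left mult_scaleC_right)
  have "Im (1 + 1 * \<phi> a + cnj 1 * \<phi> (star a) + cnj 1 * 1 * \<phi> (star a * a)) = 0"
    using phi_star_mult(1)[of "1 + 1 *\<^sub>C a"] unfolding e .
  moreover have "Im (1 + \<i> * \<phi> a + cnj \<i> * \<phi> (star a) + cnj \<i> * \<i> * \<phi> (star a * a)) = 0"
    using phi_star_mult(1)[of "1 + \<i> *\<^sub>C a"] unfolding e .
  ultimately show ?thesis using phi_star_mult(1)[of a] by (simp add: complex_eq_iff)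
qed

lemma faithfulD: "\<phi> (star a * a) = 0 \<Longrightarrow> a = 0"
  using faith unfolding faithful_def by blast

lemma emb_add [simp]: "emb (a + b) = emb a + emb b"
  and emb_scaleC [simp]: "emb (c *\<^sub>C a) = c *\<^sub>C emb a"
  and norm_emb: "norm (emb a) = sqrt (Re (\<phi> (a * star a)))"
  and dense: "closure (range emb) = UNIV"
  using compl unfolding L2_completion_def by auto

lemma emb_scaleR [simp]: "emb (r *\<^sub>R a) = r *\<^sub>R emb a"
  by (simp add: scaleR_scaleC)

lemma emb_zero [simp]: "emb 0 = 0"
  using emb_add[of 0 0] by simp

lemma emb_minus [simp]: "emb (- a) = - emb a"
  using emb_scaleR[of "-1" a] by simp

lemma emb_diff [simp]: "emb (a - b) = emb a - emb b"
  using emb_add[of a "- b"] by simp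

lemma norm_emb_sq: "(norm (emb a))\<^sup>2 = Re (\<phi> (a * star a))"
  unfolding norm_emb using phi_mult_star(2) by simp

lemma emb_eq_0 [simp]: "emb a = 0 \<longleftrightarrow> a = 0"
proof
  assume "emb a = 0"
  then have "Re (\<phi> (star a * a)) = 0" using norm_emb_sq[of a] phi_trace[of a "star a"] by simp
  then show "a = 0" using phi_star_mult(1)[of a] faithfulD by (simp add: complex_eq_iff)
qed auto

lemma emb_inner: "emb a \<bullet> emb b = Re (\<phi> (a * star b))"
proof -
  have "(norm (emb (a + b)))\<^sup>2 = (norm (emb a))\<^sup>2 + 2 * (emb a \<bullet> emb b) + (norm (emb b))\<^sup>2"
    by (simp add: power2_norm_eq_inner inner_commute algebra_simps)
  moreover have "(norm (emb (a + b)))\<^sup>2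
      = (norm (emb a))\<^sup>2 + Re (\<phi> (a * star b)) + Re (\<phi> (b * star a)) + (norm (emb b))\<^sup>2"
    unfolding norm_emb_sq by (simp add: star_add algebra_simps)
  moreover have "Re (\<phi> (b * star a)) = Re (\<phi> (a * star b))"
    using phi_star[of "a * star b"] by (simp add: star_mult star_star)
  ultimately show ?thesis by simp
qed

lemma norm_emb_star [simp]: "norm (emb (star a)) = norm (emb a)"
  unfolding norm_emb star_star by (simp add: phi_trace)

text \<open>Cauchy--Schwarz against the unit vector \<open>emb 1\<close>. A unimodular scalar first
  makes \<open>\<phi> a\<close> nonnegative, since the real inner product sees real parts alone. The
  bound lets \<open>\<phi>\<close> extend to the completion.\<close>

lemma phi_le_emb: "cmod (\<phi> a) \<le> norm (emb a)"
proof -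
  have n1: "norm (emb 1) = 1" by (simp add: norm_emb)
  obtain c where c: "cmod c = 1" "c * \<phi> a = of_real (cmod (\<phi> a))"
  proof (cases "\<phi> a = 0")
    case True then show ?thesis using that[of 1] by simp
  next
    case False
    then show ?thesis using that[of "of_real (cmod (\<phi> a)) / \<phi> a"] by (simp add: norm_divide)
  qed
  have "cmod (\<phi> a) = Re (\<phi> (c *\<^sub>C a))" using c by simp
  also have "\<dots> = emb (c *\<^sub>C a) \<bullet> emb 1" by (subst emb_inner) simp
  also have "\<dots> \<le> norm (emb (c *\<^sub>C a)) * norm (emb 1)" by (rule norm_cauchy_schwarz)
  also have "\<dots> = norm (emb a)" using c n1 by (simp add: norm_scaleC)
  finally show ?thesis .
qed

text \<open>Iterating Cauchy--Schwarz along \<open>h, h\<^sup>2, h\<^sup>4, \<dots>\<close> and using boundedness of \<open>\<phi>\<close> for the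
  operator norm replaces the functional calculus argument.\<close>

lemma norm_emb_mult_selfadjoint:
  assumes h: "star h = h"
  shows "norm (emb (h * b)) \<le> norm h * norm (emb b)"
proof (rule ccontr)
  assume neg: "\<not> ?thesis"
  define t where "t n = norm (emb (h ^ (2 ^ n) * b))" for n
  have sp: "star (h ^ n) = h ^ n" for n
    by (induction n) (simp_all add: star_mult h power_commutes)
  \<comment> \<open>The trace moves the last factor \<open>?g\<close> to the front, so the squared
    norm becomes an inner product with \<open>emb b\<close> in which the exponent of
    \<open>h\<close> has doubled.\<close>
  have step: "(t n)\<^sup>2 \<le> t (Suc n) * norm (emb b)" for n
  proof -
    let ?g = "h ^ (2 ^ n)"
    have "(t n)\<^sup>2 = Re (\<phi> ((?g * b) * (star b * ?g)))"
      unfolding t_def norm_emb_sq by (simp add: star_mult sp)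
    also have "\<dots> = Re (\<phi> ((?g * ?g * b) * star b))"
      using phi_trace[of "?g * b * star b" ?g] by (simp add: mult.assoc)
    also have "?g * ?g = h ^ (2 ^ Suc n)" by (simp only: power_add[symmetric] power_Suc mult_2)
    also have "Re (\<phi> (h ^ (2 ^ Suc n) * b * star b)) = emb (h ^ (2 ^ Suc n) * b) \<bullet> emb b"
      by (simp add: emb_inner)
    also have "\<dots> \<le> t (Suc n) * norm (emb b)" unfolding t_def by (rule norm_cauchy_schwarz)
    finally show ?thesis .
  qed
  have bpos: "norm (emb b) > 0"
  proof (rule ccontr)
    assume "\<not> norm (emb b) > 0"
    then have "(t 0)\<^sup>2 \<le> 0" using step[of 0] by simp
    then have "t 0 = 0" by simp
    moreover have "t 0 = norm (emb (h * b))" by (simp add: t_def)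
    ultimately have "norm (emb (h * b)) = 0" by simp
    moreover have "norm h * norm (emb b) \<ge> 0" by simp
    ultimately show False using neg by linarith
  qed
  define s where "s n = t n / norm (emb b)" for n
  have s_step: "(s n)\<^sup>2 \<le> s (Suc n)" for n
  proof -
    have "(s n)\<^sup>2 = (t n)\<^sup>2 / (norm (emb b))\<^sup>2" by (simp add: s_def power_divide)
    also have "\<dots> \<le> (t (Suc n) * norm (emb b)) / (norm (emb b))\<^sup>2"
      using step by (simp add: divide_right_mono)
    also have "\<dots> = s (Suc n)" using bpos by (simp add: s_def power2_eq_square)
    finally show ?thesis .
  qed
  have s_nonneg: "s n \<ge> 0" for n by (simp add: s_def t_def)
  have s_pow: "(s 0) ^ (2 ^ n) \<le> s n" for n
  proof (induction n)
    case (Suc n)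
    have "s 0 ^ (2 ^ Suc n) = (s 0 ^ (2 ^ n))\<^sup>2" by (simp only: power_mult[symmetric] power_Suc2)
    also have "\<dots> \<le> (s n)\<^sup>2" using Suc s_nonneg by (intro power_mono) auto
    finally show ?case using s_step[of n] by linarith
  qed simp
  have t0: "norm h < s 0"
    using neg bpos by (simp add: s_def t_def field_simps)
  obtain K where K: "K > 0" "\<And>a. cmod (\<phi> a) \<le> K * norm a" using phi_bound by blast
  have norm_K: "norm (emb a) \<le> sqrt K * norm a" for a
  proof -
    have "Re (\<phi> (a * star a)) \<le> K * norm (a * star a)"
      using K(2)[of "a * star a"] complex_Re_le_cmod[of "\<phi> (a * star a)"] by linarith
    also have "norm (a * star a) = (norm a)\<^sup>2" using norm_star_mult[of "star a"] by (simp add: star_star)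
    finally have "norm (emb a) \<le> sqrt (K * (norm a)\<^sup>2)" unfolding norm_emb by simp
    also have "\<dots> = sqrt K * norm a" by (simp add: real_sqrt_mult)
    finally show ?thesis .
  qed
  define C where "C = sqrt K * norm b / norm (emb b)"
  have upper: "s n \<le> C * norm h ^ (2 ^ n)" for n
  proof -
    have "t n \<le> sqrt K * norm (h ^ (2 ^ n) * b)" unfolding t_def by (rule norm_K)
    also have "\<dots> \<le> sqrt K * (norm h ^ (2 ^ n) * norm b)"
      using K(1) norm_mult_ineq[of "h ^ (2 ^ n)" b] mult_right_mono[OF norm_power_ineq[of h "2 ^ n"], of "norm b"]
      by (intro mult_left_mono) auto
    finally have "s n \<le> sqrt K * (norm h ^ (2 ^ n) * norm b) / norm (emb b)"
      unfolding s_def by (rule divide_right_mono) simp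
    also have "\<dots> = C * norm h ^ (2 ^ n)" by (simp add: C_def)
    finally show ?thesis .
  qed
  have ub: "s 0 ^ (2 ^ n) \<le> C * norm h ^ (2 ^ n)" for n
    using s_pow[of n] upper[of n] by linarith
  show False
  proof (cases "h = 0")
    case True then show False using ub[of 0] t0 by simp
  next
    case False
    \<comment> \<open>This ratio exceeds 1 if the asserted bound fails, yet its powers with
      exponents \<open>2 ^ n\<close> stay below the fixed \<open>C\<close>.\<close>
    define r where "r = s 0 / norm h"
    have r: "r > 1" using t0 False by (simp add: r_def)
    have "r ^ (2 ^ n) \<le> C" for n
      unfolding r_def power_divide using ub[of n] False by (subst pos_divide_le_eq) auto
    moreover have "r ^ n \<le> r ^ (2 ^ n)" for n using r by (intro power_increasing) auto
    ultimately have "r ^ n \<le> C" for n by (meson order_trans)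
    moreover obtain n where "C < r ^ n" using real_arch_pow[OF r, of C] by blast
    ultimately show False by (simp add: not_less[symmetric])
  qed
qed

text \<open>The trace turns the squared norm of \<open>a * b\<close> into the inner product of
  \<open>star a * a * b\<close> with \<open>b\<close>. The self-adjoint case applies to
  \<open>star a * a\<close>, whose norm is \<open>(norm a)\<^sup>2\<close>.\<close>

lemma norm_emb_mult_left: "norm (emb (a * b)) \<le> norm a * norm (emb b)"
proof -
  have "(norm (emb (a * b)))\<^sup>2 = Re (\<phi> ((star a * a * b) * star b))"
    unfolding norm_emb_sq using phi_trace[of "a * b * star b" "star a"]
    by (simp add: star_mult mult.assoc)
  also have "\<dots> = emb (star a * a * b) \<bullet> emb b" by (simp add: emb_inner)
  also have "\<dots> \<le> norm (emb (star a * a * b)) * norm (emb b)" by (rule norm_cauchy_schwarz)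
  also have "\<dots> \<le> (norm (star a * a) * norm (emb b)) * norm (emb b)"
    by (intro mult_right_mono norm_emb_mult_selfadjoint) (auto simp: star_mult star_star)
  also have "\<dots> = (norm a * norm (emb b))\<^sup>2"
    unfolding norm_star_mult power_mult_distrib by (simp only: power2_eq_square mult.assoc)
  finally show ?thesis by (rule power2_le_imp_le) simp
qed

text \<open>The star is isometric for the two-norm, because \<open>\<phi>\<close> is a trace, and it
  exchanges right and left multiplication.\<close>

lemma norm_emb_mult_right: "norm (emb (b * a)) \<le> norm a * norm (emb b)"
proof -
  have "norm (emb (b * a)) = norm (emb (star a * star b))"
    using norm_emb_star[of "b * a"] by (simp only: star_mult)
  also have "\<dots> \<le> norm (star a) * norm (emb (star b))" by (rule norm_emb_mult_left)
  finally show ?thesis by simp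
qed

section \<open>Continuous extension from the algebra to its completion\<close>

lemma continuous_eq_on_emb:
  fixes f g :: "'h \<Rightarrow> 'b::t2_space"
  assumes "continuous_on UNIV f" "continuous_on UNIV g" "\<And>a. f (emb a) = g (emb a)"
  shows "f \<xi> = g \<xi>"
proof -
  have "closed {\<xi>. f \<xi> = g \<xi>}" using assms(1,2) by (intro closed_Collect_eq)
  moreover have "range emb \<subseteq> {\<xi>. f \<xi> = g \<xi>}" using assms(3) by auto
  ultimately have "closure (range emb) \<subseteq> {\<xi>. f \<xi> = g \<xi>}" by (simp add: closure_minimal)
  then show ?thesis using dense by auto
qed

text \<open>\<open>L2_extend\<close> is a definite description, so existence and uniqueness must
  come before any use of it. A bound in the two-norm gives uniform continuity on the dense range,
  completeness of the target gives the extension, and density makes it unique.\<close>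

lemma L2_extend_works:
  fixes f :: "'a \<Rightarrow> 'b::complete_space"
  assumes lip: "\<And>a b. dist (f a) (f b) \<le> C * norm (emb (a - b))"
  shows "continuous_on UNIV (L2_extend emb f)" "L2_extend emb f (emb a) = f a"
proof -
  define f' where "f' = f \<circ> inv_into UNIV emb"
  have inj: "inj emb"
  proof (rule injI)
    fix a b assume "emb a = emb b"
    then have "emb (a - b) = 0" by (simp only: emb_diff) simp
    then show "a = b" by (simp only: emb_eq_0) simp
  qed
  have f'_emb: "f' (emb a) = f a" for a using inj by (simp add: f'_def)
  have "uniformly_continuous_on (range emb) f'"
    unfolding uniformly_continuous_on_def
  proof (intro allI impI)
    fix e :: real assume e: "0 < e"
    show "\<exists>\<delta>>0. \<forall>x\<in>range emb. \<forall>x'\<in>range emb. dist x' x < \<delta> \<longrightarrow> dist (f' x') (f' x) < e"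
    proof (intro exI conjI ballI impI)
      \<comment> \<open>\<open>\<bar>C\<bar> + 1\<close> in place of \<open>C\<close> keeps the
        denominator positive whatever the sign of \<open>C\<close>.\<close>
      show "0 < e / (\<bar>C\<bar> + 1)" using e by (intro divide_pos_pos) auto
      fix x x' assume "x \<in> range emb" "x' \<in> range emb" and d: "dist x' x < e / (\<bar>C\<bar> + 1)"
      then obtain a b where ab: "x = emb a" "x' = emb b" by auto
      have "dist (f' x') (f' x) \<le> C * norm (emb (b - a))" using lip by (simp add: ab f'_emb)
      also have "\<dots> \<le> (\<bar>C\<bar> + 1) * norm (emb (b - a))" by (intro mult_right_mono) auto
      also have "\<dots> < e" using d by (simp add: ab dist_norm pos_less_divide_eq add_nonneg_pos mult.commute)
      finally show "dist (f' x') (f' x) < e" .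
    qed
  qed
  then obtain g where g: "uniformly_continuous_on (closure (range emb)) g" "\<And>x. x \<in> range emb \<Longrightarrow> f' x = g x"
    by (rule uniformly_continuous_on_extension_on_closure) blast
  have gc: "continuous_on UNIV g" using g(1) uniformly_continuous_imp_continuous by (simp add: dense)
  have ge: "g (emb a) = f a" for a using g(2)[of "emb a"] f'_emb by simp
  have "\<exists>!g. continuous_on UNIV g \<and> (\<forall>a. g (emb a) = f a)"
  proof (rule ex1I[of _ g])
    show "continuous_on UNIV g \<and> (\<forall>a. g (emb a) = f a)" using gc ge by simp
    fix h assume h: "continuous_on UNIV h \<and> (\<forall>a. h (emb a) = f a)"
    show "h = g" by (rule ext, rule continuous_eq_on_emb) (use h gc ge in auto)
  qed
  from theI'[OF this] show "continuous_on UNIV (L2_extend emb f)" "L2_extend emb f (emb a) = f a"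
    unfolding L2_extend_def by auto
qed

end

section \<open>Multiplications and corners of \<open>L\<^sup>2\<close>\<close>

lemma subspace_closure:
  fixes V :: "'b::real_normed_vector set"
  assumes "subspace V"
  shows "subspace (closure V)"
proof (rule subspaceI)
  show "0 \<in> closure V" using assms subspace_0 closure_subset by blast
  fix x y assume "x \<in> closure V" "y \<in> closure V"
  then obtain f g where "\<And>n. f n \<in> V" "f \<longlonglongrightarrow> x" "\<And>n. g n \<in> V" "g \<longlonglongrightarrow> y"
    unfolding closure_sequential by blast
  then have "\<forall>n. f n + g n \<in> V" "(\<lambda>n. f n + g n) \<longlonglongrightarrow> x + y"
    using assms by (auto intro: subspace_add tendsto_add)
  then show "x + y \<in> closure V" unfolding closure_sequential by (intro exI[of _ "\<lambda>n. f n + g n"]) simp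
next
  fix r x assume "x \<in> closure V"
  then obtain f where "\<And>n. f n \<in> V" "f \<longlonglongrightarrow> x" unfolding closure_sequential by blast
  then have "\<forall>n. r *\<^sub>R f n \<in> V" "(\<lambda>n. r *\<^sub>R f n) \<longlonglongrightarrow> r *\<^sub>R x"
    using assms by (auto intro: subspace_scale tendsto_scaleR)
  then show "r *\<^sub>R x \<in> closure V" unfolding closure_sequential by (intro exI[of _ "\<lambda>n. r *\<^sub>R f n"]) simp
qed

context corner_setting
begin

lemma projection_mult [simp]: "i \<in> {1..d} \<Longrightarrow> p i * p i = p i"
  and projection_orth: "i \<in> {1..d} \<Longrightarrow> j \<in> {1..d} \<Longrightarrow> i \<noteq> j \<Longrightarrow> p i * p j = 0"
  and projection_star [simp]: "i \<in> {1..d} \<Longrightarrow> star (p i) = p i"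
  and projection_nonzero: "i \<in> {1..d} \<Longrightarrow> p i \<noteq> 0"
  and projection_sum: "(\<Sum>i=1..d. p i) = 1"
  using part unfolding projection_partition_def by auto

lemma projection_mult_assoc [simp]: "i \<in> {1..d} \<Longrightarrow> p i * (p i * a) = p i * a"
  by (simp add: mult.assoc[symmetric])

lemma projection_orth_assoc: "i \<in> {1..d} \<Longrightarrow> j \<in> {1..d} \<Longrightarrow> i \<noteq> j \<Longrightarrow> p i * (p j * a) = 0"
  by (simp add: mult.assoc[symmetric] projection_orth)

lemma phi_projection_nonzero: "i \<in> {1..d} \<Longrightarrow> \<phi> (p i) \<noteq> 0"
  using faithfulD[of "p i"] projection_nonzero[of i] by auto

lemma phi_projection_mult: "i \<in> {1..d} \<Longrightarrow> \<phi> (p i * a * p i) = \<phi> (p i * a)"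
  using phi_trace[of "p i * a" "p i"] by (simp add: mult.assoc[symmetric])

lemma sum_projection_mult: "(\<Sum>i=1..d. p i * a) = a" "(\<Sum>i=1..d. a * p i) = a"
  using projection_sum by (simp_all add: sum_distrib_right[symmetric] sum_distrib_left[symmetric])

lemma corner_iff:
  assumes "i \<in> {1..d}" "j \<in> {1..d}"
  shows "a \<in> corner p i j \<longleftrightarrow> p i * a = a \<and> a * p j = a"
proof
  assume "a \<in> corner p i j"
  then show "p i * a = a \<and> a * p j = a" using assms unfolding corner_def by (auto simp: mult.assoc)
next
  assume "p i * a = a \<and> a * p j = a"
  then have "a = p i * a * p j" by simp
  then show "a \<in> corner p i j" unfolding corner_def by blast
qed

lemma corner_star:
  assumes "i \<in> {1..d}" "j \<in> {1..d}" "a \<in> corner p i j"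
  shows "star a \<in> corner p j i"
proof -
  have a: "p i * a = a" "a * p j = a" using assms corner_iff by auto
  have "star (a * p j) = star a" "star (p i * a) = star a" using a by simp_all
  then show ?thesis using assms(1,2) by (simp add: corner_iff star_mult)
qed

lemma corner_mult_left:
  assumes "i \<in> {1..d}" "j \<in> {1..d}" "s \<in> {1..d}" "a \<in> corner p i j"
  shows "p s * a = (if s = i then a else 0)"
proof -
  have ia: "p i * a = a" using assms corner_iff by auto
  then have "p s * a = p s * p i * a" by (simp add: mult.assoc)
  then show ?thesis using assms ia by (auto simp: projection_orth)
qed

lemma corner_mult_right:
  assumes "i \<in> {1..d}" "j \<in> {1..d}" "s \<in> {1..d}" "a \<in> corner p i j"
  shows "a * p s = (if s = j then a else 0)"
proof -
  have aj: "a * p j = a" using assms corner_iff by auto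
  then have "a * p s = a * (p j * p s)" by (simp add: mult.assoc[symmetric])
  then show ?thesis using assms aj by (auto simp: projection_orth)
qed

lemma continuous_on_L2_lmult: "continuous_on UNIV (L2_lmult emb a)"
  and L2_lmult_emb [simp]: "L2_lmult emb a (emb b) = emb (a * b)"
proof -
  have "dist (emb (a * b)) (emb (a * c)) \<le> norm a * norm (emb (b - c))" for b c
    using norm_emb_mult_left[of a "b - c"] by (simp add: dist_norm right_diff_distrib)
  from L2_extend_works[OF this]
  show "continuous_on UNIV (L2_lmult emb a)" "L2_lmult emb a (emb b) = emb (a * b)"
    unfolding L2_lmult_def by auto
qed

lemma continuous_on_L2_rmult: "continuous_on UNIV (\<lambda>\<xi>. L2_rmult emb \<xi> a)"
  and L2_rmult_emb [simp]: "L2_rmult emb (emb b) a = emb (b * a)"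
proof -
  have "dist (emb (b * a)) (emb (c * a)) \<le> norm a * norm (emb (b - c))" for b c
    using norm_emb_mult_right[of "b - c" a] by (simp add: dist_norm left_diff_distrib)
  from L2_extend_works[OF this]
  show "continuous_on UNIV (\<lambda>\<xi>. L2_rmult emb \<xi> a)" "L2_rmult emb (emb b) a = emb (b * a)"
    unfolding L2_rmult_def by auto
qed

lemma continuous_on_L2_phi: "continuous_on UNIV (L2_extend emb \<phi>)"
  and L2_phi_emb [simp]: "L2_extend emb \<phi> (emb a) = \<phi> a"
proof -
  have "dist (\<phi> a) (\<phi> b) \<le> 1 * norm (emb (a - b))" for a b
    using phi_le_emb[of "a - b"] by (simp add: dist_norm)
  from L2_extend_works[OF this]
  show "continuous_on UNIV (L2_extend emb \<phi>)" "L2_extend emb \<phi> (emb a) = \<phi> a" by auto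
qed

text \<open>The form \<open>\<phi>(\<xi> b)\<close>. Its real and imaginary parts are real inner
  products of \<open>\<xi>\<close> with vectors from the algebra, so it stands in for the complex
  inner product while staying linear in \<open>b\<close>.\<close>

definition pairing :: "'h \<Rightarrow> 'a \<Rightarrow> complex" where
  "pairing \<xi> b = L2_extend emb \<phi> (L2_rmult emb \<xi> b)"

lemma continuous_on_pairing: "continuous_on UNIV (\<lambda>\<xi>. pairing \<xi> b)"
  unfolding pairing_def
  by (rule continuous_on_compose2[OF continuous_on_L2_phi continuous_on_L2_rmult]) auto

lemma pairing_emb [simp]: "pairing (emb a) b = \<phi> (a * b)"
  by (simp add: pairing_def)

text \<open>The trace carries a left factor of the vector round to the right end of
  \<open>b\<close>.\<close>

lemma pairing_lmult: "pairing (L2_lmult emb a \<xi>) b = pairing \<xi> (b * a)"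
proof (rule continuous_eq_on_emb[where f = "\<lambda>\<xi>. pairing (L2_lmult emb a \<xi>) b" and g = "\<lambda>\<xi>. pairing \<xi> (b * a)"])
  show "continuous_on UNIV (\<lambda>\<xi>. pairing (L2_lmult emb a \<xi>) b)"
    by (rule continuous_on_compose2[OF continuous_on_pairing continuous_on_L2_lmult]) auto
qed (auto intro: continuous_on_pairing simp: phi_trace[of a] mult.assoc)

lemma pairing_rmult: "pairing (L2_rmult emb \<xi> a) b = pairing \<xi> (a * b)"
proof (rule continuous_eq_on_emb[where f = "\<lambda>\<xi>. pairing (L2_rmult emb \<xi> a) b" and g = "\<lambda>\<xi>. pairing \<xi> (a * b)"])
  show "continuous_on UNIV (\<lambda>\<xi>. pairing (L2_rmult emb \<xi> a) b)"
    by (rule continuous_on_compose2[OF continuous_on_pairing continuous_on_L2_rmult]) auto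
qed (auto intro: continuous_on_pairing simp: mult.assoc)

lemma pairing_add_right: "pairing \<xi> (a + b) = pairing \<xi> a + pairing \<xi> b"
  by (rule continuous_eq_on_emb[where f = "\<lambda>\<xi>. pairing \<xi> (a + b)" and g = "\<lambda>\<xi>. pairing \<xi> a + pairing \<xi> b"])
    (auto intro!: continuous_intros continuous_on_pairing simp: distrib_left)

lemma pairing_scaleC_right: "pairing \<xi> (c *\<^sub>C a) = c * pairing \<xi> a"
  by (rule continuous_eq_on_emb[where f = "\<lambda>\<xi>. pairing \<xi> (c *\<^sub>C a)" and g = "\<lambda>\<xi>. c * pairing \<xi> a"])
    (auto intro!: continuous_intros continuous_on_pairing simp: mult_scaleC_right)

lemma pairing_zero_right [simp]: "pairing \<xi> 0 = 0"
  using pairing_scaleC_right[of \<xi> 0 0] by simp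

lemma Re_pairing: "Re (pairing \<xi> b) = \<xi> \<bullet> emb (star b)"
  by (rule continuous_eq_on_emb[where f = "\<lambda>\<xi>. Re (pairing \<xi> b)" and g = "\<lambda>\<xi>. \<xi> \<bullet> emb (star b)"])
    (auto intro!: continuous_intros continuous_on_pairing simp: emb_inner star_star)

lemma Im_pairing: "Im (pairing \<xi> b) = \<xi> \<bullet> emb (star ((-\<i>) *\<^sub>C b))"
  using Re_pairing[of \<xi> "(-\<i>) *\<^sub>C b"] by (simp add: pairing_scaleC_right del: emb_scaleC)

lemma pairing_add_left: "pairing (\<xi> + \<eta>) b = pairing \<xi> b + pairing \<eta> b"
  by (simp add: complex_eq_iff Re_pairing Im_pairing inner_add_left)

lemma pairing_diff_left: "pairing (\<xi> - \<eta>) b = pairing \<xi> b - pairing \<eta> b"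
  by (simp add: complex_eq_iff Re_pairing Im_pairing inner_diff_left)

lemma pairing_zero_left [simp]: "pairing 0 b = 0"
  by (simp add: complex_eq_iff Re_pairing Im_pairing)

lemma inner_zero_on_closure:
  fixes \<xi> :: 'h
  assumes "\<And>v. v \<in> V \<Longrightarrow> \<xi> \<bullet> v = 0" "\<eta> \<in> closure V"
  shows "\<xi> \<bullet> \<eta> = 0"
proof -
  have "closed {v. \<xi> \<bullet> v = 0}" by (intro closed_Collect_eq continuous_intros)
  then have "closure V \<subseteq> {v. \<xi> \<bullet> v = 0}" using assms(1) by (intro closure_minimal) auto
  then show ?thesis using assms(2) by auto
qed

text \<open>Stability of \<open>B\<close> under the star turns vanishing of the pairing into
  orthogonality to the image of \<open>B\<close>, hence to its closure, which contains
  \<open>\<xi>\<close> itself.\<close>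

lemma pairing_zero_imp_zero:
  assumes "\<xi> \<in> closure (emb ` B)" "\<And>b. b \<in> B \<Longrightarrow> star b \<in> B" "\<And>b. b \<in> B \<Longrightarrow> pairing \<xi> b = 0"
  shows "\<xi> = 0"
proof -
  have "\<xi> \<bullet> v = 0" if "v \<in> emb ` B" for v
  proof -
    from that obtain b where b: "b \<in> B" "v = emb b" by blast
    have "Re (pairing \<xi> (star b)) = 0" using assms(2,3) b(1) by simp
    then show ?thesis unfolding Re_pairing star_star b(2) .
  qed
  then have "\<xi> \<bullet> \<xi> = 0" using assms(1) by (rule inner_zero_on_closure)
  then show ?thesis by simp
qed

lemma pairing_eqI: "(\<And>b. pairing \<xi> b = pairing \<eta> b) \<Longrightarrow> \<xi> = \<eta>"
  using pairing_zero_imp_zero[of "\<xi> - \<eta>" UNIV] dense by (simp add: pairing_diff_left)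

text \<open>Corners are tested by duality. The indices are reversed because \<open>\<phi>(p\<^sub>i
  \<xi> p\<^sub>j b) = \<phi>(\<xi> p\<^sub>j b p\<^sub>i)\<close>.\<close>

lemma pairing_L2_corner:
  assumes "i \<in> {1..d}" "j \<in> {1..d}"
  shows "\<xi> \<in> L2_corner emb p i j \<longleftrightarrow> (\<forall>b. pairing \<xi> (p j * b * p i) = pairing \<xi> b)"
proof
  assume "\<xi> \<in> L2_corner emb p i j"
  then obtain \<eta> where "\<xi> = L2_rmult emb (L2_lmult emb (p i) \<eta>) (p j)" unfolding L2_corner_def by auto
  then show "\<forall>b. pairing \<xi> (p j * b * p i) = pairing \<xi> b"
    using assms by (simp add: pairing_rmult pairing_lmult mult.assoc)
next
  assume *: "\<forall>b. pairing \<xi> (p j * b * p i) = pairing \<xi> b"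
  have "L2_rmult emb (L2_lmult emb (p i) \<xi>) (p j) = \<xi>"
    using * by (intro pairing_eqI) (simp add: pairing_rmult pairing_lmult)
  then show "\<xi> \<in> L2_corner emb p i j" unfolding L2_corner_def by (smt (verit) mem_Collect_eq)
qed

lemma pairing_L2_corner_left:
  assumes "i \<in> {1..d}" "j \<in> {1..d}" "s \<in> {1..d}" "\<xi> \<in> L2_corner emb p i j"
  shows "pairing \<xi> (p s * b) = (if s = j then pairing \<xi> b else 0)"
proof -
  have *: "pairing \<xi> (p j * b * p i) = pairing \<xi> b" for b using assms pairing_L2_corner by blast
  show ?thesis
    using *[of "p s * b"] *[of b] assms by (auto simp: projection_orth_assoc mult.assoc)
qed

lemma pairing_L2_corner_right:
  assumes "i \<in> {1..d}" "j \<in> {1..d}" "s \<in> {1..d}" "\<xi> \<in> L2_corner emb p i j"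
  shows "pairing \<xi> (b * p s) = (if s = i then pairing \<xi> b else 0)"
proof -
  have *: "pairing \<xi> (p j * b * p i) = pairing \<xi> b" for b using assms pairing_L2_corner by blast
  show ?thesis
    using *[of "b * p s"] *[of b] assms by (auto simp: projection_orth mult.assoc)
qed

lemma L2_corner_unique:
  assumes "i \<in> {1..d}" "j \<in> {1..d}" "i' \<in> {1..d}" "j' \<in> {1..d}"
    and "\<xi> \<in> L2_corner emb p i j" "\<xi> \<in> L2_corner emb p i' j'" "\<xi> \<noteq> 0"
  shows "i = i' \<and> j = j'"
proof (rule ccontr)
  assume "\<not> (i = i' \<and> j = j')"
  then have "pairing \<xi> b = 0" for b
    using pairing_L2_corner_left[of i j j' \<xi> b] pairing_L2_corner_left[of i' j' j' \<xi> b]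
      pairing_L2_corner_right[of i j i' \<xi> b] pairing_L2_corner_right[of i' j' i' \<xi> b] assms
    by (auto split: if_splits)
  then have "\<xi> = 0" by (intro pairing_eqI) simp
  then show False using assms by simp
qed

text \<open>A nonzero vector lies in only one corner, so the definite descriptions in
  \<open>row\<close> and \<open>col\<close> take the expected values.\<close>

lemma simple_row_col:
  assumes "i \<in> {1..d}" "j \<in> {1..d}" "\<xi> \<in> L2_corner emb p i j" "\<xi> \<noteq> 0"
  shows "simple d p emb \<xi>" "row d p emb \<xi> = i" "col d p emb \<xi> = j"
proof -
  show "simple d p emb \<xi>" unfolding simple_def using assms by blast
  show "row d p emb \<xi> = i" unfolding row_def
    by (rule the_equality) (use assms L2_corner_unique in blast)+
  show "col d p emb \<xi> = j" unfolding col_def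
    by (rule the_equality) (use assms L2_corner_unique in blast)+
qed

lemma emb_L2_corner:
  assumes "i \<in> {1..d}" "j \<in> {1..d}" "a \<in> corner p i j"
  shows "emb a \<in> L2_corner emb p i j"
proof -
  have "emb a = L2_rmult emb (L2_lmult emb (p i) (emb a)) (p j)"
    using assms corner_iff[of i j a] by simp
  then show ?thesis unfolding L2_corner_def by blast
qed

section \<open>Generated algebras, the diagonal and closures in the completion\<close>

lemma algebra_generated_subalgebra: "subalgebra (algebra_generated (S::'a set))"
  unfolding algebra_generated_def subalgebra_def by auto

lemma algebra_generated_superset: "S \<subseteq> algebra_generated (S::'a set)"
  unfolding algebra_generated_def by auto

lemma algebra_generated_minimal: "subalgebra B \<Longrightarrow> S \<subseteq> B \<Longrightarrow> algebra_generated (S::'a set) \<subseteq> B"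
  unfolding algebra_generated_def by auto

lemma algebra_generated_mono: "S \<subseteq> T \<Longrightarrow> algebra_generated (S::'a set) \<subseteq> algebra_generated T"
  unfolding algebra_generated_def by auto

lemma star_subalgebra_generated:
  assumes "\<And>s. s \<in> S \<Longrightarrow> star s \<in> (S::'a set)"
  shows "star_subalgebra (algebra_generated S)"
proof -
  have sub: "subalgebra {b. star b \<in> algebra_generated S}"
    using algebra_generated_subalgebra[of S] unfolding subalgebra_def
    by (auto simp: star_add star_mult star_scaleC)
  have "algebra_generated S \<subseteq> {b. star b \<in> algebra_generated S}"
    using assms algebra_generated_superset by (intro algebra_generated_minimal sub) auto
  then show ?thesis unfolding star_subalgebra_def using algebra_generated_subalgebra by auto
qed

lemma diagonal_star: "a \<in> diagonal d p \<Longrightarrow> star a \<in> diagonal d p"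
proof -
  assume "a \<in> diagonal d p"
  then obtain c where "a = (\<Sum>i=1..d. c i *\<^sub>C p i)" unfolding diagonal_def by auto
  then have "star a = (\<Sum>i=1..d. cnj (c i) *\<^sub>C p i)" by (simp add: star_sum star_scaleC)
  then show ?thesis unfolding diagonal_def by (auto intro!: exI[of _ "\<lambda>i. cnj (c i)"])
qed

lemma diagonalI: "(\<Sum>i=1..d. c i *\<^sub>C p i) \<in> diagonal d p"
  unfolding diagonal_def by blast

lemma projection_mult_sum:
  assumes "s \<in> {1..d}"
  shows "p s * (\<Sum>i=1..d. k i *\<^sub>C p i) = k s *\<^sub>C p s" "(\<Sum>i=1..d. k i *\<^sub>C p i) * p s = k s *\<^sub>C p s"
proof -
  have "p s * (\<Sum>i=1..d. k i *\<^sub>C p i) = (\<Sum>i=1..d. if i = s then k s *\<^sub>C p s else 0)"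
    unfolding sum_distrib_left using assms
    by (intro sum.cong) (auto simp: mult_scaleC_right projection_orth)
  then show "p s * (\<Sum>i=1..d. k i *\<^sub>C p i) = k s *\<^sub>C p s" using assms by simp
  have "(\<Sum>i=1..d. k i *\<^sub>C p i) * p s = (\<Sum>i=1..d. if i = s then k s *\<^sub>C p s else 0)"
    unfolding sum_distrib_right using assms
    by (intro sum.cong) (auto simp: mult_scaleC_left projection_orth)
  then show "(\<Sum>i=1..d. k i *\<^sub>C p i) * p s = k s *\<^sub>C p s" using assms by simp
qed

lemma diagonal_mult_projection:
  assumes "\<delta> \<in> diagonal d p"
  obtains k where "\<And>s. s \<in> {1..d} \<Longrightarrow> p s * \<delta> = k s *\<^sub>C p s" "\<And>s. s \<in> {1..d} \<Longrightarrow> \<delta> * p s = k s *\<^sub>C p s"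
proof -
  from assms obtain k where "\<delta> = (\<Sum>i=1..d. k i *\<^sub>C p i)" unfolding diagonal_def by blast
  then show ?thesis using that[of k] projection_mult_sum by blast
qed

lemma projection_diagonal: "s \<in> {1..d} \<Longrightarrow> p s \<in> diagonal d p"
  using diagonalI[of "\<lambda>i. if i = s then 1 else 0"]
  by (simp add: if_distrib[of "\<lambda>c. c *\<^sub>C _"] cong: if_cong)

lemma subalgebra_diff: "subalgebra B \<Longrightarrow> a \<in> B \<Longrightarrow> b \<in> B \<Longrightarrow> a - b \<in> (B :: 'a set)"
proof -
  assume "subalgebra B" "a \<in> B" "b \<in> B"
  then have "a + (-1) *\<^sub>C b \<in> B" unfolding subalgebra_def by blast
  then show ?thesis by (simp add: scaleC_minus_one)
qed

lemma subspace_emb_closure: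
  assumes "subalgebra B"
  shows "subspace (closure (emb ` B))"
proof -
  have B: "0 \<in> B" "\<And>a b. a \<in> B \<Longrightarrow> b \<in> B \<Longrightarrow> a + b \<in> B" "\<And>r a. a \<in> B \<Longrightarrow> r *\<^sub>R a \<in> B"
    using assms unfolding subalgebra_def scaleR_scaleC by auto
  have "subspace (emb ` B)"
  proof (rule subspaceI)
    show "0 \<in> emb ` B" using imageI[OF B(1), of emb] by simp
    fix x y assume "x \<in> emb ` B" "y \<in> emb ` B"
    then obtain a b where "a \<in> B" "x = emb a" "b \<in> B" "y = emb b" by blast
    then show "x + y \<in> emb ` B" using imageI[OF B(2), of a b emb] by simp
  next
    fix r x assume "x \<in> emb ` B"
    then obtain a where "a \<in> B" "x = emb a" by blast
    then show "r *\<^sub>R x \<in> emb ` B" using imageI[OF B(3), of a emb r] by simp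
  qed
  then show ?thesis by (rule subspace_closure)
qed

lemma L2_lmult_closure:
  assumes "subalgebra B" "a \<in> B" "\<xi> \<in> closure (emb ` B)"
  shows "L2_lmult emb a \<xi> \<in> closure (emb ` B)"
proof -
  have "L2_lmult emb a ` closure (emb ` B) \<subseteq> closure (emb ` B)"
  proof (rule image_closure_subset)
    show "continuous_on (closure (emb ` B)) (L2_lmult emb a)"
      using continuous_on_L2_lmult continuous_on_subset by blast
    show "L2_lmult emb a ` emb ` B \<subseteq> closure (emb ` B)"
      using assms(1,2) closure_subset[of "emb ` B"] unfolding subalgebra_def by auto
  qed simp
  then show ?thesis using assms(3) by auto
qed

lemma L2_rmult_closure:
  assumes "subalgebra B" "a \<in> B" "\<xi> \<in> closure (emb ` B)"
  shows "L2_rmult emb \<xi> a \<in> closure (emb ` B)"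
proof -
  have "(\<lambda>\<xi>. L2_rmult emb \<xi> a) ` closure (emb ` B) \<subseteq> closure (emb ` B)"
  proof (rule image_closure_subset)
    show "continuous_on (closure (emb ` B)) (\<lambda>\<xi>. L2_rmult emb \<xi> a)"
      using continuous_on_L2_rmult continuous_on_subset by blast
    show "(\<lambda>\<xi>. L2_rmult emb \<xi> a) ` emb ` B \<subseteq> closure (emb ` B)"
      using assms(1,2) closure_subset[of "emb ` B"] unfolding subalgebra_def by auto
  qed simp
  then show ?thesis using assms(3) by auto
qed

text \<open>The orthogonal projection onto the closure of \<open>B\<close> acts as the conditional
  expectation. Pythagoras gives the norm inequality, and also that a vector whose norm is preserved
  is fixed, which is what the equality case exploits.\<close>

lemma L2_projection:
  assumes B: "star_subalgebra B"
  obtains \<eta> where "\<eta> \<in> closure (emb ` B)" "\<And>b. b \<in> B \<Longrightarrow> pairing \<eta> b = pairing \<xi> b"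
    "norm \<eta> \<le> norm \<xi>" "norm \<eta> = norm \<xi> \<Longrightarrow> \<eta> = \<xi>"
proof -
  have sub: "subalgebra B" and st: "\<And>b. b \<in> B \<Longrightarrow> star b \<in> B"
    using B unfolding star_subalgebra_def by auto
  obtain \<eta> where \<eta>: "\<eta> \<in> closure (emb ` B)" and perp: "\<And>v. v \<in> closure (emb ` B) \<Longrightarrow> (\<xi> - \<eta>) \<bullet> v = 0"
    using real_closed_subspace_projection[OF subspace_emb_closure[OF sub] closed_closure] by blast
  have z: "(\<xi> - \<eta>) \<bullet> emb b = 0" if "b \<in> B" for b
    using perp closure_subset[of "emb ` B"] that by blast
  have e: "pairing \<eta> b = pairing \<xi> b" if "b \<in> B" for b
  proof -
    \<comment> \<open>Orthogonality to the adjoint of \<open>b\<close> controls the real part of the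
      pairing; the adjoint of this multiple controls the imaginary part.\<close>
    have "(-\<i>) *\<^sub>C b \<in> B" using that sub unfolding subalgebra_def by blast
    then have "pairing (\<xi> - \<eta>) b = 0"
      unfolding complex_eq_iff Re_pairing Im_pairing using z st that by (simp del: emb_scaleC)
    then show ?thesis by (simp add: pairing_diff_left)
  qed
  have pyth: "(norm \<xi>)\<^sup>2 = (norm \<eta>)\<^sup>2 + (norm (\<xi> - \<eta>))\<^sup>2"
    using perp[OF \<eta>] unfolding power2_norm_eq_inner by (simp add: inner_commute algebra_simps)
  have "(norm \<eta>)\<^sup>2 \<le> (norm \<xi>)\<^sup>2" using pyth by simp
  then have "norm \<eta> \<le> norm \<xi>" by (rule power2_le_imp_le) simp
  moreover have "norm \<eta> = norm \<xi> \<Longrightarrow> \<eta> = \<xi>" using pyth by simp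
  ultimately show ?thesis using that \<eta> e by blast
qed

end

section \<open>Pairs recording a derivation\<close>

text \<open>A pair \<open>(b, T)\<close> records a value \<open>b\<close> together with
  \<open>T u v = (\<phi> \<otimes> \<phi>) (u \<cdot> \<partial>b \<cdot> v)\<close> for a derivation \<open>\<partial>\<close> into \<open>A \<otimes> A\<close>. Such a \<open>\<partial>\<close> is prescribed on
  generators and need not be well defined on the algebra that they generate; the algebra of pairs
  is its graph and takes the place of noncommutative polynomials.\<close>

type_synonym 'a dpair = "'a \<times> ('a \<Rightarrow> 'a \<Rightarrow> complex)"

definition dpair_add :: "'a::cstar_algebra dpair \<Rightarrow> 'a dpair \<Rightarrow> 'a dpair" where
  "dpair_add g h = (fst g + fst h, \<lambda>u v. snd g u v + snd h u v)"

definition dpair_scale :: "complex \<Rightarrow> 'a::cstar_algebra dpair \<Rightarrow> 'a dpair" where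
  "dpair_scale c g = (c *\<^sub>C fst g, \<lambda>u v. c * snd g u v)"

text \<open>Leibniz rule: in the term that differentiates \<open>g\<close> the value of
  \<open>h\<close> is absorbed into \<open>v\<close>, in the other one the value of \<open>g\<close>
  into \<open>u\<close>.\<close>

definition dpair_mult :: "'a::cstar_algebra dpair \<Rightarrow> 'a dpair \<Rightarrow> 'a dpair" where
  "dpair_mult g h = (fst g * fst h, \<lambda>u v. snd g u (fst h * v) + snd h (u * fst g) v)"

definition dpair_const :: "'a \<Rightarrow> 'a dpair" where
  "dpair_const a = (a, \<lambda>u v. 0)"

definition dpair_prod :: "'a::cstar_algebra dpair list \<Rightarrow> 'a dpair" where
  "dpair_prod gs = foldr dpair_mult gs (dpair_const 1)"

definition dpair_linear :: "'a::cstar_algebra dpair \<Rightarrow> bool" where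
  "dpair_linear g \<longleftrightarrow>
     (\<forall>u u' v. snd g (u + u') v = snd g u v + snd g u' v) \<and> (\<forall>c u v. snd g (c *\<^sub>C u) v = c * snd g u v) \<and>
     (\<forall>u v v'. snd g u (v + v') = snd g u v + snd g u v') \<and> (\<forall>c u v. snd g u (c *\<^sub>C v) = c * snd g u v)"

text \<open>Combinations of at least one pair; zero is reached by scaling with 0.\<close>

inductive_set dpair_span :: "'a::cstar_algebra dpair set \<Rightarrow> 'a dpair set" for X where
  base: "g \<in> X \<Longrightarrow> g \<in> dpair_span X"
| add: "g \<in> dpair_span X \<Longrightarrow> h \<in> dpair_span X \<Longrightarrow> dpair_add g h \<in> dpair_span X"
| scale: "g \<in> dpair_span X \<Longrightarrow> dpair_scale c g \<in> dpair_span X"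

inductive_set dpair_algebra :: "'a::cstar_algebra dpair set \<Rightarrow> 'a dpair set" for X where
  base: "g \<in> X \<Longrightarrow> g \<in> dpair_algebra X"
| add: "g \<in> dpair_algebra X \<Longrightarrow> h \<in> dpair_algebra X \<Longrightarrow> dpair_add g h \<in> dpair_algebra X"
| scale: "g \<in> dpair_algebra X \<Longrightarrow> dpair_scale c g \<in> dpair_algebra X"
| mult: "g \<in> dpair_algebra X \<Longrightarrow> h \<in> dpair_algebra X \<Longrightarrow> dpair_mult g h \<in> dpair_algebra X"

lemmas dpair_defs = dpair_add_def dpair_scale_def dpair_mult_def dpair_const_def

lemma dpair_mult_assoc: "dpair_mult (dpair_mult f g) h = dpair_mult f (dpair_mult g h)"
  by (simp add: dpair_mult_def mult.assoc add.assoc)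

lemma dpair_mult_const_1: "dpair_linear g \<Longrightarrow> dpair_mult g (dpair_const 1) = g"
  by (simp add: dpair_mult_def dpair_const_def)

lemma dpair_mult_add_left:
  "dpair_linear h \<Longrightarrow> dpair_mult (dpair_add f g) h = dpair_add (dpair_mult f h) (dpair_mult g h)"
  by (simp add: dpair_defs dpair_linear_def algebra_simps)

lemma dpair_mult_add_right:
  "dpair_linear f \<Longrightarrow> dpair_mult f (dpair_add g h) = dpair_add (dpair_mult f g) (dpair_mult f h)"
  by (simp add: dpair_defs dpair_linear_def algebra_simps)

lemma dpair_mult_scale_left:
  "dpair_linear h \<Longrightarrow> dpair_mult (dpair_scale c g) h = dpair_scale c (dpair_mult g h)"
  by (simp add: dpair_defs dpair_linear_def mult_scaleC_left mult_scaleC_right distrib_left)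

lemma dpair_mult_scale_right:
  "dpair_linear f \<Longrightarrow> dpair_mult f (dpair_scale c g) = dpair_scale c (dpair_mult f g)"
  by (simp add: dpair_defs dpair_linear_def mult_scaleC_left mult_scaleC_right distrib_left)

lemma dpair_linear_add: "dpair_linear g \<Longrightarrow> dpair_linear h \<Longrightarrow> dpair_linear (dpair_add g h)"
  by (simp add: dpair_defs dpair_linear_def algebra_simps)

lemma dpair_linear_scale: "dpair_linear g \<Longrightarrow> dpair_linear (dpair_scale c g)"
  by (simp add: dpair_defs dpair_linear_def algebra_simps)

lemma dpair_linear_mult: "dpair_linear g \<Longrightarrow> dpair_linear h \<Longrightarrow> dpair_linear (dpair_mult g h)"
  by (simp add: dpair_defs dpair_linear_def algebra_simps mult_scaleC_left mult_scaleC_right)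

lemma dpair_linear_const: "dpair_linear (dpair_const a)"
  by (simp add: dpair_defs dpair_linear_def)

lemma dpair_prod_Nil [simp]: "dpair_prod [] = dpair_const 1"
  and dpair_prod_Cons [simp]: "dpair_prod (g # gs) = dpair_mult g (dpair_prod gs)"
  by (simp_all add: dpair_prod_def)

lemma dpair_linear_prod: "(\<And>g. g \<in> set gs \<Longrightarrow> dpair_linear g) \<Longrightarrow> dpair_linear (dpair_prod gs)"
  by (induction gs) (auto intro: dpair_linear_mult dpair_linear_const)

lemma dpair_linear_span: "g \<in> dpair_span X \<Longrightarrow> (\<And>g. g \<in> X \<Longrightarrow> dpair_linear g) \<Longrightarrow> dpair_linear g"
  by (induction rule: dpair_span.induct) (auto intro: dpair_linear_add dpair_linear_scale)

lemma dpair_linear_algebra: "g \<in> dpair_algebra X \<Longrightarrow> (\<And>g. g \<in> X \<Longrightarrow> dpair_linear g) \<Longrightarrow> dpair_linear g"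
  by (induction rule: dpair_algebra.induct) (auto intro: dpair_linear_add dpair_linear_scale dpair_linear_mult)

lemma fst_dpair_prod: "fst (dpair_prod gs) = prod_list (map fst gs)"
  by (induction gs) (simp_all add: dpair_mult_def dpair_const_def)

lemma snd_dpair_prod:
  "snd (dpair_prod gs) u v = (\<Sum>m<length gs. snd (gs ! m) (u * prod_list (map fst (take m gs)))
     (prod_list (map fst (drop (Suc m) gs)) * v))"
proof (induction gs arbitrary: u)
  case (Cons g gs)
  have "snd (dpair_prod (g # gs)) u v
      = snd g u (prod_list (map fst gs) * v) + snd (dpair_prod gs) (u * fst g) v"
    by (simp add: dpair_mult_def fst_dpair_prod)
  then show ?case unfolding Cons.IH by (simp add: sum.lessThan_Suc_shift mult.assoc del: sum.lessThan_Suc)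
qed (simp add: dpair_const_def)

lemma dpair_prod_in_algebra:
  assumes "\<And>g. g \<in> set gs \<Longrightarrow> g \<in> dpair_algebra X" "dpair_const 1 \<in> dpair_algebra X"
  shows "dpair_prod gs \<in> dpair_algebra X"
  using assms by (induction gs) (auto intro: dpair_algebra.mult)

lemma dpair_algebra_mono: "X \<subseteq> Y \<Longrightarrow> g \<in> dpair_algebra X \<Longrightarrow> g \<in> dpair_algebra Y"
  by (erule dpair_algebra.induct) (auto intro: dpair_algebra.intros)

lemma dpair_span_sum:
  assumes "finite A" "A \<noteq> {}" "\<And>i. i \<in> A \<Longrightarrow> dpair_const (f i) \<in> dpair_span X"
  shows "dpair_const (\<Sum>i\<in>A. f i) \<in> dpair_span X"
  using assms
proof (induction A rule: finite_ne_induct)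
  case (insert i A)
  have "dpair_const (\<Sum>i\<in>insert i A. f i) = dpair_add (dpair_const (f i)) (dpair_const (\<Sum>i\<in>A. f i))"
    using insert by (simp add: dpair_defs)
  then show ?case using insert by (simp add: dpair_span.add)
qed auto

text \<open>A normal form principle. If left multiplication by the generators in \<open>X\<close>
  sends \<open>Y\<close> into its span, then so does the whole algebra, and applying an element to
  the unit exhibits it as a combination of \<open>Y\<close>. It will be used with words preceded by
  a projection and with reduced words.\<close>

lemma dpair_algebra_subset_span:
  assumes lin: "\<And>g. g \<in> X \<Longrightarrow> dpair_linear g" "\<And>h. h \<in> Y \<Longrightarrow> dpair_linear h"
    and one: "dpair_const 1 \<in> dpair_span Y"
    and absorb: "\<And>g h. g \<in> X \<Longrightarrow> h \<in> Y \<Longrightarrow> dpair_mult g h \<in> dpair_span Y"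
    and g: "g \<in> dpair_algebra X"
  shows "g \<in> dpair_span Y"
proof -
  have "\<forall>h\<in>dpair_span Y. dpair_mult g h \<in> dpair_span Y"
    using g
  proof (induction rule: dpair_algebra.induct)
    case (base g)
    have "dpair_mult g h \<in> dpair_span Y" if "h \<in> dpair_span Y" for h
      using that
    proof (induction rule: dpair_span.induct)
      case (add h h')
      then show ?case using lin(1)[OF base] by (simp add: dpair_mult_add_right dpair_span.add)
    next
      case (scale h c)
      then show ?case using lin(1)[OF base] by (simp add: dpair_mult_scale_right dpair_span.scale)
    qed (use base absorb in auto)
    then show ?case by blast
  next
    case (add g g')
    then show ?case using dpair_linear_span[OF _ lin(2)] by (simp add: dpair_mult_add_left dpair_span.add)
  next
    case (scale g c)
    then show ?case using dpair_linear_span[OF _ lin(2)] by (simp add: dpair_mult_scale_left dpair_span.scale)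
  next
    case (mult g g')
    then show ?case by (simp add: dpair_mult_assoc)
  qed
  moreover have "dpair_linear g" using g lin(1) dpair_linear_algebra by blast
  ultimately show ?thesis using one dpair_mult_const_1 by metis
qed

text \<open>Every element of the generated algebra lifts to a pair, possibly to several, so a
  relation imposed on pairs reaches the whole algebra. Zero is obtained as a multiple of some
  generator.\<close>

lemma fst_dpair_algebra:
  "fst ` dpair_algebra X = algebra_generated (fst ` X)" if "X \<noteq> {}"
proof
  have sub: "subalgebra (algebra_generated (fst ` X))" "fst ` X \<subseteq> algebra_generated (fst ` X)"
    unfolding algebra_generated_def subalgebra_def by auto
  have "fst g \<in> algebra_generated (fst ` X)" if "g \<in> dpair_algebra X" for g
    using that by (induction rule: dpair_algebra.induct) (use sub in \<open>auto simp: dpair_defs subalgebra_def\<close>)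
  then show "fst ` dpair_algebra X \<subseteq> algebra_generated (fst ` X)" by blast
  have "subalgebra (fst ` dpair_algebra X)"
    unfolding subalgebra_def
  proof (intro conjI ballI allI)
    from that obtain g where "g \<in> X" by blast
    then have "dpair_scale 0 g \<in> dpair_algebra X" by (intro dpair_algebra.scale dpair_algebra.base)
    from imageI[OF this, of fst] show "0 \<in> fst ` dpair_algebra X" by (simp add: dpair_scale_def)
  next
    fix a b assume "a \<in> fst ` dpair_algebra X" "b \<in> fst ` dpair_algebra X"
    then obtain g h where gh: "g \<in> dpair_algebra X" "a = fst g" "h \<in> dpair_algebra X" "b = fst h" by blast
    show "a + b \<in> fst ` dpair_algebra X"
      using imageI[OF dpair_algebra.add[OF gh(1,3)], of fst] by (simp add: dpair_add_def gh)
    show "a * b \<in> fst ` dpair_algebra X"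
      using imageI[OF dpair_algebra.mult[OF gh(1,3)], of fst] by (simp add: dpair_mult_def gh)
  next
    fix c a assume "a \<in> fst ` dpair_algebra X"
    then obtain g where gh: "g \<in> dpair_algebra X" "a = fst g" by blast
    show "c *\<^sub>C a \<in> fst ` dpair_algebra X"
      using imageI[OF dpair_algebra.scale[OF gh(1)], of fst] by (simp add: dpair_scale_def gh)
  qed
  then show "algebra_generated (fst ` X) \<subseteq> fst ` dpair_algebra X"
    unfolding algebra_generated_def using dpair_algebra.base[of _ X] by blast
qed

text \<open>Paths in a quiver: the letter \<open>j\<close> is an edge from \<open>r j\<close> to
  \<open>c j\<close>.\<close>

primrec composable :: "('i \<Rightarrow> nat) \<Rightarrow> ('i \<Rightarrow> nat) \<Rightarrow> nat \<Rightarrow> 'i list \<Rightarrow> nat \<Rightarrow> bool" where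
  "composable r c s [] t \<longleftrightarrow> s = t"
| "composable r c s (j # js) t \<longleftrightarrow> s = r j \<and> composable r c (c j) js t"

lemma composable_append_Cons: "composable r c s (us @ j # vs) t \<longleftrightarrow> composable r c s us (r j) \<and> composable r c (c j) vs t"
  by (induction us arbitrary: s) auto

lemma composable_nth:
  assumes "m < length js"
  shows "composable r c s js t \<longleftrightarrow> composable r c s (take m js) (r (js ! m)) \<and> composable r c (c (js ! m)) (drop (Suc m) js) t"
  using composable_append_Cons[of r c s "take m js" "js ! m" "drop (Suc m) js" t] id_take_nth_drop[OF assms] by simp

text \<open>The right side is the square sequence condition for the word preceded by an element \<open>\<xi>\<close> with
  column \<open>s\<close> and row \<open>t\<close>.\<close>

lemma composable_iff_square:
  "composable r c s js t \<longleftrightarrow>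
    (\<forall>m<Suc (length js). (s # map c js) ! m = (t # map r js) ! (Suc m mod Suc (length js)))"
proof -
  have "composable r c s js t \<longleftrightarrow> (\<forall>m<Suc (length js). (s # map c js) ! m = (map r js @ [t]) ! m)"
    by (induction js arbitrary: s) (auto simp: All_less_Suc2)
  also have "\<dots> \<longleftrightarrow> (\<forall>m<Suc (length js). (s # map c js) ! m = (t # map r js) ! (Suc m mod Suc (length js)))"
  proof (intro all_cong1 imp_cong refl)
    fix m assume "m < Suc (length js)"
    then have "(map r js @ [t]) ! m = (t # map r js) ! (Suc m mod Suc (length js))"
      by (cases "m = length js") (auto simp: nth_append)
    then show "((s # map c js) ! m = (map r js @ [t]) ! m) =
        ((s # map c js) ! m = (t # map r js) ! (Suc m mod Suc (length js)))" by simp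
  qed
  finally show ?thesis .
qed

context corner_setting
begin

text \<open>\<open>\<phi> \<otimes> \<phi>\<close> of \<open>u (p\<^sub>r \<otimes> p\<^sub>c) v\<close>; the generators below describe the derivation that sends \<open>z\<close>
  to \<open>p\<^sub>r \<otimes> p\<^sub>c\<close> and vanishes on \<open>S\<close> and on the diagonal.\<close>

definition split_phi :: "nat \<Rightarrow> nat \<Rightarrow> 'a \<Rightarrow> 'a \<Rightarrow> complex" where
  "split_phi r c u v = \<phi> (u * p r) * \<phi> (p c * v)"

definition conj_gens :: "'a \<Rightarrow> nat \<Rightarrow> nat \<Rightarrow> 'a set \<Rightarrow> 'a dpair set" where
  "conj_gens z r c S = insert (z, split_phi r c) (dpair_const ` (S \<union> diagonal d p))"

text \<open>The corner has the indices of \<open>z\<close> exchanged. The relation for the pair of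
  \<open>z\<close> has right side \<open>\<phi> (p r) * \<phi> (p c)\<close>, which is how the
  vector is later seen to be nonzero.\<close>

definition conj_var :: "'a \<Rightarrow> nat \<Rightarrow> nat \<Rightarrow> 'a set \<Rightarrow> 'h \<Rightarrow> bool" where
  "conj_var z r c S \<xi> \<longleftrightarrow>
     \<xi> \<in> closure (emb ` algebra_generated (insert z S \<union> diagonal d p)) \<and> \<xi> \<in> L2_corner emb p c r \<and>
     (\<forall>g\<in>dpair_algebra (conj_gens z r c S). \<phi> (p r) * pairing \<xi> (fst g) = snd g 1 1)"

lemma dpair_linear_split_phi: "dpair_linear (a, split_phi r c)"
  by (simp add: dpair_linear_def split_phi_def algebra_simps mult_scaleC_left mult_scaleC_right)

lemma dpair_linear_conj_gens: "g \<in> conj_gens z r c S \<Longrightarrow> dpair_linear g"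
  unfolding conj_gens_def using dpair_linear_const dpair_linear_split_phi by blast

lemma fst_conj_gens: "fst ` conj_gens z r c S = insert z S \<union> diagonal d p"
  unfolding conj_gens_def by (auto simp: image_image dpair_const_def)

lemma one_diagonal: "1 \<in> diagonal d p"
  using diagonalI[of "\<lambda>_. 1"] projection_sum by simp

lemma pairing_vanish_on_span:
  assumes "\<And>g. g \<in> X \<Longrightarrow> \<rho> * pairing \<xi> (fst g) = snd g 1 1" "g \<in> dpair_span X"
  shows "\<rho> * pairing \<xi> (fst g) = snd g 1 1"
  using assms(2) by (induction rule: dpair_span.induct)
    (simp_all add: assms(1) dpair_add_def dpair_scale_def pairing_add_right pairing_scaleC_right algebra_simps)

end

section \<open>Words in a family of corner elements\<close>

locale corner_family = corner_setting \<phi> d p emb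
  for \<phi> :: "'a::cstar_algebra \<Rightarrow> complex" and d p and emb :: "'a \<Rightarrow> 'h::complex_hilbert_space" +
  fixes I :: "'i set" and a :: "'i \<Rightarrow> 'a" and r c :: "'i \<Rightarrow> nat"
  assumes r_range: "i \<in> I \<Longrightarrow> r i \<in> {1..d}" and c_range: "i \<in> I \<Longrightarrow> c i \<in> {1..d}"
    and off_diagonal: "i \<in> I \<Longrightarrow> r i \<noteq> c i"
    and in_corner: "i \<in> I \<Longrightarrow> a i \<in> corner p (r i) (c i)"
    and nonzero: "i \<in> I \<Longrightarrow> a i \<noteq> 0"
begin

text \<open>Projections travel through the word letter by letter and survive only along a path. The
  empty path yields \<open>p s\<close>, the unit of the corner, in accordance with the convention of
  \<open>state_at_word\<close>.\<close>

lemma projection_word: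
  assumes "s \<in> {1..d}" "t \<in> {1..d}" "set js \<subseteq> I"
  shows "p s * prod_list (map a js) * p t =
    (if composable r c s js t then if js = [] then p s else prod_list (map a js) else 0)"
  using assms
proof (induction js arbitrary: s)
  case Nil
  then show ?case by (auto simp: projection_orth)
next
  case (Cons j js)
  have j: "j \<in> I" using Cons.prems by simp
  have ac: "a j * p (c j) = a j"
    using corner_mult_right[OF r_range[OF j] c_range[OF j] c_range[OF j] in_corner[OF j]] by simp
  have sa: "p s * a j = (if s = r j then a j else 0)"
    using corner_mult_left[OF r_range[OF j] c_range[OF j] Cons.prems(1) in_corner[OF j]] .
  have "p s * prod_list (map a (j # js)) * p t = (p s * a j) * (prod_list (map a js) * p t)"
    by (simp add: mult.assoc)
  also have "\<dots> = (if s = r j then a j * (p (c j) * prod_list (map a js) * p t) else 0)"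
    unfolding sa using ac by (simp add: mult.assoc[symmetric])
  also have "\<dots> = (if s = r j then a j * (if composable r c (c j) js t then if js = [] then p (c j) else prod_list (map a js) else 0) else 0)"
    using Cons.IH[OF c_range[OF j] Cons.prems(2)] Cons.prems(3) by simp
  finally show ?case using ac by auto
qed

lemma phi_word_projection:
  assumes "s \<in> {1..d}" "set js \<subseteq> I"
  shows "\<phi> (p s * prod_list (map a js)) =
    (if composable r c s js s then \<phi> (p s) * state_at_word \<phi> p s (map a js) else 0)"
proof -
  have "\<phi> (p s * prod_list (map a js)) = \<phi> (p s * prod_list (map a js) * p s)"
    using phi_projection_mult assms by simp
  also have "\<dots> = (if composable r c s js s then \<phi> (p s) * state_at_word \<phi> p s (map a js) else 0)"
    unfolding projection_word[OF assms(1) assms(1) assms(2)] using phi_projection_nonzero[OF assms(1)]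
    by (simp add: state_at_word_def state_at_def)
  finally show ?thesis .
qed

definition word_pair :: "'i \<Rightarrow> 'i \<Rightarrow> 'a dpair" where
  "word_pair i j = (if j = i then (a j, split_phi (r i) (c i)) else dpair_const (a j))"

definition relation_sum :: "'i \<Rightarrow> 'i list \<Rightarrow> complex" where
  "relation_sum i js = (\<Sum>m<length js. if js ! m = i
     then state_at_word \<phi> p (r i) (map a (take m js)) * state_at_word \<phi> p (c i) (map a (drop (Suc m) js))
     else 0)"

lemma fst_word_pair [simp]: "fst (word_pair i j) = a j"
  by (simp add: word_pair_def dpair_const_def)

lemma snd_word_pair: "snd (word_pair i j) u v = (if j = i then split_phi (r i) (c i) u v else 0)"
  by (simp add: word_pair_def dpair_const_def)

lemma fst_word: "fst (dpair_prod (map (word_pair i) js)) = prod_list (map a js)"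
  by (simp add: fst_dpair_prod comp_def)

lemma word_map_take_drop:
  "map fst (take m (map (word_pair i) js)) = map a (take m js)"
  "map fst (drop m (map (word_pair i) js)) = map a (drop m js)"
  by (simp_all add: take_map drop_map comp_def)

text \<open>Cut at an occurrence of \<open>i\<close>, a path from \<open>r i\<close> to
  \<open>c i\<close> falls into a loop at \<open>r i\<close> and a loop at \<open>c i\<close>, and
  conversely. So the product of the traces of the two pieces vanishes unless the word is composable,
  and then each trace is a weight times a normalised state.\<close>

lemma snd_word:
  assumes i: "i \<in> I" and js: "set js \<subseteq> I"
  shows "snd (dpair_prod (map (word_pair i) js)) 1 1 =
    (if composable r c (r i) js (c i) then \<phi> (p (r i)) * \<phi> (p (c i)) * relation_sum i js else 0)"
proof -
  have term_eq: "snd (map (word_pair i) js ! m) (1 * prod_list (map fst (take m (map (word_pair i) js))))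
      (prod_list (map fst (drop (Suc m) (map (word_pair i) js))) * 1)
    = (if composable r c (r i) js (c i) then \<phi> (p (r i)) * \<phi> (p (c i)) * (if js ! m = i
     then state_at_word \<phi> p (r i) (map a (take m js)) * state_at_word \<phi> p (c i) (map a (drop (Suc m) js))
     else 0) else 0)" if m: "m < length js" for m
  proof (cases "js ! m = i")
    case True
    have "set (take m js) \<subseteq> I" "set (drop (Suc m) js) \<subseteq> I"
      using js set_take_subset set_drop_subset by (meson order_trans)+
    then show ?thesis
      using m True composable_nth[OF m, of r c "r i" "c i"] phi_word_projection[OF r_range[OF i]]
        phi_word_projection[OF c_range[OF i]]
      unfolding word_map_take_drop
      by (simp add: snd_word_pair split_phi_def phi_trace[of _ "p (r i)"])
  qed (simp add: m snd_word_pair)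
  show ?thesis
    unfolding snd_dpair_prod relation_sum_def sum_distrib_left length_map
    by (subst sum.cong[OF refl term_eq]) auto
qed

lemma pairing_word_not_composable:
  assumes i: "i \<in> I" and js: "set js \<subseteq> I" and \<xi>: "\<xi> \<in> L2_corner emb p (c i) (r i)"
    and "\<not> composable r c (r i) js (c i)"
  shows "pairing \<xi> (prod_list (map a js)) = 0"
proof -
  have "pairing \<xi> (p (r i) * prod_list (map a js) * p (c i)) = pairing \<xi> (prod_list (map a js))"
    using pairing_L2_corner[OF c_range[OF i] r_range[OF i]] \<xi> by blast
  then show ?thesis using projection_word[OF r_range[OF i] c_range[OF i] js] assms(4) by simp
qed

lemma conj_gens_eq_word_pairs:
  assumes "i \<in> I"
  shows "conj_gens (a i) (r i) (c i) (a ` (I - {i})) = word_pair i ` I \<union> dpair_const ` diagonal d p"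
proof -
  have "word_pair i ` (I - {i}) = dpair_const ` a ` (I - {i})"
    unfolding image_image by (rule image_cong) (auto simp: word_pair_def)
  moreover have "word_pair i ` I = insert (word_pair i i) (word_pair i ` (I - {i}))"
    using assms by auto
  ultimately show ?thesis by (simp add: conj_gens_def word_pair_def image_Un)
qed

lemma dpair_linear_word: "dpair_linear (word_pair i j)"
  by (simp add: word_pair_def dpair_linear_split_phi dpair_linear_const)

text \<open>A generator times a word with a projection in front is again such a word up to a scalar,
  or zero, so these words span the pair algebra. The front projection is then evaluated on both
  sides: \<open>\<xi>\<close> and \<open>split_phi\<close> each single out
  \<open>s = r i\<close>.\<close>

lemma word_relation_imp_algebra:
  assumes i: "i \<in> I" and \<xi>: "\<xi> \<in> L2_corner emb p (c i) (r i)"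
    and rel: "\<And>js. set js \<subseteq> I \<Longrightarrow>
      \<phi> (p (r i)) * pairing \<xi> (prod_list (map a js)) = snd (dpair_prod (map (word_pair i) js)) 1 1"
    and g: "g \<in> dpair_algebra (conj_gens (a i) (r i) (c i) (a ` (I - {i})))"
  shows "\<phi> (p (r i)) * pairing \<xi> (fst g) = snd g 1 1"
proof -
  let ?w = "\<lambda>js. dpair_prod (map (word_pair i) js)"
  define X where "X = {dpair_mult (dpair_const (p s)) (?w js) | s js. s \<in> {1..d} \<and> set js \<subseteq> I}"
  have XI: "dpair_mult (dpair_const (p s)) (?w js) \<in> X" if "s \<in> {1..d}" "set js \<subseteq> I" for s js
    using that unfolding X_def by blast
  have lin_w: "dpair_linear (?w js)" for js
    by (rule dpair_linear_prod) (auto simp: dpair_linear_word)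
  have linX: "dpair_linear h" if "h \<in> X" for h
    using that lin_w dpair_linear_const dpair_linear_mult unfolding X_def by blast
  have "{1..d} \<noteq> {}" using r_range[OF i] by blast
  have "dpair_const (p s) \<in> X" if "s \<in> {1..d}" for s
    using XI[OF that, of "[]"] by (simp add: dpair_mult_def dpair_const_def)
  then have one: "dpair_const 1 \<in> dpair_span X"
    using dpair_span_sum[of "{1..d}" p X] \<open>{1..d} \<noteq> {}\<close> projection_sum dpair_span.base[of _ X] by auto
  have absorb: "dpair_mult g h \<in> dpair_span X"
    if g: "g \<in> conj_gens (a i) (r i) (c i) (a ` (I - {i}))" and "h \<in> X" for g h
  proof -
    from \<open>h \<in> X\<close> obtain s js where s: "s \<in> {1..d}" and js: "set js \<subseteq> I"
      and h: "h = dpair_mult (dpair_const (p s)) (?w js)" unfolding X_def by blast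
    consider j where "j \<in> I" "g = word_pair i j" | \<delta> where "\<delta> \<in> diagonal d p" "g = dpair_const \<delta>"
      using g unfolding conj_gens_eq_word_pairs[OF i] by blast
    then show ?thesis
    proof cases
      case (1 j)
      have as: "a j * p s = (if s = c j then a j else 0)"
        using corner_mult_right[OF r_range c_range s in_corner] 1(1) by blast
      have ra: "p (r j) * a j = a j"
        using corner_mult_left[OF r_range c_range r_range in_corner] 1(1) by simp
      show ?thesis
      proof (cases "s = c j")
        case True
        have as': "a j * (p (c j) * b) = a j * b" for b using as True by (simp add: mult.assoc[symmetric])
        \<comment> \<open>The projection passes to the other side of the letter, with index
          \<open>r j\<close> instead of \<open>c j\<close>; the derivatives agree because
          \<open>split_phi\<close> contains both projections.\<close>
        have "dpair_mult g h = dpair_mult (dpair_const (p (r j))) (?w (j # js))"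
          using as ra True 1 s r_range[OF 1(1)]
          by (auto simp: h dpair_mult_def dpair_const_def snd_word_pair split_phi_def fun_eq_iff as' mult.assoc
              mult.assoc[symmetric, of "p (r j)" "a j"])
        then show ?thesis using XI[of "r j" "j # js"] r_range 1(1) js by (simp add: dpair_span.base)
      next
        case False
        have as': "a j * (p s * b) = 0" for b using as False by (simp add: mult.assoc[symmetric])
        have w0: "snd (?w js) 0 v = 0" for v
          using lin_w[of js] unfolding dpair_linear_def by (metis mult_zero_left scaleC_zero_left)
        \<comment> \<open>Value and derivative both vanish; zero is written as a multiple of
          \<open>h\<close> to stay in the span.\<close>
        have "dpair_mult g h = dpair_scale 0 h"
          using False as 1 s c_range[OF 1(1)]
          by (auto simp: h dpair_mult_def dpair_const_def dpair_scale_def snd_word_pair split_phi_def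
              fun_eq_iff as' mult.assoc projection_orth_assoc w0)
        then show ?thesis using that(2) by (simp add: dpair_span.base dpair_span.scale)
      qed
    next
      case (2 \<delta>)
      then obtain k where k: "\<delta> = (\<Sum>i=1..d. k i *\<^sub>C p i)" unfolding diagonal_def by blast
      have \<delta>s: "\<delta> * p s = k s *\<^sub>C p s"
        unfolding k by (rule projection_mult_sum(2)[OF s])
      have "dpair_mult g h = dpair_scale (k s) h"
        using lin_w[of js] unfolding dpair_linear_def
        by (auto simp: h 2 dpair_mult_def dpair_const_def dpair_scale_def fun_eq_iff
            mult.assoc \<delta>s mult_scaleC_left mult_scaleC_right mult.assoc[symmetric, of \<delta> "p s"])
      then show ?thesis using that(2) by (simp add: dpair_span.base dpair_span.scale)
    qed
  qed
  have onX: "\<phi> (p (r i)) * pairing \<xi> (fst h) = snd h 1 1" if "h \<in> X" for h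
  proof -
    from that obtain s js where s: "s \<in> {1..d}" and js: "set js \<subseteq> I"
      and h: "h = dpair_mult (dpair_const (p s)) (?w js)" unfolding X_def by blast
    have e: "\<phi> (p s * (u * p (r i))) = (if s = r i then \<phi> (u * p (r i)) else 0)" for u
      using phi_trace[of "p s * u" "p (r i)"] phi_trace[of u "p (r i)"] s r_range[OF i]
      by (auto simp: mult.assoc projection_orth_assoc)
    have "snd (?w js) (p s) 1 = (if s = r i then snd (?w js) 1 1 else 0)"
    proof (cases "s = r i")
      case True
      have "\<phi> (p (r i) * (u * p (r i))) = \<phi> (u * p (r i))" for u using e[of u] True by simp
      then show ?thesis
        unfolding True snd_dpair_prod by (simp add: snd_word_pair split_phi_def mult.assoc cong: if_cong)
    next
      case False
      then have "\<phi> (p s * (u * p (r i))) = 0" for u using e by simp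
      then show ?thesis
        using False unfolding snd_dpair_prod by (simp add: snd_word_pair split_phi_def mult.assoc cong: if_cong)
    qed
    moreover have "pairing \<xi> (p s * prod_list (map a js)) = (if s = r i then pairing \<xi> (prod_list (map a js)) else 0)"
      using pairing_L2_corner_left[OF c_range[OF i] r_range[OF i] s \<xi>] .
    ultimately show ?thesis
      using rel[OF js] by (simp add: h dpair_mult_def dpair_const_def fst_word)
  qed
  have "g \<in> dpair_span X"
    by (rule dpair_algebra_subset_span[OF _ _ one _ g]) (use dpair_linear_conj_gens linX absorb in blast)+
  then show ?thesis using pairing_vanish_on_span onX by blast
qed

text \<open>For words that do not form a square sequence with \<open>\<xi> i\<close>, the pairing
  and the derivative both vanish. The relation can therefore be asked of all words, and from there
  it extends to the pair algebra.\<close>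

lemma conjugate_system_iff:
  "conjugate_system \<phi> d p emb I a \<xi> \<longleftrightarrow> (\<forall>i\<in>I. conj_var (a i) (r i) (c i) (a ` (I - {i})) (\<xi> i))"
proof -
  have set_eq: "insert (a i) (a ` (I - {i})) = a ` I" if "i \<in> I" for i using that by auto
  have a_rc: "simple d p emb (emb (a i))" "row d p emb (emb (a i)) = r i" "col d p emb (emb (a i)) = c i"
    if "i \<in> I" for i
    using simple_row_col[OF r_range c_range emb_L2_corner] that r_range c_range in_corner nonzero by auto
  have sq: "square_sequence d p emb (\<xi> i # map (\<lambda>j. emb (a j)) js) \<longleftrightarrow> composable r c (r i) js (c i)"
    if i: "i \<in> I" and js: "set js \<subseteq> I" and x: "\<xi> i \<in> L2_corner emb p (c i) (r i)" "\<xi> i \<noteq> 0" for i js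
  proof -
    have xi: "simple d p emb (\<xi> i)" "row d p emb (\<xi> i) = c i" "col d p emb (\<xi> i) = r i"
      using simple_row_col[OF c_range[OF i] r_range[OF i] x] by auto
    let ?l = "\<xi> i # map (\<lambda>j. emb (a j)) js"
    have "map (col d p emb) ?l = r i # map c js" "map (row d p emb) ?l = c i # map r js"
      using xi js a_rc by auto
    then have "col d p emb (?l ! m) = (r i # map c js) ! m" "row d p emb (?l ! m) = (c i # map r js) ! m"
      if "m < length ?l" for m using that by (metis nth_map)+
    then show ?thesis
      unfolding square_sequence_def composable_iff_square using xi(1) a_rc(1) js by auto
  qed
  have rel: "(\<forall>js. set js \<subseteq> I \<and> square_sequence d p emb (\<xi> i # map (\<lambda>j. emb (a j)) js) \<longrightarrow>
        L2_state_at \<phi> p emb (row d p emb (\<xi> i)) (L2_rmult emb (\<xi> i) (prod_list (map a js))) =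
        (\<Sum>m<length js. if js ! m = i
           then state_at_word \<phi> p (col d p emb (\<xi> i)) (map a (take m js)) *
                state_at_word \<phi> p (row d p emb (\<xi> i)) (map a (drop (Suc m) js))
           else 0)) \<longleftrightarrow>
      (\<forall>js. set js \<subseteq> I \<longrightarrow> \<phi> (p (r i)) * pairing (\<xi> i) (prod_list (map a js)) =
          snd (dpair_prod (map (word_pair i) js)) 1 1)"
    if i: "i \<in> I" and x: "\<xi> i \<in> L2_corner emb p (c i) (r i)" "\<xi> i \<noteq> 0" for i
  proof -
    have xi: "row d p emb (\<xi> i) = c i" "col d p emb (\<xi> i) = r i"
      using simple_row_col[OF c_range[OF i] r_range[OF i] x] by auto
    have "(square_sequence d p emb (\<xi> i # map (\<lambda>j. emb (a j)) js) \<longrightarrow>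
        pairing (\<xi> i) (prod_list (map a js)) / \<phi> (p (c i)) = relation_sum i js) \<longleftrightarrow>
      \<phi> (p (r i)) * pairing (\<xi> i) (prod_list (map a js)) = snd (dpair_prod (map (word_pair i) js)) 1 1"
      if js: "set js \<subseteq> I" for js
      unfolding sq[OF i js x] snd_word[OF i js]
      using pairing_word_not_composable[OF i js x(1)] phi_projection_nonzero[OF r_range[OF i]]
        phi_projection_nonzero[OF c_range[OF i]]
      by (auto simp: divide_eq_eq mult_ac)
    then show ?thesis
      unfolding xi L2_state_at_def pairing_def[symmetric] relation_sum_def[symmetric] by blast
  qed
  have corner_rel: "conj_var (a i) (r i) (c i) (a ` (I - {i})) (\<xi> i) \<longleftrightarrow>
      \<xi> i \<in> closure (emb ` algebra_generated (a ` I \<union> diagonal d p)) \<and>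
      \<xi> i \<in> L2_corner emb p (c i) (r i) \<and> \<xi> i \<noteq> 0 \<and>
      (\<forall>js. set js \<subseteq> I \<longrightarrow> \<phi> (p (r i)) * pairing (\<xi> i) (prod_list (map a js)) =
          snd (dpair_prod (map (word_pair i) js)) 1 1)" if i: "i \<in> I" for i
  proof (intro iffI conjI allI impI)
    assume cv: "conj_var (a i) (r i) (c i) (a ` (I - {i})) (\<xi> i)"
    then show "\<xi> i \<in> closure (emb ` algebra_generated (a ` I \<union> diagonal d p))" "\<xi> i \<in> L2_corner emb p (c i) (r i)"
      using set_eq[OF i] unfolding conj_var_def by auto
    have alg: "dpair_prod (map (word_pair i) js) \<in> dpair_algebra (conj_gens (a i) (r i) (c i) (a ` (I - {i})))"
      if "set js \<subseteq> I" for js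
    proof (rule dpair_prod_in_algebra)
      fix g assume "g \<in> set (map (word_pair i) js)"
      then have "g \<in> conj_gens (a i) (r i) (c i) (a ` (I - {i}))"
        using that unfolding conj_gens_eq_word_pairs[OF i] by auto
      then show "g \<in> dpair_algebra (conj_gens (a i) (r i) (c i) (a ` (I - {i})))" by (rule dpair_algebra.base)
    next
      show "dpair_const 1 \<in> dpair_algebra (conj_gens (a i) (r i) (c i) (a ` (I - {i})))"
        by (rule dpair_algebra.base) (simp add: conj_gens_def one_diagonal)
    qed
    then show wr: "\<phi> (p (r i)) * pairing (\<xi> i) (prod_list (map a js)) = snd (dpair_prod (map (word_pair i) js)) 1 1"
      if "set js \<subseteq> I" for js using cv that fst_word unfolding conj_var_def by metis
    show "\<xi> i \<noteq> 0"
    proof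
      assume "\<xi> i = 0"
      \<comment> \<open>The one-letter word detects nonvanishing: its derivative is the product of
        the traces of two nonzero projections.\<close>
      then have "snd (dpair_prod (map (word_pair i) [i])) 1 1 = 0" using wr[of "[i]"] i by simp
      moreover have "snd (dpair_prod (map (word_pair i) [i])) 1 1 = \<phi> (p (r i)) * \<phi> (p (c i))"
        by (simp add: dpair_mult_def dpair_const_def snd_word_pair split_phi_def)
      ultimately show False
        using phi_projection_nonzero[OF r_range[OF i]] phi_projection_nonzero[OF c_range[OF i]] by simp
    qed
  next
    assume *: "\<xi> i \<in> closure (emb ` algebra_generated (a ` I \<union> diagonal d p)) \<and>
      \<xi> i \<in> L2_corner emb p (c i) (r i) \<and> \<xi> i \<noteq> 0 \<and>
      (\<forall>js. set js \<subseteq> I \<longrightarrow> \<phi> (p (r i)) * pairing (\<xi> i) (prod_list (map a js)) =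
          snd (dpair_prod (map (word_pair i) js)) 1 1)"
    then show "conj_var (a i) (r i) (c i) (a ` (I - {i})) (\<xi> i)"
      unfolding conj_var_def set_eq[OF i] using word_relation_imp_algebra[OF i, of "\<xi> i"] by blast
  qed
  show ?thesis
  proof
    assume cs: "conjugate_system \<phi> d p emb I a \<xi>"
    show "\<forall>i\<in>I. conj_var (a i) (r i) (c i) (a ` (I - {i})) (\<xi> i)"
    proof
      fix i assume i: "i \<in> I"
      have s: "simple d p emb (\<xi> i)" "row d p emb (\<xi> i) = c i" "col d p emb (\<xi> i) = r i"
        using cs i a_rc unfolding conjugate_system_def conjugate_relations_def by auto
      then obtain i' j' where ij: "i' \<in> {1..d}" "j' \<in> {1..d}" "\<xi> i \<in> L2_corner emb p i' j'" "\<xi> i \<noteq> 0"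
        unfolding simple_def by blast
      then have x: "\<xi> i \<in> L2_corner emb p (c i) (r i)" "\<xi> i \<noteq> 0"
        using simple_row_col[OF ij] s by auto
      then show "conj_var (a i) (r i) (c i) (a ` (I - {i})) (\<xi> i)"
        using corner_rel[OF i] rel[OF i x] cs i unfolding conjugate_system_def conjugate_relations_def by blast
    qed
  next
    assume cv: "\<forall>i\<in>I. conj_var (a i) (r i) (c i) (a ` (I - {i})) (\<xi> i)"
    have x: "\<xi> i \<in> L2_corner emb p (c i) (r i)" "\<xi> i \<noteq> 0" if "i \<in> I" for i
      using cv corner_rel[OF that] that by auto
    have rr: "simple d p emb (\<xi> i)" "row d p emb (\<xi> i) = c i" "col d p emb (\<xi> i) = r i" if "i \<in> I" for i
      using simple_row_col[OF c_range[OF that] r_range[OF that] x[OF that]] by auto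
    show "conjugate_system \<phi> d p emb I a \<xi>"
      unfolding conjugate_system_def conjugate_relations_def
    proof (rule conjI, rule conjI, use rr in blast, rule conjI)
      show "\<forall>i\<in>I. row d p emb (\<xi> i) = col d p emb (emb (a i)) \<and> col d p emb (\<xi> i) = row d p emb (emb (a i))"
        using rr a_rc by simp
      show "\<forall>i\<in>I. \<forall>is. set is \<subseteq> I \<and> square_sequence d p emb (\<xi> i # map (\<lambda>j. emb (a j)) is) \<longrightarrow>
        L2_state_at \<phi> p emb (row d p emb (\<xi> i)) (L2_rmult emb (\<xi> i) (prod_list (map a is))) =
        (\<Sum>m<length is. if is ! m = i
           then state_at_word \<phi> p (col d p emb (\<xi> i)) (map a (take m is)) *
                state_at_word \<phi> p (row d p emb (\<xi> i)) (map a (drop (Suc m) is))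
           else 0)"
        using rel[OF _ x] corner_rel cv by blast
      show "\<forall>i\<in>I. \<xi> i \<in> closure (emb ` algebra_generated (a ` I \<union> diagonal d p))"
        using corner_rel cv by blast
    qed
  qed
qed

end

section \<open>Conjugate variables and Fisher information\<close>

context corner_setting
begin

lemma fst_conj_algebra:
  "fst ` dpair_algebra (conj_gens z r c S) = algebra_generated (insert z S \<union> diagonal d p)"
  unfolding fst_conj_gens[symmetric, of z S r c] by (rule fst_dpair_algebra) (simp add: conj_gens_def)

text \<open>The difference of two candidates lies in the closure of the generated algebra, which is
  closed under the star, and pairs to zero with it.\<close>

lemma conj_var_unique:
  assumes "conj_var z r c S \<xi>" "conj_var z r c S \<eta>" "r \<in> {1..d}"
    and st: "\<And>s. s \<in> insert z S \<Longrightarrow> star s \<in> insert z S"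
  shows "\<xi> = \<eta>"
proof -
  let ?B = "algebra_generated (insert z S \<union> diagonal d p)"
  have B: "star_subalgebra ?B" using st diagonal_star by (intro star_subalgebra_generated) blast
  have "\<xi> - \<eta> \<in> closure (emb ` ?B)"
    using assms(1,2) subspace_diff[OF subspace_emb_closure[OF algebra_generated_subalgebra]]
    unfolding conj_var_def by blast
  moreover have "pairing (\<xi> - \<eta>) b = 0" if "b \<in> ?B" for b
  proof -
    from that obtain g where "g \<in> dpair_algebra (conj_gens z r c S)" "b = fst g"
      unfolding fst_conj_algebra[symmetric, of z S r c] by blast
    then have "\<phi> (p r) * pairing \<xi> b = \<phi> (p r) * pairing \<eta> b"
      using assms(1,2) unfolding conj_var_def by metis
    then show ?thesis using phi_projection_nonzero[OF assms(3)] by (simp add: pairing_diff_left)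
  qed
  ultimately have "\<xi> - \<eta> = 0"
    using pairing_zero_imp_zero[of "\<xi> - \<eta>" ?B] B unfolding star_subalgebra_def by blast
  then show ?thesis by simp
qed

text \<open>Projecting onto the smaller closure leaves pairings with the smaller algebra unchanged,
  and pairs over \<open>S\<close> are among those over \<open>S'\<close>, so the relation
  survives.\<close>

lemma conj_var_restrict:
  assumes cv: "conj_var z r c S' \<xi>" and SS: "S \<subseteq> S'" and rc: "r \<in> {1..d}" "c \<in> {1..d}"
    and st: "\<And>s. s \<in> insert z S \<Longrightarrow> star s \<in> insert z S"
  obtains \<eta> where "conj_var z r c S \<eta>" "norm \<eta> \<le> norm \<xi>" "norm \<eta> = norm \<xi> \<Longrightarrow> \<eta> = \<xi>"
proof -
  let ?B = "algebra_generated (insert z S \<union> diagonal d p)"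
  have B: "star_subalgebra ?B" using st diagonal_star by (intro star_subalgebra_generated) blast
  have sub: "subalgebra ?B" by (rule algebra_generated_subalgebra)
  obtain \<eta> where \<eta>: "\<eta> \<in> closure (emb ` ?B)" "\<And>b. b \<in> ?B \<Longrightarrow> pairing \<eta> b = pairing \<xi> b"
    "norm \<eta> \<le> norm \<xi>" "norm \<eta> = norm \<xi> \<Longrightarrow> \<eta> = \<xi>" using L2_projection[OF B] by metis
  have pB: "p s \<in> ?B" if "s \<in> {1..d}" for s
    using projection_diagonal[OF that] algebra_generated_superset by blast
  \<comment> \<open>Since \<open>\<xi>\<close> is in the corner and \<open>?B\<close> contains the
    projections, cutting \<open>\<eta>\<close> to the corner changes no pairing with
    \<open>?B\<close>. Both vectors lie in the closure, hence they coincide.\<close>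
  define \<zeta> where "\<zeta> = L2_rmult emb (L2_lmult emb (p c) \<eta>) (p r)"
  have \<zeta>: "\<zeta> \<in> closure (emb ` ?B)"
    unfolding \<zeta>_def using L2_rmult_closure[OF sub pB] L2_lmult_closure[OF sub pB] \<eta>(1) rc by blast
  have "\<eta> - \<zeta> = 0"
  proof (rule pairing_zero_imp_zero)
    show "\<eta> - \<zeta> \<in> closure (emb ` ?B)" using \<eta>(1) \<zeta> subspace_diff[OF subspace_emb_closure[OF sub]] by blast
    show "\<And>b. b \<in> ?B \<Longrightarrow> star b \<in> ?B" using B unfolding star_subalgebra_def by blast
    fix b assume b: "b \<in> ?B"
    then have "p r * b * p c \<in> ?B" using pB rc sub unfolding subalgebra_def by blast
    then have "pairing \<zeta> b = pairing \<xi> (p r * b * p c)"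
      using \<eta>(2) by (simp add: \<zeta>_def pairing_rmult pairing_lmult)
    also have "\<dots> = pairing \<xi> b" using cv pairing_L2_corner[OF rc(2,1)] unfolding conj_var_def by blast
    finally show "pairing (\<eta> - \<zeta>) b = 0" using \<eta>(2)[OF b] by (simp add: pairing_diff_left)
  qed
  then have "\<eta> = \<zeta>" by simp
  then have corner: "\<eta> \<in> L2_corner emb p c r" unfolding L2_corner_def \<zeta>_def by blast
  have "\<phi> (p r) * pairing \<eta> (fst g) = snd g 1 1" if g: "g \<in> dpair_algebra (conj_gens z r c S)" for g
  proof -
    have "fst g \<in> ?B" using g unfolding fst_conj_algebra[symmetric, of z S r c] by blast
    moreover have "conj_gens z r c S \<subseteq> conj_gens z r c S'" using SS unfolding conj_gens_def by auto
    then have "g \<in> dpair_algebra (conj_gens z r c S')" using g by (rule dpair_algebra_mono)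
    ultimately show ?thesis using \<eta>(2) cv unfolding conj_var_def by auto
  qed
  then have "conj_var z r c S \<eta>" unfolding conj_var_def using \<eta>(1) corner by blast
  then show ?thesis using that \<eta> by blast
qed

end

context corner_family
begin

text \<open>Uniqueness of conjugate variables forces the arbitrary choice in
  \<open>fisher_information\<close> to agree with the given system on \<open>I\<close>.\<close>

lemma fisher_information_eq:
  assumes "finite I" and st: "\<And>i. i \<in> I \<Longrightarrow> star (a i) \<in> a ` I"
    and cv: "\<And>i. i \<in> I \<Longrightarrow> conj_var (a i) (r i) (c i) (a ` (I - {i})) (\<xi> i)"
  shows "fisher_information \<phi> d p emb I a = (\<Sum>i\<in>I. ennreal ((norm (\<xi> i))\<^sup>2))"
proof -
  define \<xi>' where "\<xi>' = (SOME \<xi>. conjugate_system \<phi> d p emb I a \<xi>)"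
  have ex: "\<exists>\<xi>. conjugate_system \<phi> d p emb I a \<xi>" using cv conjugate_system_iff by blast
  then have "conjugate_system \<phi> d p emb I a \<xi>'" unfolding \<xi>'_def by (rule someI_ex)
  then have cv': "conj_var (a i) (r i) (c i) (a ` (I - {i})) (\<xi>' i)" if "i \<in> I" for i
    using conjugate_system_iff that by blast
  have "\<xi>' i = \<xi> i" if i: "i \<in> I" for i
  proof (rule conj_var_unique[OF cv'[OF i] cv[OF i] r_range[OF i]])
    have "insert (a i) (a ` (I - {i})) = a ` I" using i by auto
    then show "\<And>s. s \<in> insert (a i) (a ` (I - {i})) \<Longrightarrow> star s \<in> insert (a i) (a ` (I - {i}))"
      using st by auto
  qed
  then show ?thesis
    using ex assms(1) unfolding fisher_information_def \<xi>'_def[symmetric] by (simp add: infsum_finite)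
qed

lemma fisher_information_finite:
  assumes "fisher_information \<phi> d p emb I a < \<infinity>"
  obtains \<xi> where "\<And>i. i \<in> I \<Longrightarrow> conj_var (a i) (r i) (c i) (a ` (I - {i})) (\<xi> i)"
proof -
  have "\<exists>\<xi>. conjugate_system \<phi> d p emb I a \<xi>"
    using assms unfolding fisher_information_def by (auto split: if_splits)
  then show ?thesis using that conjugate_system_iff by blast
qed

end

lemma lessThan_2: "{..<2::nat} = {0, 1}" and lessThan_4: "{..<4::nat} = {0, 1, 2, 3}"
  by auto

context corner_setting
begin

section \<open>The families of two and of four elements\<close>

lemma corner_family_pair:
  assumes kl: "k \<in> {1..d}" "l \<in> {1..d}" "k \<noteq> l" and x: "x \<in> corner p k l" "x \<noteq> 0"
  shows "corner_family \<phi> d p emb {..<2} ((!) [x, star x]) ((!) [k, l]) ((!) [l, k])"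
proof unfold_locales
  have "star x \<in> corner p l k" "star x \<noteq> 0" using corner_star kl x by (auto, metis star_star star_zero)
  then show "[x, star x] ! i \<in> corner p ([k, l] ! i) ([l, k] ! i)" "[x, star x] ! i \<noteq> 0"
    if "i \<in> {..<2}" for i using that x unfolding lessThan_2 by auto
qed (use kl in \<open>auto simp: lessThan_2\<close>)

lemma fisher_pair:
  assumes kl: "k \<in> {1..d}" "l \<in> {1..d}" "k \<noteq> l" and x: "x \<in> corner p k l" "x \<noteq> 0"
  shows "conj_var x k l {star x} \<xi> \<Longrightarrow> conj_var (star x) l k {x} \<eta> \<Longrightarrow>
      fisher_information_list \<phi> d p emb [x, star x] = ennreal ((norm \<xi>)\<^sup>2) + ennreal ((norm \<eta>)\<^sup>2)"
    and "fisher_information_list \<phi> d p emb [x, star x] < \<infinity> \<Longrightarrow>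
      \<exists>\<xi> \<eta>. conj_var x k l {star x} \<xi> \<and> conj_var (star x) l k {x} \<eta>"
proof -
  interpret f: corner_family \<phi> d p emb "{..<2}" "(!) [x, star x]" "(!) [k, l]" "(!) [l, k]"
    using corner_family_pair assms .
  have im: "(!) [x, star x] ` ({..<2} - {0}) = {star x}" "(!) [x, star x] ` ({..<2} - {1}) = {x}"
    unfolding lessThan_2 by (simp_all add: insert_Diff_if)
  have list: "fisher_information_list \<phi> d p emb [x, star x] = fisher_information \<phi> d p emb {..<2} ((!) [x, star x])"
    unfolding fisher_information_list_def by (simp add: numeral_2_eq_2)
  show "fisher_information_list \<phi> d p emb [x, star x] = ennreal ((norm \<xi>)\<^sup>2) + ennreal ((norm \<eta>)\<^sup>2)"
    if "conj_var x k l {star x} \<xi>" "conj_var (star x) l k {x} \<eta>"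
  proof -
    have "fisher_information \<phi> d p emb {..<2} ((!) [x, star x]) = (\<Sum>i<2. ennreal ((norm ([\<xi>, \<eta>] ! i))\<^sup>2))"
    proof (rule f.fisher_information_eq)
      show "star ([x, star x] ! i) \<in> (!) [x, star x] ` {..<2}" if "i \<in> {..<2}" for i
        using that by (auto simp: lessThan_2 star_star)
      show "conj_var ([x, star x] ! i) ([k, l] ! i) ([l, k] ! i) ((!) [x, star x] ` ({..<2} - {i})) ([\<xi>, \<eta>] ! i)"
        if "i \<in> {..<2}" for i
      proof -
        consider "i = 0" | "i = 1" using \<open>i \<in> {..<2}\<close> unfolding lessThan_2 by blast
        then show ?thesis by cases (simp_all only: im nth_Cons_0 One_nat_def nth_Cons_Suc
              \<open>conj_var x k l {star x} \<xi>\<close> \<open>conj_var (star x) l k {x} \<eta>\<close> im[unfolded One_nat_def])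
      qed
    qed simp
    then show ?thesis unfolding list lessThan_2 by simp
  qed
  show "\<exists>\<xi> \<eta>. conj_var x k l {star x} \<xi> \<and> conj_var (star x) l k {x} \<eta>"
    if fin: "fisher_information_list \<phi> d p emb [x, star x] < \<infinity>"
  proof -
    obtain \<xi> where \<xi>: "\<And>i. i \<in> {..<2} \<Longrightarrow> conj_var ([x, star x] ! i) ([k, l] ! i) ([l, k] ! i)
        ((!) [x, star x] ` ({..<2} - {i})) (\<xi> i)"
      using f.fisher_information_finite fin unfolding list by blast
    have "conj_var x k l {star x} (\<xi> 0)" using \<xi>[of 0] unfolding im by simp
    moreover have "conj_var (star x) l k {x} (\<xi> 1)" using \<xi>[of 1] unfolding im by simp
    ultimately show ?thesis by blast
  qed
qed

lemma corner_family_quadruple: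
  assumes kl: "k \<in> {1..d}" "l \<in> {1..d}" "k \<noteq> l" and x: "x \<in> corner p k l" "x \<noteq> 0"
    and y: "y \<in> corner p k l" "y \<noteq> 0"
  shows "corner_family \<phi> d p emb {..<4} ((!) [x, y, star x, star y]) ((!) [k, k, l, l]) ((!) [l, l, k, k])"
proof unfold_locales
  have "star x \<in> corner p l k" "star x \<noteq> 0" using corner_star kl x by (auto, metis star_star star_zero)
  moreover have "star y \<in> corner p l k" "star y \<noteq> 0" using corner_star kl y by (auto, metis star_star star_zero)
  ultimately show "[x, y, star x, star y] ! i \<in> corner p ([k, k, l, l] ! i) ([l, l, k, k] ! i)"
    "[x, y, star x, star y] ! i \<noteq> 0"
    if "i \<in> {..<4}" for i using that x y unfolding lessThan_4 by auto
qed (use kl in \<open>auto simp: lessThan_4\<close>)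

lemma fisher_quadruple:
  assumes kl: "k \<in> {1..d}" "l \<in> {1..d}" "k \<noteq> l" and x: "x \<in> corner p k l" "x \<noteq> 0"
    and y: "y \<in> corner p k l" "y \<noteq> 0"
  shows "conj_var x k l {y, star x, star y} \<xi> \<Longrightarrow> conj_var y k l {x, star x, star y} \<xi>' \<Longrightarrow>
      conj_var (star x) l k {x, y, star y} \<eta> \<Longrightarrow> conj_var (star y) l k {x, y, star x} \<eta>' \<Longrightarrow>
      fisher_information_list \<phi> d p emb [x, y, star x, star y] =
        ennreal ((norm \<xi>)\<^sup>2) + ennreal ((norm \<xi>')\<^sup>2) + ennreal ((norm \<eta>)\<^sup>2) + ennreal ((norm \<eta>')\<^sup>2)"
    and "fisher_information_list \<phi> d p emb [x, y, star x, star y] < \<infinity> \<Longrightarrow>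
      \<exists>\<xi> \<xi>' \<eta> \<eta>'. conj_var x k l {y, star x, star y} \<xi> \<and> conj_var y k l {x, star x, star y} \<xi>' \<and>
        conj_var (star x) l k {x, y, star y} \<eta> \<and> conj_var (star y) l k {x, y, star x} \<eta>'"
proof -
  interpret f: corner_family \<phi> d p emb "{..<4}" "(!) [x, y, star x, star y]" "(!) [k, k, l, l]" "(!) [l, l, k, k]"
    using corner_family_quadruple assms .
  have im: "(!) [x, y, star x, star y] ` ({..<4} - {0}) = {y, star x, star y}"
    "(!) [x, y, star x, star y] ` ({..<4} - {1}) = {x, star x, star y}"
    "(!) [x, y, star x, star y] ` ({..<4} - {2}) = {x, y, star y}"
    "(!) [x, y, star x, star y] ` ({..<4} - {3}) = {x, y, star x}"
    unfolding lessThan_4 by (simp_all add: insert_Diff_if)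
  have list: "fisher_information_list \<phi> d p emb [x, y, star x, star y] =
      fisher_information \<phi> d p emb {..<4} ((!) [x, y, star x, star y])"
    unfolding fisher_information_list_def by (simp add: eval_nat_numeral)
  show "fisher_information_list \<phi> d p emb [x, y, star x, star y] =
        ennreal ((norm \<xi>)\<^sup>2) + ennreal ((norm \<xi>')\<^sup>2) + ennreal ((norm \<eta>)\<^sup>2) + ennreal ((norm \<eta>')\<^sup>2)"
    if cv: "conj_var x k l {y, star x, star y} \<xi>" "conj_var y k l {x, star x, star y} \<xi>'"
      "conj_var (star x) l k {x, y, star y} \<eta>" "conj_var (star y) l k {x, y, star x} \<eta>'"
  proof -
    have "fisher_information \<phi> d p emb {..<4} ((!) [x, y, star x, star y]) =
        (\<Sum>i<4. ennreal ((norm ([\<xi>, \<xi>', \<eta>, \<eta>'] ! i))\<^sup>2))"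
    proof (rule f.fisher_information_eq)
      show "star ([x, y, star x, star y] ! i) \<in> (!) [x, y, star x, star y] ` {..<4}" if "i \<in> {..<4}" for i
        using that by (auto simp: lessThan_4 star_star numeral_2_eq_2 numeral_3_eq_3)
      fix i :: nat assume "i \<in> {..<4}"
      then consider "i = 0" | "i = 1" | "i = 2" | "i = 3" unfolding lessThan_4 by blast
      then show "conj_var ([x, y, star x, star y] ! i) ([k, k, l, l] ! i) ([l, l, k, k] ! i)
          ((!) [x, y, star x, star y] ` ({..<4} - {i})) ([\<xi>, \<xi>', \<eta>, \<eta>'] ! i)"
      proof cases
        case 1 show ?thesis unfolding 1 im using cv by simp
      next
        case 2 show ?thesis unfolding 2 im using cv by simp
      next
        case 3 show ?thesis unfolding 3 im using cv by (simp add: numeral_2_eq_2)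
      next
        case 4 show ?thesis unfolding 4 im using cv by (simp add: numeral_3_eq_3)
      qed
    qed simp
    then show ?thesis unfolding list lessThan_4 by (simp add: numeral_2_eq_2 numeral_3_eq_3 add.assoc)
  qed
  show "\<exists>\<xi> \<xi>' \<eta> \<eta>'. conj_var x k l {y, star x, star y} \<xi> \<and> conj_var y k l {x, star x, star y} \<xi>' \<and>
        conj_var (star x) l k {x, y, star y} \<eta> \<and> conj_var (star y) l k {x, y, star x} \<eta>'"
    if fin: "fisher_information_list \<phi> d p emb [x, y, star x, star y] < \<infinity>"
  proof -
    obtain \<xi> where \<xi>: "\<And>i. i \<in> {..<4} \<Longrightarrow> conj_var ([x, y, star x, star y] ! i) ([k, k, l, l] ! i) ([l, l, k, k] ! i)
        ((!) [x, y, star x, star y] ` ({..<4} - {i})) (\<xi> i)"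
      using f.fisher_information_finite fin unfolding list by blast
    have "conj_var x k l {y, star x, star y} (\<xi> 0)" using \<xi>[of 0] unfolding im by simp
    moreover have "conj_var y k l {x, star x, star y} (\<xi> 1)" using \<xi>[of 1] unfolding im by simp
    moreover have "conj_var (star x) l k {x, y, star y} (\<xi> 2)" using \<xi>[of 2] unfolding im by (simp add: numeral_2_eq_2)
    moreover have "conj_var (star y) l k {x, y, star x} (\<xi> 3)" using \<xi>[of 3] unfolding im by (simp add: numeral_3_eq_3)
    ultimately show ?thesis by blast
  qed
qed

end

section \<open>Reduced words\<close>

context corner_setting
begin

text \<open>The kernel of the conditional expectation, tested coefficientwise: by the trace property
  \<open>\<phi> (p s * b)\<close> is \<open>\<phi> (p s)\<close> times the coefficient of
  \<open>p s\<close> in the expectation of \<open>b\<close>.\<close>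

definition centered :: "'a \<Rightarrow> bool" where
  "centered b \<longleftrightarrow> (\<forall>s\<in>{1..d}. \<phi> (p s * b) = 0)"

lemma cond_exp_diagonal: "cond_exp \<phi> d p b \<in> diagonal d p"
  unfolding cond_exp_def by (rule diagonalI)

lemma projection_cond_exp:
  "s \<in> {1..d} \<Longrightarrow> p s * cond_exp \<phi> d p b = (\<phi> (p s * b) / \<phi> (p s)) *\<^sub>C p s"
  unfolding cond_exp_def projection_mult_sum by (simp add: state_at_def phi_projection_mult)

lemma centered_iff: "centered b \<longleftrightarrow> cond_exp \<phi> d p b = 0"
proof
  assume "centered b"
  then show "cond_exp \<phi> d p b = 0"
    unfolding cond_exp_def by (intro sum.neutral) (simp add: centered_def state_at_def phi_projection_mult)
next
  assume e: "cond_exp \<phi> d p b = 0"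
  show "centered b"
    unfolding centered_def
  proof
    fix s assume s: "s \<in> {1..d}"
    have "\<phi> ((\<phi> (p s * b) / \<phi> (p s)) *\<^sub>C p s) = 0"
      unfolding projection_cond_exp[OF s, symmetric] e by simp
    then show "\<phi> (p s * b) = 0" using phi_projection_nonzero[OF s] by simp
  qed
qed

lemma centered_diff_cond_exp: "centered (b - cond_exp \<phi> d p b)"
  unfolding centered_def
  by (simp add: right_diff_distrib projection_cond_exp phi_projection_nonzero)

lemma centered_phi: "centered b \<Longrightarrow> \<phi> b = 0"
  using sum_projection_mult(1)[of b] phi_sum[of "\<lambda>i. p i * b" "{1..d}"] by (simp add: centered_def)

text \<open>A diagonal element acts on \<open>p s\<close> as a scalar; from the right end it is
  first brought there by the trace.\<close>

lemma centered_mult_diagonal: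
  assumes "centered b" "\<delta> \<in> diagonal d p"
  shows "centered (\<delta> * b)" "centered (b * \<delta>)"
proof -
  from assms(2) obtain k where k: "\<And>s. s \<in> {1..d} \<Longrightarrow> p s * \<delta> = k s *\<^sub>C p s"
    "\<And>s. s \<in> {1..d} \<Longrightarrow> \<delta> * p s = k s *\<^sub>C p s" using diagonal_mult_projection by metis
  show "centered (\<delta> * b)"
    using assms(1) k(1) unfolding centered_def by (simp add: mult.assoc[symmetric] mult_scaleC_left)
  show "centered (b * \<delta>)"
    unfolding centered_def
  proof
    fix s assume s: "s \<in> {1..d}"
    have "\<phi> (p s * (b * \<delta>)) = \<phi> (\<delta> * p s * b)"
      using phi_trace[of "p s * b" \<delta>] by (simp add: mult.assoc)
    then show "\<phi> (p s * (b * \<delta>)) = 0"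
      using assms(1) s k(2) unfolding centered_def by (simp add: mult_scaleC_left)
  qed
qed


definition reduced :: "('i \<Rightarrow> 'a set) \<Rightarrow> ('i \<times> 'a) list \<Rightarrow> bool" where
  "reduced B w \<longleftrightarrow> distinct_adj (map fst w) \<and> (\<forall>(i, b)\<in>set w. b \<in> B i \<and> centered b)"

lemma reduced_Cons:
  "reduced B ((i, b) # w) \<longleftrightarrow> b \<in> B i \<and> centered b \<and> reduced B w \<and> (w \<noteq> [] \<longrightarrow> fst (hd w) \<noteq> i)"
  by (cases w) (auto simp: reduced_def)

lemma reduced_append: "reduced B (u @ v) \<Longrightarrow> reduced B u \<and> reduced B v"
  unfolding reduced_def by (auto simp: distinct_adj_append_iff)

lemma reduced_take: "reduced B w \<Longrightarrow> reduced B (take m w)"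
  and reduced_drop: "reduced B w \<Longrightarrow> reduced B (drop m w)"
  using reduced_append[of B "take m w" "drop m w"] by simp_all

lemma reduced_rev: "reduced B (rev w) \<longleftrightarrow> reduced B w"
  unfolding reduced_def by (simp add: rev_map[symmetric])

lemma reduced_snoc:
  "reduced B (w @ [(i, b)]) \<longleftrightarrow> b \<in> B i \<and> centered b \<and> reduced B w \<and> (w \<noteq> [] \<longrightarrow> fst (last w) \<noteq> i)"
  using reduced_Cons[of B i b "rev w"] reduced_rev[of B "w @ [(i, b)]"] reduced_rev[of B w]
  by (simp add: hd_rev)

lemma free_subalgebras_iff:
  "free_subalgebras \<phi> d p B \<longleftrightarrow> (\<forall>i. star_subalgebra (B i) \<and> diagonal d p \<subseteq> B i) \<and>
     (\<forall>w. reduced B w \<and> w \<noteq> [] \<longrightarrow> centered (prod_list (map snd w)))"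
  unfolding free_subalgebras_def reduced_def centered_iff by (metis (no_types, lifting))

end

section \<open>Conjugate variables of free elements\<close>

locale free_family = corner_setting \<phi> d p emb
  for \<phi> :: "'a::cstar_algebra \<Rightarrow> complex" and d p and emb :: "'a \<Rightarrow> 'h::complex_hilbert_space" +
  fixes B :: "'i \<Rightarrow> 'a set"
  assumes free: "free_subalgebras \<phi> d p B"
begin

lemma sub_B: "subalgebra (B i)" and diag_B: "diagonal d p \<subseteq> B i"
  using free unfolding free_subalgebras_iff star_subalgebra_def by auto

lemma B_mult: "a \<in> B i \<Longrightarrow> b \<in> B i \<Longrightarrow> a * b \<in> B i"
  using sub_B unfolding subalgebra_def by blast

lemma B_diff_cond_exp: "b \<in> B i \<Longrightarrow> b - cond_exp \<phi> d p b \<in> B i"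
  using subalgebra_diff[OF sub_B] cond_exp_diagonal diag_B by blast

lemma reduced_centered: "reduced B w \<Longrightarrow> w \<noteq> [] \<Longrightarrow> centered (prod_list (map snd w))"
  using free unfolding free_subalgebras_iff by blast

text \<open>Split \<open>u\<close> into a centred part and its expectation. The former lengthens the
  reduced word by one letter; the latter is diagonal and preserves centred elements.\<close>

lemma phi_mult_reduced:
  assumes "reduced B w" "w \<noteq> []" "fst (hd w) \<noteq> i" "u \<in> B i"
  shows "\<phi> (u * prod_list (map snd w)) = 0"
proof -
  let ?e = "cond_exp \<phi> d p u"
  have "reduced B ((i, u - ?e) # w)"
    using assms B_diff_cond_exp centered_diff_cond_exp by (simp add: reduced_Cons)
  from centered_phi[OF reduced_centered[OF this]]
  have "\<phi> ((u - ?e) * prod_list (map snd w)) = 0" by simp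
  moreover have "\<phi> (?e * prod_list (map snd w)) = 0"
    using centered_phi centered_mult_diagonal(1) reduced_centered assms cond_exp_diagonal by blast
  ultimately show ?thesis by (simp add: left_diff_distrib)
qed

lemma phi_reduced_mult:
  assumes "reduced B w" "w \<noteq> []" "fst (last w) \<noteq> i" "u \<in> B i"
  shows "\<phi> (prod_list (map snd w) * u) = 0"
proof -
  let ?e = "cond_exp \<phi> d p u"
  have "reduced B (w @ [(i, u - ?e)])"
    using assms B_diff_cond_exp centered_diff_cond_exp by (simp add: reduced_snoc)
  from centered_phi[OF reduced_centered[OF this]]
  have "\<phi> (prod_list (map snd w) * (u - ?e)) = 0" by simp
  moreover have "\<phi> (prod_list (map snd w) * ?e) = 0"
    using centered_phi centered_mult_diagonal(2) reduced_centered assms cond_exp_diagonal by blast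
  ultimately show ?thesis by (simp add: right_diff_distrib)
qed

text \<open>By continuity it is enough to test on \<open>B i\<close>. A first letter from
  \<open>B i\<close> merges with the test element and leaves a word that begins in another algebra;
  the excluded case is the one where nothing remains.\<close>

lemma pairing_reduced:
  assumes "\<xi> \<in> closure (emb ` B i)" "reduced B w" "w \<noteq> []" "\<not> (length w = 1 \<and> fst (hd w) = i)"
  shows "pairing \<xi> (prod_list (map snd w)) = 0"
proof -
  have "\<phi> (u * prod_list (map snd w)) = 0" if u: "u \<in> B i" for u
  proof (cases "fst (hd w) = i")
    case False then show ?thesis using phi_mult_reduced assms u by blast
  next
    case True
    then obtain b w' where w: "w = (i, b) # w'" using assms(3) by (cases w) auto
    then have "w' \<noteq> []" using assms(4) by auto
    then have "\<phi> ((u * b) * prod_list (map snd w')) = 0"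
      using assms(2) u B_mult unfolding w by (intro phi_mult_reduced[where i=i]) (auto simp: reduced_Cons)
    then show ?thesis by (simp add: w mult.assoc)
  qed
  then have "emb ` B i \<subseteq> {\<xi>. pairing \<xi> (prod_list (map snd w)) = 0}" by auto
  moreover have "closed {\<xi>. pairing \<xi> (prod_list (map snd w)) = 0}"
    by (intro closed_Collect_eq continuous_on_pairing continuous_on_const)
  ultimately show ?thesis using assms(1) closure_minimal by blast
qed

text \<open>Every Leibniz term has its left leg in \<open>u\<close> times \<open>B i\<close> and its
  right leg in \<open>B i\<close> times \<open>v\<close>. An outer factor whose products with all of
  \<open>B i\<close> have trace zero therefore kills each term.\<close>

lemma conj_algebra_vanish:
  assumes "g \<in> dpair_algebra (conj_gens z r c S)" "insert z S \<subseteq> B i" "r \<in> {1..d}" "c \<in> {1..d}"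
  shows "(\<And>b. b \<in> B i \<Longrightarrow> \<phi> (u * b) = 0) \<Longrightarrow> snd g u v = 0"
    and "(\<And>b. b \<in> B i \<Longrightarrow> \<phi> (b * v) = 0) \<Longrightarrow> snd g u v = 0"
proof -
  have pB: "p r \<in> B i" "p c \<in> B i" using projection_diagonal diag_B assms by auto
  have "algebra_generated (insert z S \<union> diagonal d p) \<subseteq> B i"
    using assms(2) diag_B sub_B by (intro algebra_generated_minimal) auto
  then have fst_B: "fst g \<in> B i" if "g \<in> dpair_algebra (conj_gens z r c S)" for g
    using that unfolding fst_conj_algebra[symmetric, of z S r c] by blast
  show "snd g u v = 0" if "\<And>b. b \<in> B i \<Longrightarrow> \<phi> (u * b) = 0"
    using assms(1) that
  proof (induction arbitrary: u v rule: dpair_algebra.induct)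
    case (base g)
    then show ?case using pB unfolding conj_gens_def by (auto simp: split_phi_def dpair_const_def)
  next
    case (mult g h)
    have "\<phi> (u * fst g * b) = 0" if "b \<in> B i" for b
      using mult.prems B_mult[OF fst_B[OF mult.hyps(1)] that] by (simp add: mult.assoc)
    then show ?case using mult by (simp add: dpair_mult_def)
  qed (simp_all add: dpair_add_def dpair_scale_def)
  show "snd g u v = 0" if "\<And>b. b \<in> B i \<Longrightarrow> \<phi> (b * v) = 0"
    using assms(1) that
  proof (induction arbitrary: u v rule: dpair_algebra.induct)
    case (base g)
    then show ?case using pB unfolding conj_gens_def by (auto simp: split_phi_def dpair_const_def)
  next
    case (mult g h)
    have "\<phi> (b * (fst h * v)) = 0" if "b \<in> B i" for b
      using mult.prems[OF B_mult[OF that fst_B[OF mult.hyps(2)]]] by (simp add: mult.assoc)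
    then show ?case using mult by (simp add: dpair_mult_def)
  qed (simp_all add: dpair_add_def dpair_scale_def)
qed

text \<open>Centring letters at the level of pairs shows that the larger pair algebra is spanned by
  products along reduced words and by the diagonal. A single letter of index \<open>i\<close> gives
  the old relation; on any other reduced word both sides vanish.\<close>

lemma conj_var_free_extension:
  assumes cv: "conj_var z r c S \<xi>" and zS: "insert z S \<subseteq> B i" and S': "S' \<subseteq> (\<Union>j\<in>-{i}. B j)"
    and r: "r \<in> {1..d}" and c: "c \<in> {1..d}" and rc: "r \<noteq> c"
  shows "conj_var z r c (S \<union> S') \<xi>"
proof -
  \<comment> \<open>Pairs of index \<open>i\<close> keep their derivation; those of the other
    indices have derivative zero.\<close>
  define M where "M j = (if j = i then dpair_algebra (conj_gens z r c S) else dpair_const ` B j)" for j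
  have gens_alg: "algebra_generated (insert z S \<union> diagonal d p) \<subseteq> B i"
    using zS diag_B sub_B by (intro algebra_generated_minimal) auto
  have fst_M: "fst g \<in> B j" if "g \<in> M j" for g j
  proof (cases "j = i")
    case True
    then have "fst g \<in> fst ` dpair_algebra (conj_gens z r c S)" using that by (simp add: M_def)
    then show ?thesis using gens_alg True unfolding fst_conj_algebra by blast
  qed (use that in \<open>auto simp: M_def dpair_const_def\<close>)
  have M_mult: "dpair_mult g h \<in> M j" if "g \<in> M j" "h \<in> M j" for g h j
  proof (cases "j = i")
    case False
    with that obtain a b where "a \<in> B j" "b \<in> B j" "g = dpair_const a" "h = dpair_const b"
      by (auto simp: M_def)
    moreover from this have "dpair_mult g h = dpair_const (a * b)" by (simp add: dpair_defs)
    ultimately show ?thesis using False B_mult by (simp add: M_def)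
  qed (use that in \<open>simp add: M_def dpair_algebra.mult\<close>)
  have M_diag: "dpair_const \<delta> \<in> M j" if "\<delta> \<in> diagonal d p" for \<delta> j
    using that diag_B by (auto simp: M_def conj_gens_def intro: dpair_algebra.base)
  have M_linear: "dpair_linear g" if "g \<in> M j" for g j
    using that dpair_linear_algebra[OF _ dpair_linear_conj_gens] dpair_linear_const
    by (auto simp: M_def split: if_splits)
  \<comment> \<open>Subtracting the constant pair of the expectation does not touch the derivative,
    so centring stays inside \<open>M j\<close>.\<close>
  have M_split: "\<exists>g0\<in>M j. \<exists>\<delta>\<in>diagonal d p. centered (fst g0) \<and> g = dpair_add g0 (dpair_const \<delta>)" if g: "g \<in> M j" for g j
  proof (intro bexI conjI)
    let ?e = "cond_exp \<phi> d p (fst g)"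
    let ?g0 = "dpair_add g (dpair_scale (-1) (dpair_const ?e))"
    show "?e \<in> diagonal d p" by (rule cond_exp_diagonal)
    have f: "fst ?g0 = fst g - ?e" by (simp add: dpair_defs scaleC_minus_one)
    show "centered (fst ?g0)" unfolding f by (rule centered_diff_cond_exp)
    show "g = dpair_add ?g0 (dpair_const ?e)" by (simp add: dpair_defs scaleC_minus_one)
    show "?g0 \<in> M j"
    proof (cases "j = i")
      case True
      then show ?thesis using g M_diag[OF cond_exp_diagonal, of "fst g" j]
        by (simp add: M_def dpair_algebra.add dpair_algebra.scale)
    next
      case False
      then obtain a where a: "a \<in> B j" "g = dpair_const a" using g by (auto simp: M_def)
      then have "?g0 = dpair_const (a - cond_exp \<phi> d p a)" by (simp add: dpair_defs scaleC_minus_one)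
      then show ?thesis using False B_diff_cond_exp[OF a(1)] by (simp add: M_def)
    qed
  qed
  define R where "R W \<longleftrightarrow> reduced B (map (map_prod id fst) W) \<and> (\<forall>(j, g)\<in>set W. g \<in> M j)" for W
  have R_Cons: "R ((j, g) # W) \<longleftrightarrow> g \<in> M j \<and> centered (fst g) \<and> R W \<and> (W \<noteq> [] \<longrightarrow> fst (hd W) \<noteq> j)" for j g W
    using fst_M[of g j] by (cases W) (auto simp: R_def reduced_Cons)
  define Y where "Y = {dpair_prod (map snd W) | W. R W \<and> W \<noteq> []} \<union> dpair_const ` diagonal d p"
  have YI: "dpair_prod (map snd W) \<in> dpair_span Y" if "R W" for W
  proof (cases "W = []")
    case True then show ?thesis using one_diagonal by (auto simp: Y_def intro!: dpair_span.base)
  next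
    case False then show ?thesis using that by (auto simp: Y_def intro!: dpair_span.base)
  qed
  have lin_R: "dpair_linear (dpair_prod (map snd W))" if "R W" for W
    using that M_linear by (intro dpair_linear_prod) (auto simp: R_def)
  have absorb_M: "dpair_mult g (dpair_prod (map snd W)) \<in> dpair_span Y"
    if g: "g \<in> M j" and W: "R W" "W \<noteq> [] \<longrightarrow> fst (hd W) \<noteq> j" for g j W
  proof -
    obtain g0 \<delta> where g0: "g0 \<in> M j" "\<delta> \<in> diagonal d p" "centered (fst g0)" "g = dpair_add g0 (dpair_const \<delta>)"
      using M_split[OF g] by blast
    have "dpair_mult g0 (dpair_prod (map snd W)) \<in> dpair_span Y"
      using YI[of "(j, g0) # W"] g0 W by (simp add: R_Cons)
    moreover have "dpair_mult (dpair_const \<delta>) (dpair_prod (map snd W)) \<in> dpair_span Y"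
    proof (cases W)
      case Nil
      then show ?thesis using g0(2) by (auto simp: Y_def dpair_mult_const_1[OF dpair_linear_const] intro!: dpair_span.base)
    next
      case (Cons a W')
      obtain j' h where a: "a = (j', h)" by (cases a)
      \<comment> \<open>A diagonal factor joins the first letter, which stays centred.\<close>
      have "R ((j', dpair_mult (dpair_const \<delta>) h) # W')"
        using W(1) M_mult[OF M_diag[OF g0(2)]] centered_mult_diagonal(1)[OF _ g0(2)]
        unfolding Cons a R_Cons by (auto simp: dpair_mult_def dpair_const_def)
      from YI[OF this] show ?thesis by (simp add: Cons a dpair_mult_assoc)
    qed
    ultimately show ?thesis unfolding g0(4) using lin_R[OF W(1)] by (simp add: dpair_mult_add_left dpair_span.add)
  qed
  have absorb: "dpair_mult g h \<in> dpair_span Y" if gX: "g \<in> conj_gens z r c (S \<union> S')" and hY: "h \<in> Y" for g h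
  proof -
    obtain j where g: "g \<in> M j"
    proof -
      from gX consider "g \<in> conj_gens z r c S" | s where "s \<in> S'" "g = dpair_const s"
        unfolding conj_gens_def by blast
      then show ?thesis
      proof cases
        case 1 then show ?thesis using that[of i] by (simp add: M_def dpair_algebra.base)
      next
        case 2
        then obtain j where "j \<noteq> i" "s \<in> B j" using S' by blast
        then show ?thesis using that[of j] 2 by (simp add: M_def)
      qed
    qed
    from hY consider \<delta> where "\<delta> \<in> diagonal d p" "h = dpair_const \<delta>" | W where "R W" "W \<noteq> []" "h = dpair_prod (map snd W)"
      unfolding Y_def by blast
    then show ?thesis
    proof cases
      case (1 \<delta>)
      have gh: "dpair_mult g h \<in> M j" unfolding 1(2) by (rule M_mult[OF g M_diag[OF 1(1)]])
      from absorb_M[OF this, of "[]"] show ?thesis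
        by (simp add: R_def reduced_def dpair_mult_const_1[OF M_linear[OF gh]])
    next
      case (2 W)
      then obtain j' h1 W' where W: "W = (j', h1) # W'" by (cases W) auto
      show ?thesis
      proof (cases "j' = j")
        case True
        then have "dpair_mult (dpair_mult g h1) (dpair_prod (map snd W')) \<in> dpair_span Y"
          using 2(1) g M_mult unfolding W by (intro absorb_M[of _ j]) (auto simp: R_Cons)
        then show ?thesis by (simp add: 2 W dpair_mult_assoc)
      next
        case False
        then show ?thesis using absorb_M[OF g 2(1)] unfolding 2(3) by (simp add: W)
      qed
    qed
  qed
  have onY: "\<phi> (p r) * pairing \<xi> (fst h) = snd h 1 1" if "h \<in> Y" for h
  proof -
    from that consider \<delta> where "\<delta> \<in> diagonal d p" "h = dpair_const \<delta>" | W where "R W" "W \<noteq> []" "h = dpair_prod (map snd W)"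
      unfolding Y_def by blast
    then show ?thesis
    proof cases
      case (1 \<delta>)
      obtain k where "p r * \<delta> = k r *\<^sub>C p r" using diagonal_mult_projection[OF 1(1)] r by metis
      \<comment> \<open>Here \<open>r \<noteq> c\<close> enters: a vector in an off-diagonal corner
        pairs to zero with the diagonal.\<close>
      then have "p r * \<delta> * p c = 0" using r c rc by (simp add: mult_scaleC_left projection_orth)
      moreover have "pairing \<xi> (p r * \<delta> * p c) = pairing \<xi> \<delta>"
        using cv pairing_L2_corner[OF c r] unfolding conj_var_def by blast
      ultimately show ?thesis by (simp add: 1 dpair_const_def)
    next
      case (2 W)
      let ?w = "map (map_prod id fst) W"
      have red: "reduced B ?w" "?w \<noteq> []" and inM: "\<forall>(j, g)\<in>set W. g \<in> M j" using 2 by (auto simp: R_def)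
      have snd_w: "map fst (map snd W) = map snd ?w" by simp
      show ?thesis
      proof (cases "length W = 1 \<and> fst (hd W) = i")
        case True
        then obtain g where W: "W = [(i, g)]" by (cases W) auto
        then have g: "g \<in> M i" using inM by simp
        then have "h = g" unfolding 2(3) W by (simp add: dpair_mult_const_1[OF M_linear[OF g]])
        then show ?thesis using g cv unfolding M_def conj_var_def by simp
      next
        case False
        have hd_w: "fst (hd ?w) = fst (hd W)" using 2(2) by (cases W) auto
        have "\<xi> \<in> closure (emb ` B i)"
          using cv closure_mono[OF image_mono[OF gens_alg]] unfolding conj_var_def by blast
        then have "pairing \<xi> (prod_list (map snd ?w)) = 0"
          using False hd_w by (intro pairing_reduced[OF _ red]) auto
        then have l: "pairing \<xi> (fst h) = 0" unfolding 2(3) fst_dpair_prod snd_w .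
        have "snd (map snd W ! m) (1 * prod_list (map fst (take m (map snd W))))
            (prod_list (map fst (drop (Suc m) (map snd W))) * 1) = 0" if m: "m < length W" for m
        proof (cases "fst (W ! m) = i")
          case nm: False
          obtain j g where Wm: "W ! m = (j, g)" by (cases "W ! m")
          then have "g \<in> M j" using inM m by (metis (mono_tags, lifting) case_prodD nth_mem)
          then show ?thesis using nm m Wm by (auto simp: M_def dpair_const_def)
        next
          case im: True
          obtain g where Wm: "W ! m = (i, g)" using im by (metis prod.collapse)
          then have g: "g \<in> dpair_algebra (conj_gens z r c S)"
            using inM m by (metis (mono_tags, lifting) M_def case_prodD nth_mem)
          have adj: "fst (W ! n) \<noteq> fst (W ! Suc n)" if "Suc n < length W" for n
            using red(1) distinct_adj_nth[of "map fst ?w" n] that by (simp add: reduced_def)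
          have e: "map fst (take m (map snd W)) = map snd (take m ?w)"
            "map fst (drop (Suc m) (map snd W)) = map snd (drop (Suc m) ?w)"
            by (simp_all add: take_map drop_map)
          show ?thesis
          proof (cases m)
            \<comment> \<open>The word on the left is reduced and ends in another algebra, so its
              product with any element of \<open>B i\<close> has trace zero.\<close>
            case (Suc n)
            have "last (take m ?w) = ?w ! n" using m Suc by (simp add: take_Suc_conv_app_nth)
            then have "fst (last (take m ?w)) \<noteq> i" using adj[of n] m Suc im by simp
            moreover have "take m ?w \<noteq> []" using m Suc by auto
            ultimately have "\<phi> (prod_list (map snd (take m ?w)) * b) = 0" if "b \<in> B i" for b
              using phi_reduced_mult reduced_take[OF red(1)] that by blast
            then show ?thesis
              unfolding e using conj_algebra_vanish(1)[OF g zS r c] m Wm by simp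
          next
            \<comment> \<open>Nothing stands on the left of the first letter, so the word on the
              right takes over; it is nonempty because single letters of index \<open>i\<close> were
              set aside.\<close>
            case 0
            have len: "Suc m < length W" using False im 0 2(2) by (cases W; cases "tl W") auto
            then have "hd (drop (Suc m) ?w) = ?w ! Suc m" by (simp add: hd_drop_conv_nth)
            then have "fst (hd (drop (Suc m) ?w)) \<noteq> i" using adj[OF len] len im by simp
            moreover have "drop (Suc m) ?w \<noteq> []" using len by simp
            ultimately have "\<phi> (b * prod_list (map snd (drop (Suc m) ?w))) = 0" if "b \<in> B i" for b
              using phi_mult_reduced reduced_drop[OF red(1)] that by blast
            then show ?thesis
              unfolding e using conj_algebra_vanish(2)[OF g zS r c] m Wm by simp
          qed
        qed
        then have "snd h 1 1 = 0" unfolding 2(3) snd_dpair_prod length_map by (intro sum.neutral) blast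
        then show ?thesis using l by simp
      qed
    qed
  qed
  have one: "dpair_const 1 \<in> dpair_span Y"
    using one_diagonal by (auto simp: Y_def intro!: dpair_span.base)
  have linY: "dpair_linear h" if "h \<in> Y" for h
    using that lin_R dpair_linear_const unfolding Y_def by blast
  have "\<phi> (p r) * pairing \<xi> (fst g) = snd g 1 1" if "g \<in> dpair_algebra (conj_gens z r c (S \<union> S'))" for g
  proof -
    have "g \<in> dpair_span Y"
      by (rule dpair_algebra_subset_span[OF _ _ one _ that]) (use dpair_linear_conj_gens linY absorb in blast)+
    then show ?thesis using pairing_vanish_on_span onY by blast
  qed
  moreover have "\<xi> \<in> closure (emb ` algebra_generated (insert z (S \<union> S') \<union> diagonal d p))"
  proof -
    have "algebra_generated (insert z S \<union> diagonal d p) \<subseteq> algebra_generated (insert z (S \<union> S') \<union> diagonal d p)"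
      by (rule algebra_generated_mono) auto
    from closure_mono[OF image_mono[OF this]] show ?thesis using cv unfolding conj_var_def by blast
  qed
  ultimately show ?thesis using cv unfolding conj_var_def by blast
qed

end

section \<open>Freeness from equality\<close>

context corner_setting
begin

text \<open>The second component belongs to the inner derivation
  \<open>b \<mapsto> b e - e b\<close> with \<open>e = \<Sum>\<^sub>s p\<^sub>s \<otimes> p\<^sub>s\<close>, whose value under \<open>\<phi> \<otimes> \<phi>\<close> is zero.\<close>

definition inner_pair :: "'a \<Rightarrow> 'a dpair" where
  "inner_pair b = (b, \<lambda>u v. \<Sum>s=1..d. \<phi> (u * b * p s) * \<phi> (p s * v) - \<phi> (u * p s) * \<phi> (p s * b * v))"

lemma fst_inner_pair [simp]: "fst (inner_pair b) = b"
  by (simp add: inner_pair_def)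

lemma inner_pair_add: "inner_pair (a + b) = dpair_add (inner_pair a) (inner_pair b)"
  by (simp add: inner_pair_def dpair_add_def algebra_simps sum.distrib[symmetric] fun_eq_iff)

lemma inner_pair_scale: "inner_pair (c *\<^sub>C a) = dpair_scale c (inner_pair a)"
  by (simp add: inner_pair_def dpair_scale_def sum_distrib_left mult_scaleC_left mult_scaleC_right
      algebra_simps fun_eq_iff)

lemma inner_pair_mult: "inner_pair (a * b) = dpair_mult (inner_pair a) (inner_pair b)"
  by (simp add: inner_pair_def dpair_mult_def mult.assoc sum.distrib[symmetric] fun_eq_iff)

lemma snd_inner_pair_1_1: "snd (inner_pair b) 1 1 = 0"
  by (simp add: inner_pair_def phi_trace[of b])

text \<open>\<open>e\<close> commutes with the diagonal. Hence the inner derivation agrees with the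
  zero derivation on the part that the two algebras share.\<close>

lemma inner_pair_diagonal:
  assumes "\<delta> \<in> diagonal d p"
  shows "inner_pair \<delta> = dpair_const \<delta>"
proof -
  obtain k where "\<And>s. s \<in> {1..d} \<Longrightarrow> p s * \<delta> = k s *\<^sub>C p s" "\<And>s. s \<in> {1..d} \<Longrightarrow> \<delta> * p s = k s *\<^sub>C p s"
    using diagonal_mult_projection[OF assms] by metis
  then show ?thesis
    by (auto simp: inner_pair_def dpair_const_def fun_eq_iff mult.assoc mult_scaleC_left mult_scaleC_right
        mult.assoc[symmetric, of "p _" \<delta>] intro!: sum.neutral)
qed

text \<open>The inner derivation sends \<open>z\<close> to \<open>z \<otimes> p\<^sub>c - p\<^sub>r \<otimes> z\<close>.\<close>

lemma snd_inner_pair_corner: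
  assumes r: "r \<in> {1..d}" and c: "c \<in> {1..d}" and z: "z \<in> corner p r c"
  shows "snd (inner_pair z) u v = split_phi r c (z * u) v - split_phi r c u (v * z)"
proof -
  have zs: "u * z * p s = (if s = c then u * z else 0)" "p s * z * v = (if s = r then z * v else 0)"
    if "s \<in> {1..d}" for s
    using corner_mult_right[OF r c that z] corner_mult_left[OF r c that z] by (simp_all add: mult.assoc)
  have "snd (inner_pair z) u v = (\<Sum>s=1..d. (if s = c then \<phi> (u * z) * \<phi> (p c * v) else 0) -
      (if s = r then \<phi> (u * p r) * \<phi> (z * v) else 0))"
    unfolding inner_pair_def snd_conv by (intro sum.cong) (auto simp: zs)
  also have "\<dots> = \<phi> (u * z) * \<phi> (p c * v) - \<phi> (u * p r) * \<phi> (z * v)"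
    using r c by (simp add: sum_subtractf)
  \<comment> \<open>The trace cycles \<open>z\<close> to the outer side of each leg, the form that a
    commutator of the conjugate variable with \<open>z\<close> reproduces.\<close>
  also have "\<phi> (u * z) = \<phi> (z * u * p r)"
    using phi_trace[of "z * u" "p r"] corner_mult_left[OF r c r z] phi_trace[of u z]
    by (simp add: mult.assoc[symmetric])
  also have "\<phi> (z * v) = \<phi> (p c * (v * z))"
    using phi_trace[of "p c" "v * z"] corner_mult_right[OF r c c z] phi_trace[of z v]
    by (simp add: mult.assoc)
  finally show ?thesis by (simp add: split_phi_def)
qed

text \<open>In the expansion of \<open>\<phi> \<otimes> \<phi>\<close> of the derivation of a word that begins in the first algebra and ends in
  the second one, only the leading term survives, by induction on the length.\<close>

lemma free_step:
  assumes deriv: "\<And>g. g \<in> dpair_algebra X \<Longrightarrow> snd g 1 1 = 0"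
    and one: "dpair_const 1 \<in> dpair_algebra X"
    and X: "\<And>b. b \<in> B True \<Longrightarrow> inner_pair b \<in> dpair_algebra X" "\<And>b. b \<in> B False \<Longrightarrow> dpair_const b \<in> dpair_algebra X"
    and IH: "\<And>w'. length w' < length w \<Longrightarrow> reduced B w' \<Longrightarrow> w' \<noteq> [] \<Longrightarrow> centered (prod_list (map snd w'))"
    and w: "reduced B w" "w \<noteq> []" "\<not> fst (last w)" "fst (hd w)"
  shows "(\<Sum>t=1..d. \<phi> (p t) * \<phi> (p t * prod_list (map snd w))) = 0"
proof -
  \<comment> \<open>\<open>True\<close> marks the algebra on which the derivation is inner,
    \<open>False\<close> the one on which it vanishes.\<close>
  define G where "G ib = (if fst ib then inner_pair (snd ib) else dpair_const (snd ib))" for ib :: "bool \<times> 'a"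
  have fst_G: "fst (G ib) = snd ib" for ib by (simp add: G_def dpair_const_def)
  have map_G: "map fst (map G v) = map snd v" for v by (simp add: fst_G)
  have "dpair_prod (map G w) \<in> dpair_algebra X"
  proof (rule dpair_prod_in_algebra[OF _ one])
    fix g assume "g \<in> set (map G w)"
    then show "g \<in> dpair_algebra X" using w(1) X unfolding reduced_def G_def by fastforce
  qed
  from deriv[OF this] have z: "(\<Sum>m<length w. snd (G (w ! m)) (prod_list (map snd (take m w))) (prod_list (map snd (drop (Suc m) w)))) = 0"
    unfolding snd_dpair_prod take_map drop_map map_G by simp
  have IH_phi: "\<phi> (prod_list (map snd (take m w)) * p t) = 0" if "0 < m" "m < length w" "t \<in> {1..d}" for m t
  proof -
    have "centered (prod_list (map snd (take m w)))"
      using that w(1,2) by (intro IH reduced_take) auto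
    then show ?thesis using that phi_trace[of _ "p t"] unfolding centered_def by metis
  qed
  have "snd (G (w ! m)) (prod_list (map snd (take m w))) (prod_list (map snd (drop (Suc m) w))) =
      (if m = 0 then - (\<Sum>t=1..d. \<phi> (p t) * \<phi> (p t * prod_list (map snd w))) else 0)" if m: "m < length w" for m
  proof (cases "fst (w ! m)")
    case False
    moreover from this have "m \<noteq> 0" using w(2,4) by (metis hd_conv_nth)
    ultimately show ?thesis by (simp add: G_def dpair_const_def)
  next
    case True
    \<comment> \<open>The last letter belongs to the second algebra, so the prefix that includes
      letter \<open>m\<close> is still proper and the induction hypothesis covers it.\<close>
    have "w ! m \<noteq> last w" using True w(3) by metis
    then have Sm: "Suc m < length w" using m w(2) by (metis Suc_lessI diff_Suc_1 last_conv_nth)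
    have t: "prod_list (map snd (take m w)) * snd (w ! m) = prod_list (map snd (take (Suc m) w))"
      using m by (simp add: take_Suc_conv_app_nth)
    have dr: "p t * snd (w ! m) * prod_list (map snd (drop (Suc m) w)) = p t * prod_list (map snd (drop m w))" for t
      using Cons_nth_drop_Suc[OF m] by (metis list.simps(9) mult.assoc prod_list.Cons)
    have "snd (G (w ! m)) (prod_list (map snd (take m w))) (prod_list (map snd (drop (Suc m) w)))
      = (\<Sum>s=1..d. \<phi> (prod_list (map snd (take (Suc m) w)) * p s) * \<phi> (p s * prod_list (map snd (drop (Suc m) w)))
          - \<phi> (prod_list (map snd (take m w)) * p s) * \<phi> (p s * prod_list (map snd (drop m w))))"
      using True by (simp add: G_def inner_pair_def t dr)
    \<comment> \<open>What survives is the empty prefix at \<open>m = 0\<close>, whose left trace is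
      \<open>\<phi> (p s)\<close>; the sign is that of the second half of the inner
      derivation.\<close>
    also have "\<dots> = (\<Sum>s=1..d. - (if m = 0 then \<phi> (p s) * \<phi> (p s * prod_list (map snd w)) else 0))"
      using IH_phi[of "Suc m"] IH_phi[of m] Sm by (intro sum.cong) auto
    finally show ?thesis by (simp add: sum_negf)
  qed
  then have "(\<Sum>m<length w. snd (G (w ! m)) (prod_list (map snd (take m w))) (prod_list (map snd (drop (Suc m) w)))) =
      (\<Sum>m<length w. if m = 0 then - (\<Sum>t=1..d. \<phi> (p t) * \<phi> (p t * prod_list (map snd w))) else 0)"
    by (intro sum.cong) auto
  also have "\<dots> = - (\<Sum>t=1..d. \<phi> (p t) * \<phi> (p t * prod_list (map snd w)))"
    using w(2) by simp
  finally show ?thesis using z by simp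
qed

text \<open>Induction on the length, by the algebras of the two end letters. From first to second is
  the derivation argument; from second to first is reduced to it by cycling the last letter to the
  front. For equal ends the cycled letter merges with the first one, and centring the product leaves
  shorter reduced words.\<close>

lemma free_from_derivation:
  assumes deriv: "\<And>g. g \<in> dpair_algebra X \<Longrightarrow> snd g 1 1 = 0"
    and one: "dpair_const 1 \<in> dpair_algebra X"
    and X: "\<And>b. b \<in> B True \<Longrightarrow> inner_pair b \<in> dpair_algebra X" "\<And>b. b \<in> B False \<Longrightarrow> dpair_const b \<in> dpair_algebra X"
    and B: "\<And>i. star_subalgebra (B i)" "\<And>i. diagonal d p \<subseteq> B i"
  shows "free_subalgebras \<phi> d p B"
proof -
  have B_mult: "a * b \<in> B i" if "a \<in> B i" "b \<in> B i" for a b i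
    using B(1) that unfolding star_subalgebra_def subalgebra_def by blast
  have pB: "p s \<in> B i" if "s \<in> {1..d}" for s i using projection_diagonal[OF that] B(2) by blast
  have "centered (prod_list (map snd w))" if "reduced B w" "w \<noteq> []" for w
    using that
  proof (induction w rule: length_induct)
    case (1 w)
    have IH: "centered (prod_list (map snd w'))" if "length w' < length w" "reduced B w'" "w' \<noteq> []" for w'
      using 1 that by blast
    have forward: "centered (prod_list (map snd w'))"
      if w': "length w' = length w" "reduced B w'" "fst (hd w')" "\<not> fst (last w')" for w'
    proof -
      from w'(1) 1(3) have "w' \<noteq> []" by auto
      then obtain b v where bv: "w' = (True, b) # v" using w'(3) by (cases w') auto
      have v: "v \<noteq> []" using w'(3,4) bv by auto
      have "\<phi> (p s * prod_list (map snd w')) = 0" if s: "s \<in> {1..d}" for s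
      proof -
        \<comment> \<open>Multiplying the first letter by \<open>p s\<close> isolates the summand
          \<open>t = s\<close> of the weighted sum.\<close>
        let ?v = "(True, p s * b) # v"
        have "(\<Sum>t=1..d. \<phi> (p t) * \<phi> (p t * prod_list (map snd ?v))) = 0"
        proof (rule free_step[OF deriv one X])
          show "reduced B ?v"
            using w'(2) B_mult[OF pB[OF s]] centered_mult_diagonal(1)[OF _ projection_diagonal[OF s]]
            unfolding bv by (auto simp: reduced_Cons)
          show "\<not> fst (last ?v)" using w'(4) v unfolding bv by simp
          show "centered (prod_list (map snd u))" if "length u < length ?v" "reduced B u" "u \<noteq> []" for u
            using that w'(1) bv by (intro IH) auto
        qed auto
        moreover have "(\<Sum>t=1..d. \<phi> (p t) * \<phi> (p t * prod_list (map snd ?v))) =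
            (\<Sum>t=1..d. if t = s then \<phi> (p s) * \<phi> (p s * prod_list (map snd w')) else 0)"
          using s by (intro sum.cong) (auto simp: bv mult.assoc projection_orth_assoc)
        ultimately show ?thesis using s phi_projection_nonzero[OF s] by simp
      qed
      then show ?thesis unfolding centered_def by blast
    qed
    obtain i b v where ibv: "w = (i, b) # v" using 1(3) by (cases w) auto
    show ?case
    proof (cases "v = []")
      case True
      then show ?thesis using 1(2) by (simp add: ibv reduced_Cons)
    next
      case False
      then obtain u j e where uje: "v = u @ [(j, e)]" by (metis rev_exhaust prod.exhaust)
      have w: "w = ((i, b) # u) @ [(j, e)]" by (simp add: ibv uje)
      have red: "b \<in> B i" "centered b" "e \<in> B j" "centered e" "reduced B u" "reduced B ((i, b) # u)"
        "u \<noteq> [] \<Longrightarrow> fst (hd u) \<noteq> i" "u \<noteq> [] \<Longrightarrow> fst (last u) \<noteq> j" "u = [] \<Longrightarrow> i \<noteq> j"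
        using 1(2) unfolding w reduced_snoc by (auto simp: reduced_Cons)
      consider "i" "\<not> j" | "\<not> i" "j" | "i = j" by blast
      then show ?thesis
      proof cases
        case 1
        show ?thesis by (rule forward) (use 1 "1.prems" in \<open>auto simp: w\<close>)
      next
        case 2
        have "\<phi> (p s * prod_list (map snd w)) = 0" if s: "s \<in> {1..d}" for s
        proof -
          have "centered (prod_list (map snd ((True, e * p s) # (i, b) # u)))"
          proof (rule forward)
            show "reduced B ((True, e * p s) # (i, b) # u)"
              using red 2 B_mult[OF _ pB[OF s]] centered_mult_diagonal(2)[OF _ projection_diagonal[OF s]]
              by (auto simp: reduced_Cons)
            show "\<not> fst (last ((True, e * p s) # (i, b) # u))" using red(8) 2 by (cases "u = []") auto
          qed (auto simp: w)
          from centered_phi[OF this] show ?thesis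
            using phi_trace[of "p s * b * prod_list (map snd u)" e] by (simp add: w mult.assoc)
        qed
        then show ?thesis unfolding centered_def by blast
      next
        case 3
        then have u: "u \<noteq> []" using red(9) by blast
        have "\<phi> (p s * prod_list (map snd w)) = 0" if s: "s \<in> {1..d}" for s
        proof -
          \<comment> \<open>The cycled last letter, the projection and the first letter all lie in
            the same algebra and form one letter, not yet centred.\<close>
          let ?f = "e * p s * b" let ?d = "cond_exp \<phi> d p ?f"
          have f: "?f \<in> B i" using red(1,3) 3 B_mult pB[OF s] by blast
          have "?f - ?d \<in> B i"
            using f B cond_exp_diagonal subalgebra_diff unfolding star_subalgebra_def by blast
          then have "centered (prod_list (map snd ((i, ?f - ?d) # u)))"
            using red(5,7) u centered_diff_cond_exp by (intro IH) (auto simp: w reduced_Cons)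
          then have "\<phi> ((?f - ?d) * prod_list (map snd u)) = 0" using centered_phi by fastforce
          moreover have "centered (prod_list (map snd u))" using red(5) u by (intro IH) (auto simp: w)
          then have "\<phi> (?d * prod_list (map snd u)) = 0"
            using centered_mult_diagonal(1)[OF _ cond_exp_diagonal] centered_phi by blast
          ultimately have "\<phi> (?f * prod_list (map snd u)) = 0" by (simp add: left_diff_distrib)
          then show ?thesis
            using phi_trace[of "p s * b * prod_list (map snd u)" e] by (simp add: w mult.assoc)
        qed
        then show ?thesis unfolding centered_def by blast
      qed
    qed
  qed
  then show ?thesis using B unfolding free_subalgebras_iff by blast
qed

text \<open>If the conjugate variables lie in the \<open>L\<^sup>2\<close>-closure of the first algebra, then so does the
  element \<open>\<zeta>\<close> below that implements the derivation vanishing on the second algebra and inner on the first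
  one; it is orthogonal to the first algebra, hence zero.\<close>

lemma free_if_conj_var_in_closure:
  assumes k: "k \<in> {1..d}" and l: "l \<in> {1..d}" and x: "x \<in> corner p k l"
    and \<xi>: "conj_var x k l {y, star x, star y} \<xi>" "\<xi> \<in> closure (emb ` algebra_generated ({x, star x} \<union> diagonal d p))"
    and \<eta>: "conj_var (star x) l k {x, y, star y} \<eta>" "\<eta> \<in> closure (emb ` algebra_generated ({x, star x} \<union> diagonal d p))"
  shows "free_elements \<phi> d p (\<lambda>b::bool. if b then x else y)"
proof -
  let ?B1 = "algebra_generated ({x, star x} \<union> diagonal d p)"
  let ?B2 = "algebra_generated ({y, star y} \<union> diagonal d p)"
  have sub1: "subalgebra ?B1" and sub2: "subalgebra ?B2" by (rule algebra_generated_subalgebra)+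
  have xB: "x \<in> ?B1" "star x \<in> ?B1" using algebra_generated_superset[of "{x, star x} \<union> diagonal d p"] by auto
  have yB: "y \<in> ?B2" using algebra_generated_superset[of "{y, star y} \<union> diagonal d p"] by auto
  have dB: "diagonal d p \<subseteq> ?B1" "diagonal d p \<subseteq> ?B2"
    using algebra_generated_superset[of "{x, star x} \<union> diagonal d p"]
      algebra_generated_superset[of "{y, star y} \<union> diagonal d p"] by auto
  have starx: "star x \<in> corner p l k" using corner_star[OF k l x] .
  \<comment> \<open>Generators for the graph of the glued derivation. Diagonal elements enter as
    inner pairs, which are constant pairs as well.\<close>
  define X where "X = inner_pair ` ({x, star x} \<union> diagonal d p) \<union> dpair_const ` {y, star y}"
  have X1: "inner_pair b \<in> dpair_algebra X" if "b \<in> {x, star x} \<union> diagonal d p" for b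
    by (rule dpair_algebra.base) (unfold X_def, use that in blast)
  have X2: "dpair_const b \<in> dpair_algebra X" if "b \<in> {y, star y}" for b
    by (rule dpair_algebra.base) (unfold X_def, use that in blast)
  have Xd: "dpair_const \<delta> \<in> dpair_algebra X" if "\<delta> \<in> diagonal d p" for \<delta>
    using X1[of \<delta>] that unfolding inner_pair_diagonal[OF that] by blast
  have zd: "0 \<in> diagonal d p" using diagonalI[of "\<lambda>_. 0"] by simp
  have in1: "inner_pair b \<in> dpair_algebra X" if "b \<in> ?B1" for b
  proof -
    have "subalgebra {b. inner_pair b \<in> dpair_algebra X}"
      unfolding subalgebra_def mem_Collect_eq Ball_def inner_pair_add inner_pair_mult inner_pair_scale
        inner_pair_diagonal[OF zd]
      using Xd[OF zd] dpair_algebra.add dpair_algebra.mult dpair_algebra.scale by blast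
    moreover have "{x, star x} \<union> diagonal d p \<subseteq> {b. inner_pair b \<in> dpair_algebra X}"
      using X1 by blast
    ultimately show ?thesis using that algebra_generated_minimal by blast
  qed
  have in2: "dpair_const b \<in> dpair_algebra X" if "b \<in> ?B2" for b
  proof -
    have c: "dpair_const (a + b) = dpair_add (dpair_const a) (dpair_const b)"
      "dpair_const (a * b) = dpair_mult (dpair_const a) (dpair_const b)"
      "dpair_const (c *\<^sub>C a) = dpair_scale c (dpair_const a)" for a b :: 'a and c
      by (simp_all add: dpair_defs)
    have "subalgebra {b. dpair_const b \<in> dpair_algebra X}"
      unfolding subalgebra_def mem_Collect_eq Ball_def c
      using Xd[OF zd] dpair_algebra.add dpair_algebra.mult dpair_algebra.scale by blast
    moreover have "{y, star y} \<union> diagonal d p \<subseteq> {b. dpair_const b \<in> dpair_algebra X}"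
      using Xd X2 by blast
    ultimately show ?thesis using that algebra_generated_minimal by blast
  qed
  let ?X1 = "conj_gens x k l {y, star x, star y}" and ?X2 = "conj_gens (star x) l k {x, y, star y}"
  \<comment> \<open>\<open>S\<close> and \<open>T\<close> are derivatives of the same element
    \<open>fst g\<close> with respect to \<open>x\<close> and \<open>star x\<close>. Up to the
    trace, the glued derivation is the sum of their commutators with \<open>x\<close> and
    \<open>star x\<close>; the formula holds on generators and is compatible with the Leibniz rule.
    Witnesses are asserted to exist because lifts of \<open>fst g\<close> need not be
    unique.\<close>
  have rep: "\<exists>S T. (fst g, S) \<in> dpair_algebra ?X1 \<and> (fst g, T) \<in> dpair_algebra ?X2 \<and>
      (\<forall>u v. snd g u v = S (x * u) v - S u (v * x) + (T (star x * u) v - T u (v * star x)))"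
    if "g \<in> dpair_algebra X" for g
    using that
  proof (induction rule: dpair_algebra.induct)
    case (base g)
    let ?nul = "\<lambda>u v. 0"
    have c1: "(s, ?nul) \<in> dpair_algebra ?X1" if "s \<in> {y, star x, star y} \<union> diagonal d p" for s
      using that by (intro dpair_algebra.base) (auto simp: conj_gens_def dpair_const_def)
    have c2: "(s, ?nul) \<in> dpair_algebra ?X2" if "s \<in> {x, y, star y} \<union> diagonal d p" for s
      using that by (intro dpair_algebra.base) (auto simp: conj_gens_def dpair_const_def)
    have t1: "(x, split_phi k l) \<in> dpair_algebra ?X1" and t2: "(star x, split_phi l k) \<in> dpair_algebra ?X2"
      by (auto intro!: dpair_algebra.base simp: conj_gens_def)
    from base consider "g = inner_pair x" | "g = inner_pair (star x)"
      | \<delta> where "\<delta> \<in> diagonal d p \<union> {y, star y}" "g = dpair_const \<delta>"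
      unfolding X_def using inner_pair_diagonal by auto
    then show ?case
    proof cases
      case 1
      show ?thesis
        by (rule exI[of _ "split_phi k l"], rule exI[of _ ?nul])
          (use t1 c2[of x] snd_inner_pair_corner[OF k l x] in \<open>simp add: 1\<close>)
    next
      case 2
      show ?thesis
        by (rule exI[of _ ?nul], rule exI[of _ "split_phi l k"])
          (use t2 c1[of "star x"] snd_inner_pair_corner[OF l k starx] in \<open>simp add: 2\<close>)
    next
      case (3 \<delta>)
      show ?thesis
        by (rule exI[of _ ?nul], rule exI[of _ ?nul]) (use c1[of \<delta>] c2[of \<delta>] 3 in \<open>auto simp: dpair_const_def\<close>)
    qed
  next
    case (add g h)
    then obtain S T S' T' where
      *: "(fst g, S) \<in> dpair_algebra ?X1" "(fst g, T) \<in> dpair_algebra ?X2"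
        "\<forall>u v. snd g u v = S (x * u) v - S u (v * x) + (T (star x * u) v - T u (v * star x))"
        "(fst h, S') \<in> dpair_algebra ?X1" "(fst h, T') \<in> dpair_algebra ?X2"
        "\<forall>u v. snd h u v = S' (x * u) v - S' u (v * x) + (T' (star x * u) v - T' u (v * star x))"
      by blast
    show ?case
      by (rule exI[of _ "\<lambda>u v. S u v + S' u v"], rule exI[of _ "\<lambda>u v. T u v + T' u v"])
        (use dpair_algebra.add[OF *(1,4)] dpair_algebra.add[OF *(2,5)] *(3,6) in \<open>simp add: dpair_add_def\<close>)
  next
    case (scale g c)
    then obtain S T where
      *: "(fst g, S) \<in> dpair_algebra ?X1" "(fst g, T) \<in> dpair_algebra ?X2"
        "\<forall>u v. snd g u v = S (x * u) v - S u (v * x) + (T (star x * u) v - T u (v * star x))"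
      by blast
    show ?case
      by (rule exI[of _ "\<lambda>u v. c * S u v"], rule exI[of _ "\<lambda>u v. c * T u v"])
        (use dpair_algebra.scale[OF *(1), of c] dpair_algebra.scale[OF *(2), of c] *(3) in
          \<open>simp add: dpair_scale_def distrib_left right_diff_distrib\<close>)
  next
    case (mult g h)
    then obtain S T S' T' where
      *: "(fst g, S) \<in> dpair_algebra ?X1" "(fst g, T) \<in> dpair_algebra ?X2"
        "\<forall>u v. snd g u v = S (x * u) v - S u (v * x) + (T (star x * u) v - T u (v * star x))"
        "(fst h, S') \<in> dpair_algebra ?X1" "(fst h, T') \<in> dpair_algebra ?X2"
        "\<forall>u v. snd h u v = S' (x * u) v - S' u (v * x) + (T' (star x * u) v - T' u (v * star x))"
      by blast
    show ?case
      by (rule exI[of _ "\<lambda>u v. S u (fst h * v) + S' (u * fst g) v"],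
          rule exI[of _ "\<lambda>u v. T u (fst h * v) + T' (u * fst g) v"])
        (use dpair_algebra.mult[OF *(1,4)] dpair_algebra.mult[OF *(2,5)] *(3,6) in
          \<open>simp add: dpair_mult_def mult.assoc\<close>)
  qed
  \<comment> \<open>The scalars are the factors that \<open>conj_var\<close> puts in front of the
    two pairings.\<close>
  define \<zeta> where "\<zeta> = L2_rmult emb \<xi> (\<phi> (p k) *\<^sub>C x) - L2_lmult emb (\<phi> (p k) *\<^sub>C x) \<xi> +
      (L2_rmult emb \<eta> (\<phi> (p l) *\<^sub>C star x) - L2_lmult emb (\<phi> (p l) *\<^sub>C star x) \<eta>)"
  have \<zeta>_pair: "pairing \<zeta> (fst g) = snd g 1 1" if g: "g \<in> dpair_algebra X" for g
  proof -
    let ?b = "fst g"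
    obtain S T where ST: "(?b, S) \<in> dpair_algebra ?X1" "(?b, T) \<in> dpair_algebra ?X2"
      "\<And>u v. snd g u v = S (x * u) v - S u (v * x) + (T (star x * u) v - T u (v * star x))"
      using rep[OF g] by blast
    have t1: "(x, split_phi k l) \<in> dpair_algebra ?X1" and t2: "(star x, split_phi l k) \<in> dpair_algebra ?X2"
      by (auto intro!: dpair_algebra.base simp: conj_gens_def)
    have r1: "\<phi> (p k) * pairing \<xi> (fst h) = snd h 1 1" if "h \<in> dpair_algebra ?X1" for h
      using \<xi>(1) that unfolding conj_var_def by blast
    have r2: "\<phi> (p l) * pairing \<eta> (fst h) = snd h 1 1" if "h \<in> dpair_algebra ?X2" for h
      using \<eta>(1) that unfolding conj_var_def by blast
    \<comment> \<open>Leibniz on the products with \<open>x\<close> and \<open>star x\<close> gives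
      the commutator terms and boundary terms in which the extra factor is differentiated. The
      boundary term of \<open>x\<close> on the left of \<open>?b\<close> cancels the one of
      \<open>star x\<close> on its right, and vice versa.\<close>
    have e: "\<phi> (p k) * pairing \<xi> (x * ?b) = \<phi> (p k) * \<phi> (p l * ?b) + S x 1"
      "\<phi> (p k) * pairing \<xi> (?b * x) = S 1 x + \<phi> (?b * p k) * \<phi> (p l)"
      "\<phi> (p l) * pairing \<eta> (star x * ?b) = \<phi> (p l) * \<phi> (p k * ?b) + T (star x) 1"
      "\<phi> (p l) * pairing \<eta> (?b * star x) = T 1 (star x) + \<phi> (?b * p l) * \<phi> (p k)"
      using r1[OF dpair_algebra.mult[OF t1 ST(1)]] r1[OF dpair_algebra.mult[OF ST(1) t1]]
        r2[OF dpair_algebra.mult[OF t2 ST(2)]] r2[OF dpair_algebra.mult[OF ST(2) t2]]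
      by (simp_all add: dpair_mult_def split_phi_def)
    have "pairing \<zeta> ?b = \<phi> (p k) * pairing \<xi> (x * ?b) - \<phi> (p k) * pairing \<xi> (?b * x) +
        (\<phi> (p l) * pairing \<eta> (star x * ?b) - \<phi> (p l) * pairing \<eta> (?b * star x))"
      unfolding \<zeta>_def by (simp add: pairing_add_left pairing_diff_left pairing_rmult pairing_lmult
          mult_scaleC_left mult_scaleC_right pairing_scaleC_right)
    also have "\<dots> = snd g 1 1"
      unfolding e ST(3) by (simp add: phi_trace[of ?b])
    finally show ?thesis .
  qed
  have "\<zeta> = 0"
  proof (rule pairing_zero_imp_zero)
    have "\<phi> (p k) *\<^sub>C x \<in> ?B1" "\<phi> (p l) *\<^sub>C star x \<in> ?B1"
      using xB sub1 unfolding subalgebra_def by blast+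
    then show "\<zeta> \<in> closure (emb ` ?B1)"
      unfolding \<zeta>_def using \<xi>(2) \<eta>(2) L2_rmult_closure[OF sub1] L2_lmult_closure[OF sub1]
      by (intro subspace_add subspace_diff subspace_emb_closure[OF sub1]) auto
    show "star b \<in> ?B1" if "b \<in> ?B1" for b
    proof -
      have "star_subalgebra ?B1"
        using diagonal_star by (intro star_subalgebra_generated) (auto simp: star_star)
      then show ?thesis using that unfolding star_subalgebra_def by blast
    qed
    show "pairing \<zeta> b = 0" if "b \<in> ?B1" for b
      using \<zeta>_pair[OF in1[OF that]] snd_inner_pair_1_1 by simp
  qed
  then have deriv: "snd g 1 1 = 0" if "g \<in> dpair_algebra X" for g using \<zeta>_pair[OF that] by simp
  have "free_subalgebras \<phi> d p (\<lambda>b. if b then ?B1 else ?B2)"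
  proof (rule free_from_derivation[OF deriv])
    show "dpair_const 1 \<in> dpair_algebra X" using Xd one_diagonal by blast
    show "star_subalgebra (if i then ?B1 else ?B2)" for i
      using diagonal_star by (auto intro!: star_subalgebra_generated simp: star_star)
    show "diagonal d p \<subseteq> (if i then ?B1 else ?B2)" for i
      using dB by simp
  qed (use in1 in2 in auto)
  moreover have "(if i then x else y) \<in> (if i then ?B1 else ?B2)" for i
    using xB(1) yB by simp
  ultimately show ?thesis unfolding free_elements_def by (intro exI[of _ "\<lambda>b. if b then ?B1 else ?B2"]) blast
qed

end

section \<open>Superadditivity and the case of equality\<close>

theorem theorem6p4:
  fixes \<phi> :: "'a::cstar_algebra \<Rightarrow> complex"
    and d :: nat
    and p :: "nat \<Rightarrow> 'a"
    and emb :: "'a \<Rightarrow> 'h::complex_hilbert_space"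
    and k l :: nat
    and x y :: 'a
  defines "\<Phi> \<equiv> fisher_information_list \<phi> d p emb"
  assumes "wstar_probability_space \<phi>"
    and "faithful \<phi>"
    and "tracial \<phi>"
    and "projection_partition d p"
    and "L2_completion \<phi> emb"
    and "k \<in> {1..d}" and "l \<in> {1..d}" and "k \<noteq> l"
    and "x \<in> corner p k l" and "x \<noteq> 0"
    and "y \<in> corner p k l" and "y \<noteq> 0"
  shows "\<Phi> [x, y, star x, star y] \<ge> \<Phi> [x, star x] + \<Phi> [y, star y] \<and>
    (free_elements \<phi> d p (\<lambda>b::bool. if b then x else y) \<longrightarrow>
       \<Phi> [x, y, star x, star y] = \<Phi> [x, star x] + \<Phi> [y, star y]) \<and>
    (\<Phi> [x, y, star x, star y] = \<Phi> [x, star x] + \<Phi> [y, star y] \<and>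
       \<Phi> [x, star x] + \<Phi> [y, star y] < \<infinity> \<longrightarrow>
       free_elements \<phi> d p (\<lambda>b::bool. if b then x else y))"
proof -
  interpret corner_setting \<phi> d p emb using assms by unfold_locales
  note kl = assms(7-9) and x = assms(10,11) and y = assms(12,13)
  note pair_x = fisher_pair[OF kl x, folded \<Phi>_def] and pair_y = fisher_pair[OF kl y, folded \<Phi>_def]
  note quad = fisher_quadruple[OF kl x y, folded \<Phi>_def]
  \<comment> \<open>One restriction argument serves the inequality and the converse. The clause on
    equal norms is kept for \<open>x\<close> and \<open>star x\<close>, on whose conjugate variables
    the freeness criterion rests.\<close>
  have dec: "\<exists>\<xi>0 (\<xi>0' :: 'h) \<eta>0 (\<eta>0' :: 'h). \<Phi> [x, star x] = ennreal ((norm \<xi>0)\<^sup>2) + ennreal ((norm \<eta>0)\<^sup>2) \<and>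
      \<Phi> [y, star y] = ennreal ((norm \<xi>0')\<^sup>2) + ennreal ((norm \<eta>0')\<^sup>2) \<and>
      conj_var x k l {star x} \<xi>0 \<and> conj_var (star x) l k {x} \<eta>0 \<and>
      norm \<xi>0 \<le> norm \<xi> \<and> norm \<xi>0' \<le> norm \<xi>' \<and> norm \<eta>0 \<le> norm \<eta> \<and> norm \<eta>0' \<le> norm \<eta>' \<and>
      (norm \<xi>0 = norm \<xi> \<longrightarrow> \<xi>0 = \<xi>) \<and> (norm \<eta>0 = norm \<eta> \<longrightarrow> \<eta>0 = \<eta>)"
    if cv: "conj_var x k l {y, star x, star y} \<xi>" "conj_var y k l {x, star x, star y} \<xi>'"
      "conj_var (star x) l k {x, y, star y} \<eta>" "conj_var (star y) l k {x, y, star x} \<eta>'" for \<xi> \<xi>' \<eta> \<eta>'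
  proof -
    obtain \<xi>0 where \<xi>0: "conj_var x k l {star x} \<xi>0" "norm \<xi>0 \<le> norm \<xi>" "norm \<xi>0 = norm \<xi> \<Longrightarrow> \<xi>0 = \<xi>"
      by (rule conj_var_restrict[OF cv(1), of "{star x}"]) (use kl in \<open>auto simp: star_star\<close>)
    obtain \<xi>0' where \<xi>0': "conj_var y k l {star y} \<xi>0'" "norm \<xi>0' \<le> norm \<xi>'"
      by (rule conj_var_restrict[OF cv(2), of "{star y}"]) (use kl in \<open>auto simp: star_star\<close>)
    obtain \<eta>0 where \<eta>0: "conj_var (star x) l k {x} \<eta>0" "norm \<eta>0 \<le> norm \<eta>" "norm \<eta>0 = norm \<eta> \<Longrightarrow> \<eta>0 = \<eta>"
      by (rule conj_var_restrict[OF cv(3), of "{x}"]) (use kl in \<open>auto simp: star_star\<close>)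
    obtain \<eta>0' where \<eta>0': "conj_var (star y) l k {y} \<eta>0'" "norm \<eta>0' \<le> norm \<eta>'"
      by (rule conj_var_restrict[OF cv(4), of "{y}"]) (use kl in \<open>auto simp: star_star\<close>)
    show ?thesis
      by (rule exI[of _ \<xi>0], rule exI[of _ \<xi>0'], rule exI[of _ \<eta>0], rule exI[of _ \<eta>0'])
        (use \<xi>0 \<xi>0' \<eta>0 \<eta>0' pair_x(1)[OF \<xi>0(1) \<eta>0(1)] pair_y(1)[OF \<xi>0'(1) \<eta>0'(1)] in simp)
  qed
  have super: "\<Phi> [x, star x] + \<Phi> [y, star y] \<le> \<Phi> [x, y, star x, star y]"
  proof (cases "\<Phi> [x, y, star x, star y] < \<infinity>")
    case True
    then obtain \<xi> \<xi>' \<eta> \<eta>' where cv: "conj_var x k l {y, star x, star y} \<xi>" "conj_var y k l {x, star x, star y} \<xi>'"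
      "conj_var (star x) l k {x, y, star y} \<eta>" "conj_var (star y) l k {x, y, star x} \<eta>'"
      using quad(2) by blast
    obtain \<xi>0 \<xi>0' \<eta>0 \<eta>0' :: 'h where *: "\<Phi> [x, star x] = ennreal ((norm \<xi>0)\<^sup>2) + ennreal ((norm \<eta>0)\<^sup>2)"
      "\<Phi> [y, star y] = ennreal ((norm \<xi>0')\<^sup>2) + ennreal ((norm \<eta>0')\<^sup>2)"
      "norm \<xi>0 \<le> norm \<xi>" "norm \<xi>0' \<le> norm \<xi>'" "norm \<eta>0 \<le> norm \<eta>" "norm \<eta>0' \<le> norm \<eta>'"
      using dec[OF cv] by (elim exE conjE) (rule that; assumption)
    have "ennreal ((norm \<xi>0)\<^sup>2) + ennreal ((norm \<xi>0')\<^sup>2) + ennreal ((norm \<eta>0)\<^sup>2) + ennreal ((norm \<eta>0')\<^sup>2)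
        \<le> \<Phi> [x, y, star x, star y]"
      unfolding quad(1)[OF cv] using *(3-6) by (intro add_mono ennreal_leI power_mono) auto
    then show ?thesis unfolding *(1,2) by (simp add: ac_simps)
  next
    case False
    then have "\<Phi> [x, y, star x, star y] = top" unfolding infinity_ennreal_def less_top[symmetric] by blast
    then show ?thesis by simp
  qed
  have equality: "\<Phi> [x, y, star x, star y] = \<Phi> [x, star x] + \<Phi> [y, star y]"
    if fr: "free_elements \<phi> d p (\<lambda>b::bool. if b then x else y)"
  proof (cases "\<Phi> [x, star x] + \<Phi> [y, star y] < \<infinity>")
    case True
    then have "\<Phi> [x, star x] < \<infinity>" "\<Phi> [y, star y] < \<infinity>" by simp_all
    then obtain \<xi> \<xi>' \<eta> \<eta>' where cv: "conj_var x k l {star x} \<xi>" "conj_var (star x) l k {x} \<eta>"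
      "conj_var y k l {star y} \<xi>'" "conj_var (star y) l k {y} \<eta>'"
      using pair_x(2) pair_y(2) by blast
    obtain B where B: "free_subalgebras \<phi> d p B" "\<And>b. (if b then x else y) \<in> B b"
      using fr unfolding free_elements_def by blast
    interpret free_family \<phi> d p emb B using B(1) by unfold_locales
    have mem: "x \<in> B True" "star x \<in> B True" "y \<in> B False" "star y \<in> B False"
      using B(2)[of True] B(2)[of False] B(1) unfolding free_subalgebras_def star_subalgebra_def by auto
    have "conj_var x k l ({star x} \<union> {y, star y}) \<xi>"
      by (rule conj_var_free_extension[OF cv(1), of True]) (use mem kl in auto)
    moreover have "conj_var (star x) l k ({x} \<union> {y, star y}) \<eta>"
      by (rule conj_var_free_extension[OF cv(2), of True]) (use mem kl in auto)
    moreover have "conj_var y k l ({star y} \<union> {x, star x}) \<xi>'"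
      by (rule conj_var_free_extension[OF cv(3), of False]) (use mem kl in auto)
    moreover have "conj_var (star y) l k ({y} \<union> {x, star x}) \<eta>'"
      by (rule conj_var_free_extension[OF cv(4), of False]) (use mem kl in auto)
    moreover have "{star x} \<union> {y, star y} = {y, star x, star y}" "{x} \<union> {y, star y} = {x, y, star y}"
      "{star y} \<union> {x, star x} = {x, star x, star y}" "{y} \<union> {x, star x} = {x, y, star x}" by auto
    ultimately have "\<Phi> [x, y, star x, star y] =
        ennreal ((norm \<xi>)\<^sup>2) + ennreal ((norm \<xi>')\<^sup>2) + ennreal ((norm \<eta>)\<^sup>2) + ennreal ((norm \<eta>')\<^sup>2)"
      by (intro quad(1)) simp_all
    then show ?thesis unfolding pair_x(1)[OF cv(1,2)] pair_y(1)[OF cv(3,4)] by (simp add: ac_simps)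
  next
    case False
    \<comment> \<open>If the right side is infinite, superadditivity makes the left side
      infinite.\<close>
    then have "\<Phi> [x, star x] + \<Phi> [y, star y] = top" unfolding infinity_ennreal_def less_top[symmetric] by blast
    then show ?thesis using super by (metis top_unique)
  qed
  have "free_elements \<phi> d p (\<lambda>b::bool. if b then x else y)"
    if eq: "\<Phi> [x, y, star x, star y] = \<Phi> [x, star x] + \<Phi> [y, star y]"
      and fin: "\<Phi> [x, star x] + \<Phi> [y, star y] < \<infinity>"
  proof -
    obtain \<xi> \<xi>' \<eta> \<eta>' where cv: "conj_var x k l {y, star x, star y} \<xi>" "conj_var y k l {x, star x, star y} \<xi>'"
      "conj_var (star x) l k {x, y, star y} \<eta>" "conj_var (star y) l k {x, y, star x} \<eta>'"
      using quad(2) eq fin by auto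
    obtain \<xi>0 \<xi>0' \<eta>0 \<eta>0' :: 'h where *: "\<Phi> [x, star x] = ennreal ((norm \<xi>0)\<^sup>2) + ennreal ((norm \<eta>0)\<^sup>2)"
      "\<Phi> [y, star y] = ennreal ((norm \<xi>0')\<^sup>2) + ennreal ((norm \<eta>0')\<^sup>2)"
      "conj_var x k l {star x} \<xi>0" "conj_var (star x) l k {x} \<eta>0"
      "norm \<xi>0 \<le> norm \<xi>" "norm \<xi>0' \<le> norm \<xi>'" "norm \<eta>0 \<le> norm \<eta>" "norm \<eta>0' \<le> norm \<eta>'"
      "norm \<xi>0 = norm \<xi> \<longrightarrow> \<xi>0 = \<xi>" "norm \<eta>0 = norm \<eta> \<longrightarrow> \<eta>0 = \<eta>"
      using dec[OF cv] by (elim exE conjE) (rule that; assumption)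
    \<comment> \<open>All terms are finite, so the identity descends to the reals; four squares
      dominated term by term and with equal sums agree term by term.\<close>
    have "ennreal ((norm \<xi>)\<^sup>2 + (norm \<xi>')\<^sup>2 + (norm \<eta>)\<^sup>2 + (norm \<eta>')\<^sup>2) =
        ennreal ((norm \<xi>0)\<^sup>2 + (norm \<eta>0)\<^sup>2 + ((norm \<xi>0')\<^sup>2 + (norm \<eta>0')\<^sup>2))"
      using eq unfolding quad(1)[OF cv] *(1,2) by (simp add: ennreal_plus)
    then have "(norm \<xi>)\<^sup>2 + (norm \<xi>')\<^sup>2 + (norm \<eta>)\<^sup>2 + (norm \<eta>')\<^sup>2 =
        (norm \<xi>0)\<^sup>2 + (norm \<eta>0)\<^sup>2 + ((norm \<xi>0')\<^sup>2 + (norm \<eta>0')\<^sup>2)"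
      by (subst (asm) ennreal_inj) auto
    moreover have "(norm \<xi>0)\<^sup>2 \<le> (norm \<xi>)\<^sup>2" "(norm \<xi>0')\<^sup>2 \<le> (norm \<xi>')\<^sup>2"
      "(norm \<eta>0)\<^sup>2 \<le> (norm \<eta>)\<^sup>2" "(norm \<eta>0')\<^sup>2 \<le> (norm \<eta>')\<^sup>2"
      using *(5-8) by (auto intro: power_mono)
    ultimately have "(norm \<xi>0)\<^sup>2 = (norm \<xi>)\<^sup>2" "(norm \<eta>0)\<^sup>2 = (norm \<eta>)\<^sup>2" by linarith+
    then have "\<xi>0 = \<xi>" "\<eta>0 = \<eta>" using *(9,10) by simp_all
    then have "\<xi> \<in> closure (emb ` algebra_generated ({x, star x} \<union> diagonal d p))"
      "\<eta> \<in> closure (emb ` algebra_generated ({x, star x} \<union> diagonal d p))"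
      using *(3,4) unfolding conj_var_def by (auto simp: insert_commute)
    then show ?thesis by (rule free_if_conj_var_in_closure[OF kl(1,2) x(1) cv(1) _ cv(3)])
  qed
  then show ?thesis using super equality by blast
qed

end
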